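(* Let $N\ge 2$, let $\gamma>0$, and let $a,b,c\in\mathbb{R}$ satisfy either (A1) $0<b<\min\{a,c\}$ or (A2) $a,c>0$ and $b>\max\{a,c\}$. Let $\omega>\frac{\gamma^2}{N^2}$ satisfy $N\sqrt{\omega}-\gamma\le\frac{2\gamma}{N}$, and put $\alpha=\frac{2(b-c)}{b^2-ac}(N\sqrt\omega-\gamma)$, $\beta=\frac{2(b-a)}{b^2-ac}(N\sqrt\omega-\gamma)$. Then: (i) Any minimizing sequence $\{(u_n,v_n)\}$ for $J(\alpha,\beta)$ is relatively compact in $X$; that is, there exist a subsequence $\{(u_{n_k},v_{n_k})\}$ and $(\Phi_1,\Phi_2)\in X$ such that $(u_{n_k},v_{n_k})\to(\Phi_1,\Phi_2)$ in $X$. Therefore there exists a minimizer for the problem defining $J(\alpha,\beta)$, and hence $\mathcal{G}(\alpha,\beta)$ is non-empty. (ii) For each minimizing sequence $\{(u_n,v_n)\}$ for $J(\alpha,\beta)$, $$\lim_{n\to\infty}\ \inf_{(\Phi_1,\Phi_2)\in\mathcal{G}(\alpha,\beta)}\|(u_n,v_n)-(\Phi_1,\Phi_2)\|_X=0.$$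
   Context: $\Gamma$ is the star graph made of $N\ge2$ half-lines $I_e=\mathbb{R}^+$, $e=1,\dots,N$, joined at the common vertex $0$. A function $u$ on $\Gamma$ is a vector $u=(u_e)_{e=1}^N$ of functions $u_e:\mathbb{R}^+\to\mathbb{C}$. $L^p(\Gamma)$ is the set of $u$ with $u_e\in L^p(\mathbb{R}^+)$ for all $e$, with $\|u\|_p^p=\sum_e\|u_e\|_{L^p(\mathbb{R}^+)}^p$ for $p<\infty$. $H^1(\Gamma)$ is the set of $u$ with $u_e\in H^1(\mathbb{R}^+)$ for all $e$ and $u_1(0)=\dots=u_N(0)$, with $\|u\|_{H^1}^2=\|u\|_2^2+\|u'\|_2^2$. Products, derivatives and moduli are taken componentwise. $X=H^1(\Gamma)\times H^1(\Gamma)$ with $\|(u,v)\|_X^2=\|u\|_{H^1}^2+\|v\|_{H^1}^2$. Energy: $E(u,v)=\|u'\|_2^2+\|v'\|_2^2-\gamma(|u_1(0)|^2+|v_1(0)|^2)-\frac12(a\|u\|_4^4+c\|v\|_4^4)-b\|uv\|_2^2$. $J(\alpha,\beta)=\inf\{E(u,v): u,v\in H^1(\Gamma),\ \|u\|_2^2=\alpha,\ \|v\|_2^2=\beta\}$. A minimizing sequence for $J(\alpha,\beta)$ is a sequence $\{(u_n,v_n)\}\subset X$ with $\|u_n\|_2^2=\alpha$, $\|v_n\|_2^2=\beta$ for all $n$ and $E(u_n,v_n)\to J(\alpha,\beta)$. $\mathcal{G}(\alpha,\beta)=\{(u,v)\in X: E(u,v)=J(\alpha,\beta),\ \|u\|_2^2=\alpha,\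 \|v\|_2^2=\beta\}$. *)

theory Defs
  imports "HOL-Analysis.Analysis"
begin

text \<open>
  A function on the star graph with \<open>N\<close> half-lines is a family \<open>u e x\<close> with edges \<open>e = 1, \<dots>, N\<close>
  and \<open>x \<ge> 0\<close>; its values for other \<open>e\<close> or \<open>x\<close> are irrelevant. Accordingly the norms below are
  norms up to the usual identification of functions that agree almost everywhere on each edge.
\<close>

type_synonym graph_fun = "nat \<Rightarrow> real \<Rightarrow> complex"

abbreviation halfline :: "real measure" where
  "halfline \<equiv> lebesgue_on {0..}"

definition Lp_halfline :: "nat \<Rightarrow> (real \<Rightarrow> complex) set" where
  "Lp_halfline p =
     {f \<in> borel_measurable halfline. integrable halfline (\<lambda>x. cmod (f x) ^ p)}"

definition test_fun :: "(real \<Rightarrow> real) \<Rightarrow> bool" where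
  "test_fun \<phi> \<longleftrightarrow>
     \<phi> C1_differentiable_on UNIV \<and>
     compact (closure {x. \<phi> x \<noteq> 0}) \<and> closure {x. \<phi> x \<noteq> 0} \<subseteq> {0<..}"

definition has_weak_deriv :: "(real \<Rightarrow> complex) \<Rightarrow> (real \<Rightarrow> complex) \<Rightarrow> bool" where
  "has_weak_deriv f g \<longleftrightarrow>
     (\<forall>\<phi>. test_fun \<phi> \<longrightarrow>
        (LINT x|halfline. deriv \<phi> x *\<^sub>R f x) = - (LINT x|halfline. \<phi> x *\<^sub>R g x))"

text \<open>
  Every class in \<open>H\<^sup>1\<close> of the half-line has exactly one representative that is continuous on
  \<open>[0, \<infinity>)\<close>. Elements of \<open>H\<^sup>1\<close> are taken to be these representatives, so that the value at the
  vertex is just \<open>f 0\<close>.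
\<close>

definition H1_halfline :: "(real \<Rightarrow> complex) set" where
  "H1_halfline =
     {f \<in> Lp_halfline 2. continuous_on {0..} f \<and> (\<exists>g\<in>Lp_halfline 2. has_weak_deriv f g)}"

text \<open>The weak derivative is determined up to null sets; the choice does not affect its norms.\<close>

definition weak_deriv :: "(real \<Rightarrow> complex) \<Rightarrow> real \<Rightarrow> complex" where
  "weak_deriv f = (SOME g. g \<in> Lp_halfline 2 \<and> has_weak_deriv f g)"

definition graph_deriv :: "graph_fun \<Rightarrow> graph_fun" where
  "graph_deriv u = (\<lambda>e. weak_deriv (u e))"

definition Lp_norm :: "nat \<Rightarrow> nat \<Rightarrow> graph_fun \<Rightarrow> real" where
  "Lp_norm N p u = root p (\<Sum>e=1..N. LINT x|halfline. cmod (u e x) ^ p)"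

definition H1_graph :: "nat \<Rightarrow> graph_fun set" where
  "H1_graph N =
     {u. (\<forall>e\<in>{1..N}. u e \<in> H1_halfline) \<and> (\<forall>e\<in>{1..N}. \<forall>e'\<in>{1..N}. u e 0 = u e' 0)}"

definition H1_norm :: "nat \<Rightarrow> graph_fun \<Rightarrow> real" where
  "H1_norm N u = sqrt ((Lp_norm N 2 u)\<^sup>2 + (Lp_norm N 2 (graph_deriv u))\<^sup>2)"

definition X_space :: "nat \<Rightarrow> (graph_fun \<times> graph_fun) set" where
  "X_space N = H1_graph N \<times> H1_graph N"

definition X_norm :: "nat \<Rightarrow> graph_fun \<times> graph_fun \<Rightarrow> real" where
  "X_norm N w = sqrt ((H1_norm N (fst w))\<^sup>2 + (H1_norm N (snd w))\<^sup>2)"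

definition energy ::
    "nat \<Rightarrow> real \<Rightarrow> real \<Rightarrow> real \<Rightarrow> real \<Rightarrow> graph_fun \<times> graph_fun \<Rightarrow> real" where
  "energy N \<gamma> a b c w = (case w of (u, v) \<Rightarrow>
     (Lp_norm N 2 (graph_deriv u))\<^sup>2 + (Lp_norm N 2 (graph_deriv v))\<^sup>2
     - \<gamma> * ((cmod (u 1 0))\<^sup>2 + (cmod (v 1 0))\<^sup>2)
     - 1 / 2 * (a * Lp_norm N 4 u ^ 4 + c * Lp_norm N 4 v ^ 4)
     - b * (Lp_norm N 2 (\<lambda>e x. u e x * v e x))\<^sup>2)"

definition admissible :: "nat \<Rightarrow> real \<Rightarrow> real \<Rightarrow> (graph_fun \<times> graph_fun) set" where
  "admissible N \<alpha> \<beta> =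
     {(u, v) \<in> X_space N. (Lp_norm N 2 u)\<^sup>2 = \<alpha> \<and> (Lp_norm N 2 v)\<^sup>2 = \<beta>}"

text \<open>A real infimum: the energy is bounded below on the (non-empty) admissible set for
  \<open>\<alpha>, \<beta> > 0\<close>, by the Gagliardo--Nirenberg inequality.\<close>

definition J :: "nat \<Rightarrow> real \<Rightarrow> real \<Rightarrow> real \<Rightarrow> real \<Rightarrow> real \<Rightarrow> real \<Rightarrow> real" where
  "J N \<gamma> a b c \<alpha> \<beta> = (INF w\<in>admissible N \<alpha> \<beta>. energy N \<gamma> a b c w)"

definition minimizing_seq ::
    "nat \<Rightarrow> real \<Rightarrow> real \<Rightarrow> real \<Rightarrow> real \<Rightarrow> real \<Rightarrow> real
      \<Rightarrow> (nat \<Rightarrow> graph_fun \<times> graph_fun) \<Rightarrow> bool" where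
  "minimizing_seq N \<gamma> a b c \<alpha> \<beta> w \<longleftrightarrow>
     (\<forall>n. w n \<in> admissible N \<alpha> \<beta>) \<and>
     (\<lambda>n. energy N \<gamma> a b c (w n)) \<longlonglongrightarrow> J N \<gamma> a b c \<alpha> \<beta>"

definition ground_states ::
    "nat \<Rightarrow> real \<Rightarrow> real \<Rightarrow> real \<Rightarrow> real \<Rightarrow> real \<Rightarrow> real \<Rightarrow> (graph_fun \<times> graph_fun) set" where
  "ground_states N \<gamma> a b c \<alpha> \<beta> =
     {w \<in> admissible N \<alpha> \<beta>. energy N \<gamma> a b c w = J N \<gamma> a b c \<alpha> \<beta>}"

end

theory Submission
  imports Defs
begin

text \<open>
  Put \<open>t = \<surd>\<omega>\<close>, \<open>\<sigma> = N t - \<gamma>\<close>, \<open>A\<^sup>2 = (b - c) / (b\<^sup>2 - a c)\<close> and \<open>B\<^sup>2 = (b - a) / (b\<^sup>2 - a c)\<close>, so that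
  \<open>a A\<^sup>2 + b B\<^sup>2 = c B\<^sup>2 + b A\<^sup>2 = 1\<close>. Since \<open>b > 0\<close>, Young's inequality bounds the coupling term by the two
  quartic terms, and \<open>E(u,v)\<close> is at least the sum of the scalar energies
  \<open>E\<^sub>k(f) = \<parallel>f'\<parallel>\<^sup>2 - \<gamma> |f(0)|\<^sup>2 - k \<parallel>f\<parallel>\<^sub>4\<^sup>4 / 2\<close> of \<open>u\<close> and \<open>v\<close>, where \<open>k = 1 / A\<^sup>2\<close>, respectively \<open>k = 1 / B\<^sup>2\<close>, and the
  mass is \<open>2 \<sigma> / k\<close>. Equality holds at multiples of the sech soliton, so it suffices to treat \<open>E\<^sub>k\<close>.

  On one edge let \<open>T(x) = t - k/2 \<integral>\<^sub>x\<^sup>\<infinity> |f|\<^sup>2\<close>, \<open>z = T(0)\<close> and \<open>D = f' + T f\<close>. Completing the square with this nonlocal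
  factor gives the exact identity
  \<open>\<integral> |f'|\<^sup>2 - k/2 \<integral> |f|\<^sup>4 = \<integral> |D|\<^sup>2 + z |f(0)|\<^sup>2 - 2 (t\<^sup>3 - z\<^sup>3) / (3 k)\<close>. The mass constraint says that the \<open>z\<close> of all edges add
  up to \<open>\<gamma>\<close>, which cancels the vertex term. With \<open>z\<^sub>0 = \<gamma> / N\<close> it follows that \<open>E\<^sub>k(f)\<close> exceeds its value at the soliton by
  \<open>\<Sum> \<integral> |D|\<^sup>2 + 2 / (3 k) \<Sum> (z - z\<^sub>0)\<^sup>2 (z + 2 z\<^sub>0)\<close>, and \<open>\<sigma> \<le> 2 z\<^sub>0\<close> makes \<open>z + 2 z\<^sub>0 \<ge> t\<close>. Along a minimizing sequence
  \<open>D \<rightarrow> 0\<close> in \<open>L\<^sup>2\<close> and \<open>z \<rightarrow> z\<^sub>0\<close>; stability of the equations \<open>f' = - T f\<close> and \<open>T' = t\<^sup>2 - T\<^sup>2\<close> turns this into \<open>H\<^sup>1\<close>-convergence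
  to the soliton up to phases, which lie on the compact unit circle.
\<close>

section \<open>Absolutely continuous functions on the half-line\<close>

text \<open>Local absolute continuity on the half-line, encoded by the fundamental theorem of
  calculus. The derivative \<open>g\<close> is a parameter because it is determined only up to null
  sets; values at negative arguments are left free.\<close>

definition has_ac_deriv :: "(real \<Rightarrow> 'a::euclidean_space) \<Rightarrow> (real \<Rightarrow> 'a) \<Rightarrow> bool" where
  "has_ac_deriv f g \<longleftrightarrow>
     (\<forall>x\<ge>0. g absolutely_integrable_on {0..x} \<and> f x = f 0 + integral {0..x} g)"

lemma has_ac_deriv_eq:
  "has_ac_deriv f g \<Longrightarrow> 0 \<le> x \<Longrightarrow> f x = f 0 + integral {0..x} g"
  unfolding has_ac_deriv_def by blast

lemma has_ac_deriv_abs_int: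
  assumes "has_ac_deriv f g" "0 \<le> a"
  shows "g absolutely_integrable_on {a..b}"
proof (cases "a \<le> b")
  case True
  then have "g absolutely_integrable_on {0..b}" "{a..b} \<subseteq> {0..b}"
    using assms unfolding has_ac_deriv_def by auto
  then show ?thesis
    using set_integrable_subset[of lebesgue "{0..b}" g "{a..b}"] by auto
qed auto

lemma has_ac_deriv_int:
  assumes "has_ac_deriv f g" "0 \<le> a"
  shows "g integrable_on {a..b}"
  using has_ac_deriv_abs_int[OF assms] by (rule set_lebesgue_integral_eq_integral(1))

lemma has_ac_deriv_diff_eq:
  assumes "has_ac_deriv f g" "0 \<le> x" "x \<le> y"
  shows "f y - f x = integral {x..y} g"
proof -
  have "integral {0..x} g + integral {x..y} g = integral {0..y} g"
    by (intro Henstock_Kurzweil_Integration.integral_combine has_ac_deriv_int[OF assms(1)])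
      (use assms in auto)
  moreover have "f x = f 0 + integral {0..x} g" "f y = f 0 + integral {0..y} g"
    using assms by (auto intro: has_ac_deriv_eq)
  ultimately show ?thesis by (simp add: algebra_simps)
qed

lemma has_ac_deriv_continuous:
  assumes "has_ac_deriv f g"
  shows "continuous_on {0..} f"
proof -
  have "continuous_on {0..b} f" for b
  proof -
    have "continuous_on {0..b} (\<lambda>x. f 0 + integral {0..x} g)"
      by (intro continuous_intros indefinite_integral_continuous_1 has_ac_deriv_int[OF assms]) auto
    then show ?thesis
      by (rule continuous_on_eq) (simp add: has_ac_deriv_eq[OF assms, symmetric])
  qed
  then have "continuous (at x within {0..}) f" if "x \<ge> 0" for x
  proof -
    have "continuous (at x within {0..x+1}) f"
      using \<open>continuous_on {0..x+1} f\<close> that by (auto simp: continuous_on_eq_continuous_within)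
    moreover have "at x within {0..x+1} = at x within {0..}"
      by (rule at_within_nhd[of _ "{..<x+1}"]) auto
    ultimately show ?thesis by simp
  qed
  then show ?thesis by (auto simp: continuous_on_eq_continuous_within)
qed

section \<open>Products of integrable functions and the product rule\<close>

lemma bounded_times_abs_integrable:
  fixes f g :: "real \<Rightarrow> 'a::{euclidean_space, real_normed_field}"
  assumes "f \<in> borel_measurable (lebesgue_on S)" "S \<in> sets lebesgue" "bounded (f ` S)"
    "g absolutely_integrable_on S"
  shows "(\<lambda>x. f x * g x) absolutely_integrable_on S"
  by (rule absolutely_integrable_bounded_measurable_product[OF _ assms])
    (auto simp: bilinear_conv_bounded_bilinear bounded_bilinear_mult)

lemma continuous_times_abs_integrable:
  fixes f g :: "real \<Rightarrow> 'a::{euclidean_space, real_normed_field}"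
  assumes "continuous_on {a..b} f" "g absolutely_integrable_on {a..b}"
  shows "(\<lambda>x. f x * g x) absolutely_integrable_on {a..b}"
  by (rule bounded_times_abs_integrable)
    (use assms in \<open>auto intro: continuous_imp_measurable_on_sets_lebesgue
       compact_imp_bounded compact_continuous_image\<close>)

lemma absolutely_integrable_restrict_Int:
  "(\<lambda>x. if x \<in> T then f x else 0) absolutely_integrable_on S \<longleftrightarrow> f absolutely_integrable_on (T \<inter> S)"
  unfolding set_integrable_def
  by (intro arg_cong2[where f=integrable]) (auto simp: indicator_def)

text \<open>Fubini on the square with side \<open>{0..b}\<close>: the diagonal cuts the integral of
  \<open>g x * q s\<close> into two triangles, and each term on the left is the iterated integral
  over one of them.\<close>

lemma integral_product_indefinite:
  fixes g q :: "real \<Rightarrow> 'a::{euclidean_space, real_normed_field}"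
  assumes g: "g absolutely_integrable_on {0..b}" and q: "q absolutely_integrable_on {0..b}"
    and b: "0 \<le> b"
  shows "integral {0..b} (\<lambda>x. g x * integral {0..x} q) + integral {0..b} (\<lambda>x. integral {0..x} g * q x)
     = integral {0..b} g * integral {0..b} q"
proof -
  define M where "M = lebesgue_on {0..b}"
  have [simp]: "space M = {0..b}" by (simp add: M_def)
  interpret finite_measure M
    unfolding M_def by (rule finite_measure_lebesgue_on) auto
  interpret pair_sigma_finite M M ..
  have ig: "integrable M g" and iq: "integrable M q"
    unfolding M_def using g q by (auto intro!: absolutely_integrable_imp_integrable)
  have [measurable]: "g \<in> borel_measurable M" "q \<in> borel_measurable M"
    using ig iq by auto
  have [measurable]: "(\<lambda>x. x) \<in> borel_measurable M"
    unfolding M_def by (rule continuous_imp_measurable_on_sets_lebesgue) auto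
  have sub: "g absolutely_integrable_on {0..x}" "q absolutely_integrable_on {0..x}" if "x \<le> b" for x
    using g q that by (auto intro: set_integrable_subset[of _ "{0..b}"])
  have cont: "continuous_on {0..b} (\<lambda>x. integral {0..x} g)" "continuous_on {0..b} (\<lambda>x. integral {0..x} q)"
    using g q by (auto intro!: indefinite_integral_continuous_1 set_lebesgue_integral_eq_integral(1))
  have i: "integrable (M \<Otimes>\<^sub>M M) (\<lambda>(x, s). g x * q s)"
  proof (rule Fubini_integrable)
    show "integrable M (\<lambda>x. LINT y|M. norm (case (x, y) of (x, s) \<Rightarrow> g x * q s))"
      using ig iq by (simp add: norm_mult)
  qed (use iq in auto)
  \<comment> \<open>The diagonal is given to \<open>h1\<close>, so the section of \<open>h2\<close>
    at \<open>s\<close> is the half-open \<open>{0..<s}\<close>; it differs from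
    \<open>{0..s}\<close> by a null set.\<close>
  define h1 where "h1 = (\<lambda>x s. if s \<le> x then g x * q s else 0)"
  define h2 where "h2 = (\<lambda>x s. if x < s then g x * q s else 0)"
  have i1: "integrable (M \<Otimes>\<^sub>M M) (\<lambda>(x, s). h1 x s)"
    by (rule Bochner_Integration.integrable_bound[OF i]) (auto simp: h1_def)
  have i2: "integrable (M \<Otimes>\<^sub>M M) (\<lambda>(x, s). h2 x s)"
    by (rule Bochner_Integration.integrable_bound[OF i]) (auto simp: h2_def)
  have e1: "(LINT s|M. h1 x s) = g x * integral {0..x} q" if x: "x \<in> {0..b}" for x
  proof -
    have eq: "{..x} \<inter> {0..b} = {0..x}" using x by auto
    have "(\<lambda>s. if s \<in> {..x} then q s else 0) absolutely_integrable_on {0..b}"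
      using sub(2)[of x] x by (simp only: absolutely_integrable_restrict_Int eq) simp
    then have ii: "integrable M (\<lambda>s. if s \<le> x then q s else 0)"
      unfolding M_def by (simp add: absolutely_integrable_imp_integrable)
    have "(LINT s|M. h1 x s) = (LINT s|M. g x * (if s \<le> x then q s else 0))"
      by (rule Bochner_Integration.integral_cong) (simp_all add: h1_def)
    also have "\<dots> = g x * (LINT s|M. (if s \<le> x then q s else 0))"
      by (rule Bochner_Integration.integral_mult_right_zero)
    also have "(LINT s|M. (if s \<le> x then q s else 0)) = integral {0..b} (\<lambda>s. if s \<in> {..x} then q s else 0)"
      using ii unfolding M_def by (subst lebesgue_integral_eq_integral) auto
    also have "\<dots> = integral {0..x} q"
      by (subst integral_restrict_Int) (simp only: eq)
    finally show ?thesis .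
  qed
  have e2: "(LINT x|M. h2 x s) = integral {0..s} g * q s" if s: "s \<in> {0..b}" for s
  proof -
    have "g absolutely_integrable_on {0..<s}"
      using sub[of s] s by (auto intro: set_integrable_subset[of _ "{0..s}"])
    moreover have eq: "{..<s} \<inter> {0..b} = {0..<s}" using s by auto
    ultimately have "(\<lambda>x. if x \<in> {..<s} then g x else 0) absolutely_integrable_on {0..b}"
      by (simp only: absolutely_integrable_restrict_Int)
    then have ii: "integrable M (\<lambda>x. if x < s then g x else 0)"
      unfolding M_def by (simp add: absolutely_integrable_imp_integrable)
    have "(LINT x|M. h2 x s) = (LINT x|M. (if x < s then g x else 0) * q s)"
      by (rule Bochner_Integration.integral_cong) (simp_all add: h2_def)
    also have "\<dots> = (LINT x|M. (if x < s then g x else 0)) * q s"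
      by (rule Bochner_Integration.integral_mult_left_zero)
    also have "(LINT x|M. (if x < s then g x else 0)) = integral {0..b} (\<lambda>x. if x \<in> {..<s} then g x else 0)"
      using ii unfolding M_def by (subst lebesgue_integral_eq_integral) auto
    also have "\<dots> = integral {0..<s} g"
      by (subst integral_restrict_Int) (simp only: eq)
    also have "\<dots> = integral {0..s} g"
      by (rule integral_subset_negligible) (auto intro: negligible_subset[of "{s}"])
    finally show ?thesis .
  qed
  have "integral {0..b} (\<lambda>x. g x * integral {0..x} q) = (LINT x|M. g x * integral {0..x} q)"
    unfolding M_def
    by (rule lebesgue_integral_eq_integral[symmetric])
      (use continuous_times_abs_integrable[OF cont(2) g] in
        \<open>auto simp: mult.commute intro: absolutely_integrable_imp_integrable\<close>)
  also have "\<dots> = (LINT x|M. LINT s|M. h1 x s)"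
    by (rule Bochner_Integration.integral_cong) (auto simp: e1)
  also have "\<dots> = integral\<^sup>L (M \<Otimes>\<^sub>M M) (\<lambda>(x, s). h1 x s)"
    by (rule integral_fst[OF i1])
  finally have s1: "integral {0..b} (\<lambda>x. g x * integral {0..x} q) = \<dots>" .
  have "integral {0..b} (\<lambda>x. integral {0..x} g * q x) = (LINT x|M. integral {0..x} g * q x)"
    unfolding M_def
    by (rule lebesgue_integral_eq_integral[symmetric])
      (use continuous_times_abs_integrable[OF cont(1) q] in
        \<open>auto intro: absolutely_integrable_imp_integrable\<close>)
  also have "\<dots> = (LINT s|M. LINT x|M. h2 x s)"
    by (rule Bochner_Integration.integral_cong) (auto simp: e2)
  also have "\<dots> = integral\<^sup>L (M \<Otimes>\<^sub>M M) (\<lambda>(x, s). h2 x s)"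
    by (rule integral_snd[OF i2])
  finally have s2: "integral {0..b} (\<lambda>x. integral {0..x} g * q x) = \<dots>" .
  have "integral\<^sup>L (M \<Otimes>\<^sub>M M) (\<lambda>(x, s). h1 x s) + integral\<^sup>L (M \<Otimes>\<^sub>M M) (\<lambda>(x, s). h2 x s)
     = integral\<^sup>L (M \<Otimes>\<^sub>M M) (\<lambda>(x, s). g x * q s)"
    by (subst Bochner_Integration.integral_add[OF i1 i2, symmetric])
      (auto simp: h1_def h2_def intro!: Bochner_Integration.integral_cong)
  also have "\<dots> = (LINT x|M. LINT s|M. g x * q s)"
    by (rule integral_fst[OF i, symmetric])
  also have "\<dots> = (LINT x|M. g x) * (LINT s|M. q s)"
    by simp
  also have "\<dots> = integral {0..b} g * integral {0..b} q"
    using ig iq unfolding M_def by (simp add: lebesgue_integral_eq_integral)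
  finally show ?thesis using s1 s2 by simp
qed

text \<open>Write both factors as initial value plus indefinite integral and expand. The terms
  quadratic in the integrals are those of \<open>integral_product_indefinite\<close>, so no
  pointwise differentiation is involved.\<close>

lemma has_ac_deriv_mult:
  fixes f g p q :: "real \<Rightarrow> 'a::{euclidean_space, real_normed_field}"
  assumes fg: "has_ac_deriv f g" and pq: "has_ac_deriv p q"
  shows "has_ac_deriv (\<lambda>x. f x * p x) (\<lambda>x. g x * p x + f x * q x)"
  unfolding has_ac_deriv_def
proof (intro allI impI conjI)
  fix b :: real assume b: "0 \<le> b"
  have g: "g absolutely_integrable_on {0..b}" and q: "q absolutely_integrable_on {0..b}"
    using has_ac_deriv_abs_int fg pq by blast+
  have cf: "continuous_on {0..b} f" and cp: "continuous_on {0..b} p"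
    using has_ac_deriv_continuous[OF fg] has_ac_deriv_continuous[OF pq]
    by (auto elim: continuous_on_subset)
  have a1: "(\<lambda>x. g x * p x) absolutely_integrable_on {0..b}"
    using continuous_times_abs_integrable[OF cp g] by (simp add: mult.commute)
  have a2: "(\<lambda>x. f x * q x) absolutely_integrable_on {0..b}"
    using continuous_times_abs_integrable[OF cf q] .
  from a1 a2 show "(\<lambda>x. g x * p x + f x * q x) absolutely_integrable_on {0..b}"
    by (rule set_integral_add)
  have cG: "continuous_on {0..b} (\<lambda>x. integral {0..x} g)" and cQ: "continuous_on {0..b} (\<lambda>x. integral {0..x} q)"
    using g q by (auto intro!: indefinite_integral_continuous_1 set_lebesgue_integral_eq_integral(1))
  have gi: "g integrable_on {0..b}" "q integrable_on {0..b}"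
    using g q by (auto intro: set_lebesgue_integral_eq_integral(1))
  have ig: "(\<lambda>x. g x * integral {0..x} q) integrable_on {0..b}"
    using continuous_times_abs_integrable[OF cQ g]
    by (auto simp: mult.commute intro: set_lebesgue_integral_eq_integral(1))
  have iq: "(\<lambda>x. integral {0..x} g * q x) integrable_on {0..b}"
    using continuous_times_abs_integrable[OF cG q]
    by (auto intro: set_lebesgue_integral_eq_integral(1))
  have fx: "f x = f 0 + integral {0..x} g" "p x = p 0 + integral {0..x} q" if "x \<in> {0..b}" for x
    using that has_ac_deriv_eq[OF fg, of x] has_ac_deriv_eq[OF pq, of x] by simp_all
  have "integral {0..b} (\<lambda>x. g x * p x + f x * q x)
      = integral {0..b} (\<lambda>x. (g x * p 0 + f 0 * q x) + (g x * integral {0..x} q + integral {0..x} g * q x))"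
  proof (rule Henstock_Kurzweil_Integration.integral_cong)
    fix x assume "x \<in> {0..b}"
    then show "g x * p x + f x * q x
      = (g x * p 0 + f 0 * q x) + (g x * integral {0..x} q + integral {0..x} g * q x)"
      by (simp only: fx[of x]) (simp add: algebra_simps)
  qed
  also have "\<dots> = integral {0..b} (\<lambda>x. g x * p 0 + f 0 * q x)
      + integral {0..b} (\<lambda>x. g x * integral {0..x} q + integral {0..x} g * q x)"
    by (intro Henstock_Kurzweil_Integration.integral_add integrable_add gi ig iq
        integrable_on_mult_left integrable_on_mult_right)
  also have "integral {0..b} (\<lambda>x. g x * p 0 + f 0 * q x) = integral {0..b} g * p 0 + f 0 * integral {0..b} q"
    by (subst Henstock_Kurzweil_Integration.integral_add)
      (auto simp: gi integrable_on_mult_left integrable_on_mult_right)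
  also have "integral {0..b} (\<lambda>x. g x * integral {0..x} q + integral {0..x} g * q x)
      = integral {0..b} g * integral {0..b} q"
    using integral_product_indefinite[OF g q b]
    by (subst Henstock_Kurzweil_Integration.integral_add) (auto simp: ig iq)
  finally have "integral {0..b} (\<lambda>x. g x * p x + f x * q x)
      = integral {0..b} g * p 0 + f 0 * integral {0..b} q + integral {0..b} g * integral {0..b} q" .
  moreover have "f b * p b = (f 0 + integral {0..b} g) * (p 0 + integral {0..b} q)"
    using fx[of b] b by simp
  ultimately show "f b * p b = f 0 * p 0 + integral {0..b} (\<lambda>x. g x * p x + f x * q x)"
    by (simp add: algebra_simps)
qed

section \<open>Integrable and square-integrable functions on the half-line\<close>

lemma halfline_integrable_iff:
  fixes f :: "real \<Rightarrow> 'a::euclidean_space"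
  shows "integrable halfline f \<longleftrightarrow> f absolutely_integrable_on {0..}"
  unfolding set_integrable_def by (subst integrable_restrict_space) auto

lemma halfline_integral:
  fixes f :: "real \<Rightarrow> 'a::euclidean_space"
  assumes "f absolutely_integrable_on {0..}"
  shows "(LINT x|halfline. f x) = integral {0..} f"
  using assms by (intro lebesgue_integral_eq_integral) (auto simp: halfline_integrable_iff)

lemma halfline_measurable:
  fixes f :: "real \<Rightarrow> 'a::euclidean_space"
  assumes "f absolutely_integrable_on {0..}"
  shows "f \<in> borel_measurable halfline"
  using assms by (simp flip: halfline_integrable_iff)

lemma abs_int_intervals:
  fixes f :: "real \<Rightarrow> 'a::euclidean_space"
  assumes "f absolutely_integrable_on {0..}" "0 \<le> a"
  shows "f absolutely_integrable_on {a..b}"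
  using assms by (auto intro: set_integrable_subset[of _ "{0..}"])

lemma abs_int_integrable:
  fixes f :: "real \<Rightarrow> 'a::euclidean_space"
  shows "f absolutely_integrable_on S \<Longrightarrow> f integrable_on S"
  by (rule set_lebesgue_integral_eq_integral(1))

lemma abs_int_bound:
  fixes f :: "real \<Rightarrow> 'a::euclidean_space" and h :: "real \<Rightarrow> real"
  assumes "f \<in> borel_measurable halfline" "h absolutely_integrable_on {0..}"
    "\<And>x. 0 \<le> x \<Longrightarrow> norm (f x) \<le> h x"
  shows "f absolutely_integrable_on {0..}"
  by (rule measurable_bounded_by_integrable_imp_absolutely_integrable[of _ _ h])
    (use assms abs_int_integrable in auto)

lemma Lp_halfline_2_iff:
  "f \<in> Lp_halfline 2 \<longleftrightarrow>
     f \<in> borel_measurable halfline \<and> (\<lambda>x. (cmod (f x))\<^sup>2) absolutely_integrable_on {0..}"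
  by (simp add: Lp_halfline_def halfline_integrable_iff)

lemma L2_mult:
  assumes "f \<in> Lp_halfline 2" "g \<in> Lp_halfline 2"
  shows "(\<lambda>x. f x * g x) absolutely_integrable_on {0..}"
proof (rule abs_int_bound)
  show "(\<lambda>x. (cmod (f x))\<^sup>2 + (cmod (g x))\<^sup>2) absolutely_integrable_on {0..}"
    using assms by (intro set_integral_add) (auto simp: Lp_halfline_2_iff)
  show "norm (f x * g x) \<le> (cmod (f x))\<^sup>2 + (cmod (g x))\<^sup>2" for x
    using sum_squares_bound[of "cmod (f x)" "cmod (g x)"] mult_nonneg_nonneg[OF norm_ge_zero norm_ge_zero, of "f x" "g x"]
    unfolding norm_mult by linarith
qed (use assms in \<open>auto simp: Lp_halfline_2_iff\<close>)

lemma L2_cnj: "f \<in> Lp_halfline 2 \<Longrightarrow> (\<lambda>x. cnj (f x)) \<in> Lp_halfline 2"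
  using measurable_compose[OF _ borel_measurable_continuous_onI[of cnj], of f halfline]
  by (auto simp: Lp_halfline_2_iff continuous_on_cnj continuous_on_id)

lemma cmod_add_square_le: "(cmod (z + w))\<^sup>2 \<le> 2 * (cmod z)\<^sup>2 + 2 * (cmod w)\<^sup>2"
proof -
  have "(cmod (z + w))\<^sup>2 \<le> (cmod z + cmod w)\<^sup>2"
    by (intro power_mono norm_triangle_ineq) auto
  then show ?thesis
    using sum_squares_bound[of "cmod z" "cmod w"] by (simp add: power2_sum)
qed

lemma L2_add:
  assumes "f \<in> Lp_halfline 2" "g \<in> Lp_halfline 2"
  shows "(\<lambda>x. f x + g x) \<in> Lp_halfline 2"
  unfolding Lp_halfline_2_iff
proof
  show "(\<lambda>x. f x + g x) \<in> borel_measurable halfline"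
    using assms by (auto simp: Lp_halfline_2_iff)
  then have m: "(\<lambda>x. (cmod (f x + g x))\<^sup>2) \<in> borel_measurable halfline"
    by measurable
  show "(\<lambda>x. (cmod (f x + g x))\<^sup>2) absolutely_integrable_on {0..}"
  proof (rule abs_int_bound[OF m])
    show "(\<lambda>x. 2 * (cmod (f x))\<^sup>2 + 2 * (cmod (g x))\<^sup>2) absolutely_integrable_on {0..}"
      using assms by (intro set_integral_add) (auto simp: Lp_halfline_2_iff)
    show "norm ((cmod (f x + g x))\<^sup>2) \<le> 2 * (cmod (f x))\<^sup>2 + 2 * (cmod (g x))\<^sup>2" for x
      using cmod_add_square_le by simp
  qed
qed

lemma L2_bounded_mult:
  fixes h :: "real \<Rightarrow> complex"
  assumes "h \<in> borel_measurable halfline" "\<And>x. 0 \<le> x \<Longrightarrow> cmod (h x) \<le> C" "f \<in> Lp_halfline 2"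
  shows "(\<lambda>x. h x * f x) \<in> Lp_halfline 2"
  unfolding Lp_halfline_2_iff
proof
  show "(\<lambda>x. h x * f x) \<in> borel_measurable halfline"
    using assms by (auto simp: Lp_halfline_2_iff)
  then have m: "(\<lambda>x. (cmod (h x * f x))\<^sup>2) \<in> borel_measurable halfline"
    by measurable
  show "(\<lambda>x. (cmod (h x * f x))\<^sup>2) absolutely_integrable_on {0..}"
  proof (rule abs_int_bound[OF m])
    show "(\<lambda>x. C\<^sup>2 * (cmod (f x))\<^sup>2) absolutely_integrable_on {0..}"
      using assms by (intro set_integrable_mult_right) (auto simp: Lp_halfline_2_iff)
    show "norm ((cmod (h x * f x))\<^sup>2) \<le> C\<^sup>2 * (cmod (f x))\<^sup>2" if "0 \<le> x" for x
      using assms(2)[OF that] by (auto simp: norm_mult power_mult_distrib intro!: mult_right_mono power_mono)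
  qed
qed

lemma L2_cmult: "f \<in> Lp_halfline 2 \<Longrightarrow> (\<lambda>x. z * f x) \<in> Lp_halfline 2"
  using L2_bounded_mult[of "\<lambda>_. z" "cmod z" f] by simp

lemma L2_diff: "f \<in> Lp_halfline 2 \<Longrightarrow> g \<in> Lp_halfline 2 \<Longrightarrow> (\<lambda>x. f x - g x) \<in> Lp_halfline 2"
  using L2_add[of f "\<lambda>x. (-1) * g x"] L2_cmult[of g "-1"] by simp

text \<open>Evaluate at the minimizer \<open>s = B / C\<close>; for \<open>C = 0\<close> the
  expression is affine in \<open>s\<close>, so its slope must vanish.\<close>

lemma quadratic_discriminant_le:
  fixes A B C :: real
  assumes "\<And>s. 0 \<le> A - 2 * s * B + s\<^sup>2 * C" "0 \<le> C"
  shows "B\<^sup>2 \<le> A * C"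
proof (cases "C = 0")
  case True
  have "B = 0"
  proof (rule ccontr)
    assume "B \<noteq> 0"
    \<comment> \<open>At this \<open>s\<close> the affine expression takes the value
      \<open>-1\<close>.\<close>
    with assms(1)[of "(A + 1) / (2 * B)"] True show False by (simp add: field_simps)
  qed
  then show ?thesis using True by simp
next
  case False
  with assms(2) have "0 < C" by simp
  have "0 \<le> A - 2 * (B / C) * B + (B / C)\<^sup>2 * C" by (rule assms(1))
  also have "\<dots> = A - B\<^sup>2 / C" using \<open>0 < C\<close> by (simp add: power2_eq_square)
  finally show ?thesis using \<open>0 < C\<close> by (simp add: field_simps)
qed

text \<open>The integral of \<open>(cmod (f x) - s * cmod (g x))\<^sup>2\<close> is a nonnegative
  quadratic in \<open>s\<close>; the bound is the sign of its discriminant.\<close>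

lemma L2_Cauchy_Schwarz:
  assumes f: "f \<in> Lp_halfline 2" and g: "g \<in> Lp_halfline 2"
  shows "(integral {0..} (\<lambda>x. cmod (f x * g x)))\<^sup>2
     \<le> integral {0..} (\<lambda>x. (cmod (f x))\<^sup>2) * integral {0..} (\<lambda>x. (cmod (g x))\<^sup>2)"
proof (rule quadratic_discriminant_le)
  have i: "(\<lambda>x. cmod (f x * g x)) integrable_on {0..}" "(\<lambda>x. (cmod (f x))\<^sup>2) integrable_on {0..}"
      "(\<lambda>x. (cmod (g x))\<^sup>2) integrable_on {0..}"
    using L2_mult[OF f g] f g by (auto simp: Lp_halfline_2_iff absolutely_integrable_on_def
        intro: abs_int_integrable)
  fix s :: real
  have eq: "(cmod (f x) - s * cmod (g x))\<^sup>2
      = (cmod (f x))\<^sup>2 - 2 * s * cmod (f x * g x) + s\<^sup>2 * (cmod (g x))\<^sup>2" for x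
    by (simp add: power2_diff norm_mult power_mult_distrib algebra_simps)
  have "0 \<le> integral {0..} (\<lambda>x. (cmod (f x))\<^sup>2 - 2 * s * cmod (f x * g x) + s\<^sup>2 * (cmod (g x))\<^sup>2)"
    by (intro Henstock_Kurzweil_Integration.integral_nonneg integrable_add integrable_diff
        integrable_on_mult_right i) (simp flip: eq)
  also have "\<dots> = integral {0..} (\<lambda>x. (cmod (f x))\<^sup>2) - 2 * s * integral {0..} (\<lambda>x. cmod (f x * g x))
      + s\<^sup>2 * integral {0..} (\<lambda>x. (cmod (g x))\<^sup>2)"
    using i by (simp add: Henstock_Kurzweil_Integration.integral_add Henstock_Kurzweil_Integration.integral_diff
        integrable_on_mult_right integrable_diff del: norm_mult)
  finally show "0 \<le> \<dots>" .
next
  show "0 \<le> integral {0..} (\<lambda>x. (cmod (g x))\<^sup>2)"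
    using g by (intro Henstock_Kurzweil_Integration.integral_nonneg abs_int_integrable)
      (auto simp: Lp_halfline_2_iff)
qed

section \<open>Calculus rules for absolutely continuous functions\<close>

lemma has_ac_deriv_linear:
  assumes "bounded_linear h" "has_ac_deriv f g"
  shows "has_ac_deriv (\<lambda>x. h (f x)) (\<lambda>x. h (g x))"
  unfolding has_ac_deriv_def
proof (intro allI impI conjI)
  fix x :: real assume x: "0 \<le> x"
  have gi: "g absolutely_integrable_on {0..x}"
    using has_ac_deriv_abs_int[OF assms(2)] by auto
  then show "(\<lambda>x. h (g x)) absolutely_integrable_on {0..x}"
    using absolutely_integrable_linear[OF _ assms(1)] by (simp add: o_def)
  have "h (f x) = h (f 0 + integral {0..x} g)"
    using has_ac_deriv_eq[OF assms(2) x] by simp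
  also have "\<dots> = h (f 0) + h (integral {0..x} g)"
    using assms(1) by (simp add: bounded_linear.linear linear_add)
  also have "h (integral {0..x} g) = integral {0..x} (\<lambda>x. h (g x))"
    using integral_linear[OF abs_int_integrable[OF gi] assms(1)] by (simp add: o_def)
  finally show "h (f x) = h (f 0) + integral {0..x} (\<lambda>x. h (g x))" .
qed

lemma has_ac_deriv_const: "has_ac_deriv (\<lambda>x. c) (\<lambda>x. 0)"
  by (simp add: has_ac_deriv_def)

lemma has_ac_deriv_add:
  assumes "has_ac_deriv f g" "has_ac_deriv p q"
  shows "has_ac_deriv (\<lambda>x. f x + p x) (\<lambda>x. g x + q x)"
  unfolding has_ac_deriv_def
proof (intro allI impI conjI)
  fix x :: real assume x: "0 \<le> x"
  have gi: "g absolutely_integrable_on {0..x}" "q absolutely_integrable_on {0..x}"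
    using has_ac_deriv_abs_int assms by auto
  then show "(\<lambda>x. g x + q x) absolutely_integrable_on {0..x}"
    by (rule set_integral_add)
  show "f x + p x = f 0 + p 0 + integral {0..x} (\<lambda>x. g x + q x)"
    using has_ac_deriv_eq[OF assms(1) x] has_ac_deriv_eq[OF assms(2) x]
      Henstock_Kurzweil_Integration.integral_add[OF gi[THEN abs_int_integrable]] by simp
qed

lemma has_ac_deriv_cmult:
  fixes f g :: "real \<Rightarrow> 'a::{euclidean_space, real_normed_field}"
  shows "has_ac_deriv f g \<Longrightarrow> has_ac_deriv (\<lambda>x. c * f x) (\<lambda>x. c * g x)"
  by (rule has_ac_deriv_linear) (rule bounded_linear_mult_right)

lemma has_ac_deriv_diff:
  assumes "has_ac_deriv f g" "has_ac_deriv p q"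
  shows "has_ac_deriv (\<lambda>x. f x - p x) (\<lambda>x. g x - q x)"
  using has_ac_deriv_add[OF assms(1) has_ac_deriv_linear[OF bounded_linear_minus[OF bounded_linear_ident] assms(2)]]
  by simp

lemma has_ac_deriv_cong:
  assumes "has_ac_deriv f g" "\<And>x. 0 \<le> x \<Longrightarrow> f x = f' x" "\<And>x. 0 \<le> x \<Longrightarrow> g x = g' x"
  shows "has_ac_deriv f' g'"
  unfolding has_ac_deriv_def
proof (intro allI impI conjI)
  fix x :: real assume x: "0 \<le> x"
  show "g' absolutely_integrable_on {0..x}"
    using has_ac_deriv_abs_int[OF assms(1), of 0 x] assms(3)
      set_integrable_cong[of lebesgue lebesgue "{0..x}" "{0..x}" g g'] by auto
  have "integral {0..x} g = integral {0..x} g'"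
    by (rule Henstock_Kurzweil_Integration.integral_cong) (use assms in auto)
  then show "f' x = f' 0 + integral {0..x} g'"
    using has_ac_deriv_eq[OF assms(1) x] assms(2)[OF x] assms(2)[of 0] by simp
qed

lemma has_ac_deriv_indefinite:
  assumes "\<And>x. g absolutely_integrable_on {0..x}"
  shows "has_ac_deriv (\<lambda>x. c + integral {0..x} g) g"
  unfolding has_ac_deriv_def using assms by simp

lemma has_ac_deriv_of_has_vector_derivative:
  assumes "\<And>x. 0 \<le> x \<Longrightarrow> (f has_vector_derivative g x) (at x within {0..})" "continuous_on {0..} g"
  shows "has_ac_deriv f g"
  unfolding has_ac_deriv_def
proof (intro allI impI conjI)
  fix x :: real assume x: "0 \<le> x"
  show "g absolutely_integrable_on {0..x}"
    using assms(2) by (intro absolutely_integrable_continuous_real) (auto elim: continuous_on_subset)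
  have "(g has_integral f x - f 0) {0..x}"
    using x by (intro fundamental_theorem_of_calculus)
      (auto intro: has_vector_derivative_within_subset[OF assms(1)])
  then show "f x = f 0 + integral {0..x} g"
    by (simp add: integral_unique)
qed

lemma has_ac_deriv_cmod_square:
  assumes "has_ac_deriv f g"
  shows "has_ac_deriv (\<lambda>x. (cmod (f x))\<^sup>2) (\<lambda>x. 2 * Re (cnj (f x) * g x))"
proof -
  have "has_ac_deriv (\<lambda>x. cnj (f x)) (\<lambda>x. cnj (g x))"
    by (rule has_ac_deriv_linear[OF bounded_linear_cnj assms])
  from has_ac_deriv_linear[OF bounded_linear_Re has_ac_deriv_mult[OF assms this]]
  show ?thesis
    by (rule has_ac_deriv_cong) (auto simp: cmod_power2, simp_all add: power2_eq_square)
qed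

section \<open>Limits at infinity and bounds through the derivative\<close>

lemma has_ac_deriv_tendsto:
  assumes "has_ac_deriv f g" "g absolutely_integrable_on {0..}"
  shows "(f \<longlongrightarrow> f 0 + integral {0..} g) at_top"
proof -
  have "((\<lambda>b. LINT x:{0..b}|lebesgue. g x) \<longlongrightarrow> (LINT x:{0..}|lebesgue. g x)) at_top"
    by (rule tendsto_set_lebesgue_integral_at_top) (use assms in auto)
  moreover have "(LINT x:{0..b}|lebesgue. g x) = integral {0..b} g" for b
    by (intro set_lebesgue_integral_eq_integral(2) has_ac_deriv_abs_int[OF assms(1)]) auto
  moreover have "(LINT x:{0..}|lebesgue. g x) = integral {0..} g"
    by (rule set_lebesgue_integral_eq_integral(2)[OF assms(2)])
  ultimately have "((\<lambda>b. f 0 + integral {0..b} g) \<longlongrightarrow> f 0 + integral {0..} g) at_top"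
    by (intro tendsto_add tendsto_const) simp
  then show ?thesis
    by (rule Lim_transform_eventually)
      (use eventually_ge_at_top[of 0] in eventually_elim, simp add: has_ac_deriv_eq[OF assms(1), symmetric])
qed

text \<open>A nonzero limit would keep the norm of \<open>f\<close> above a positive constant on a
  whole ray, and its integral over long intervals would exceed the total.\<close>

lemma integrable_tendsto_zero:
  fixes f :: "real \<Rightarrow> 'a::euclidean_space"
  assumes f: "f absolutely_integrable_on {0..}" and L: "(f \<longlongrightarrow> L) at_top"
  shows "L = 0"
proof (rule ccontr)
  assume "L \<noteq> 0"
  then have c: "norm L / 2 > 0" by simp
  have n: "(\<lambda>x. norm (f x)) integrable_on {0..}"
    using f by (simp add: absolutely_integrable_on_def)
  have "\<forall>\<^sub>F x in at_top. norm L / 2 < norm (f x)"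
    using tendsto_norm[OF L] c by (intro order_tendstoD) auto
  then obtain X0 where X0: "\<And>x. X0 \<le> x \<Longrightarrow> norm L / 2 < norm (f x)"
    by (auto simp: eventually_at_top_linorder)
  define X where "X = max X0 0"
  have X: "0 \<le> X" "\<And>x. X \<le> x \<Longrightarrow> norm L / 2 < norm (f x)"
    using X0 by (auto simp: X_def)
  \<comment> \<open>An interval of length \<open>R\<close> alone already contributes more than the
    integral over the half-line.\<close>
  obtain R where R: "integral {0..} (\<lambda>x. norm (f x)) / (norm L / 2) < R" "0 \<le> R"
    using gt_ex[of "max 0 (integral {0..} (\<lambda>x. norm (f x)) / (norm L / 2))"] by auto
  have "R * (norm L / 2) = integral {X..X+R} (\<lambda>x. norm L / 2)"
    using R by simp
  also have "\<dots> \<le> integral {X..X+R} (\<lambda>x. norm (f x))"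
    using X n by (intro integral_le) (auto intro: less_imp_le integrable_on_subinterval)
  also have "\<dots> \<le> integral {0..} (\<lambda>x. norm (f x))"
    using X n by (intro integral_subset_le) (auto intro: integrable_on_subinterval)
  finally show False using R c by (simp add: field_simps)
qed

text \<open>An integrable derivative makes \<open>f\<close> converge at infinity, and integrability
  of \<open>f\<close> forces the limit to be \<open>0\<close>: there is no boundary term at
  infinity.\<close>

lemma has_ac_deriv_integrable:
  assumes "has_ac_deriv f g" "f absolutely_integrable_on {0..}" "g absolutely_integrable_on {0..}"
  shows "integral {0..} g = - f 0" "(f \<longlongrightarrow> 0) at_top"
proof -
  have "f 0 + integral {0..} g = 0"
    by (rule integrable_tendsto_zero[OF assms(2) has_ac_deriv_tendsto[OF assms(1,3)]])
  then show "integral {0..} g = - f 0"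
    by (simp add: add_eq_0_iff)
  then show "(f \<longlongrightarrow> 0) at_top"
    using has_ac_deriv_tendsto[OF assms(1,3)] by simp
qed

lemma has_ac_deriv_norm_diff_le:
  assumes "has_ac_deriv f g" "g absolutely_integrable_on {0..}" "0 \<le> x"
  shows "norm (f x - f 0) \<le> integral {0..} (\<lambda>x. norm (g x))"
proof -
  have n: "(\<lambda>x. norm (g x)) integrable_on {0..}"
    using assms by (simp add: absolutely_integrable_on_def)
  have "norm (f x - f 0) = norm (integral {0..x} g)"
    using has_ac_deriv_eq[OF assms(1,3)] by simp
  also have "\<dots> \<le> integral {0..x} (\<lambda>x. norm (g x))"
    by (intro integral_norm_bound_integral has_ac_deriv_int[OF assms(1)])
      (use n in \<open>auto intro: integrable_on_subinterval\<close>)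
  also have "\<dots> \<le> integral {0..} (\<lambda>x. norm (g x))"
    using n by (intro integral_subset_le) (auto intro: integrable_on_subinterval)
  finally show ?thesis .
qed

lemma has_ac_deriv_antimono:
  fixes f g :: "real \<Rightarrow> real"
  assumes "has_ac_deriv f g" "\<And>x. 0 \<le> x \<Longrightarrow> g x \<le> 0" "0 \<le> x"
  shows "f x \<le> f 0"
proof -
  have "0 \<le> integral {0..x} (\<lambda>x. - g x)"
    using assms has_ac_deriv_int[OF assms(1)] by (intro Henstock_Kurzweil_Integration.integral_nonneg integrable_neg) auto
  then show ?thesis using has_ac_deriv_eq[OF assms(1,3)] by simp
qed

section \<open>Weak derivatives\<close>

text \<open>The derivative vanishes off the support because the complement of the support is open.
  As the support is compact in the open half-line, the boundary terms at \<open>0\<close> and at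
  \<open>b\<close> drop out of every integration by parts.\<close>

lemma test_fun_properties:
  assumes "test_fun \<phi>"
  obtains b where "b > 0" "\<And>x. x \<le> 0 \<or> b \<le> x \<Longrightarrow> \<phi> x = 0 \<and> deriv \<phi> x = 0"
    "\<And>x. (\<phi> has_real_derivative deriv \<phi> x) (at x)" "continuous_on UNIV (deriv \<phi>)"
proof -
  define K where "K = closure {x. \<phi> x \<noteq> 0}"
  have K: "compact K" "K \<subseteq> {0<..}" and C1: "\<phi> C1_differentiable_on UNIV"
    using assms by (auto simp: test_fun_def K_def)
  obtain D where D: "\<And>x. (\<phi> has_vector_derivative D x) (at x)" "continuous_on UNIV D"
    using C1 unfolding C1_differentiable_on_def by auto
  have D': "(\<phi> has_real_derivative D x) (at x)" for x
    using D(1) by (simp add: has_real_derivative_iff_has_vector_derivative)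
  then have dD: "deriv \<phi> = D"
    by (auto intro: DERIV_imp_deriv)
  obtain B where B: "\<And>x. x \<in> K \<Longrightarrow> norm x \<le> B"
    using compact_imp_bounded[OF K(1)] by (auto simp: bounded_iff)
  have zero: "\<phi> x = 0" if "x \<notin> K" for x
    using that closure_subset[of "{x. \<phi> x \<noteq> 0}"] by (auto simp: K_def)
  have Dzero: "D x = 0" if "x \<notin> K" for x
  proof -
    have "(\<phi> has_real_derivative 0) (at x)"
      by (rule has_field_derivative_transform_within_open[of "\<lambda>_. 0" _ _ "- K"])
        (use that K(1) zero in \<open>auto intro: compact_imp_closed\<close>)
    then show ?thesis using D' DERIV_unique by blast
  qed
  have notK: "x \<notin> K" if "x \<le> 0 \<or> \<bar>B\<bar> + 1 \<le> x" for x
  proof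
    assume "x \<in> K"
    with K(2) have "0 < x" by auto
    moreover have "\<bar>x\<bar> \<le> B" using B[OF \<open>x \<in> K\<close>] by simp
    ultimately show False using that by linarith
  qed
  show ?thesis
  proof (rule that)
    show "0 < \<bar>B\<bar> + 1" by simp
    show "\<phi> x = 0 \<and> deriv \<phi> x = 0" if "x \<le> 0 \<or> \<bar>B\<bar> + 1 \<le> x" for x
      using zero[OF notK[OF that]] Dzero[OF notK[OF that]] unfolding dD by blast
  qed (use D' D(2) in \<open>simp_all only: dD\<close>)
qed

lemma abs_int_extend_zero:
  fixes h :: "real \<Rightarrow> 'a::euclidean_space"
  assumes "h absolutely_integrable_on {0..b}" "\<And>x. b \<le> x \<Longrightarrow> h x = 0"
  shows "h absolutely_integrable_on {0..}" "integral {0..} h = integral {0..b} h"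
proof -
  have eq: "(\<lambda>x. if x \<in> {0..b} then h x else 0) x = h x" if "x \<in> {0..}" for x
    using that assms(2)[of x] by auto
  have s: "{0..b} \<inter> {0..} = {0..b}" by auto
  have "(\<lambda>x. if x \<in> {0..b} then h x else 0) absolutely_integrable_on {0..}"
    using assms(1) by (simp only: absolutely_integrable_restrict_Int s)
  moreover have "(\<lambda>x. if x \<in> {0..b} then h x else 0) absolutely_integrable_on {0..}
      \<longleftrightarrow> h absolutely_integrable_on {0..}"
    by (rule set_integrable_cong) (use eq in auto)
  ultimately show "h absolutely_integrable_on {0..}" by simp
  have "integral {0..} h = integral {0..} (\<lambda>x. if x \<in> {0..b} then h x else 0)"
    by (rule Henstock_Kurzweil_Integration.integral_cong) (use eq in auto)
  also have "\<dots> = integral {0..b} h"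
    by (subst integral_restrict_Int) (simp only: s)
  finally show "integral {0..} h = integral {0..b} h" .
qed

text \<open>The product rule on \<open>{0..b}\<close>, where \<open>b\<close> bounds the support of
  \<open>\<phi>\<close>; both boundary values of the product are zero.\<close>

lemma test_fun_integration_by_parts:
  assumes ac: "has_ac_deriv f g" and t: "test_fun \<phi>"
  shows "(\<lambda>x. deriv \<phi> x *\<^sub>R f x) absolutely_integrable_on {0..}"
    "(\<lambda>x. \<phi> x *\<^sub>R g x) absolutely_integrable_on {0..}"
    "integral {0..} (\<lambda>x. deriv \<phi> x *\<^sub>R f x) = - integral {0..} (\<lambda>x. \<phi> x *\<^sub>R (g x :: complex))"
proof -
  obtain b where b: "b > 0" "\<And>x. x \<le> 0 \<or> b \<le> x \<Longrightarrow> \<phi> x = 0 \<and> deriv \<phi> x = 0"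
    and d: "\<And>x. (\<phi> has_real_derivative deriv \<phi> x) (at x)" "continuous_on UNIV (deriv \<phi>)"
    using test_fun_properties[OF t] by metis
  have "has_ac_deriv \<phi> (deriv \<phi>)"
    using d by (intro has_ac_deriv_of_has_vector_derivative)
      (auto simp: has_real_derivative_iff_has_vector_derivative[symmetric]
        intro: has_field_derivative_at_within continuous_on_subset)
  from has_ac_deriv_linear[OF bounded_linear_of_real this]
  have P: "has_ac_deriv (\<lambda>x. of_real (\<phi> x) :: complex) (\<lambda>x. of_real (deriv \<phi> x))" .
  have cf: "continuous_on {0..b} f"
    using has_ac_deriv_continuous[OF ac] by (rule continuous_on_subset) auto
  have cp: "continuous_on {0..b} (\<lambda>x. of_real (\<phi> x) :: complex)"
    using has_ac_deriv_continuous[OF P] by (rule continuous_on_subset) auto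
  have 1: "(\<lambda>x. deriv \<phi> x *\<^sub>R f x) absolutely_integrable_on {0..b}"
    using continuous_times_abs_integrable[OF cf has_ac_deriv_abs_int[OF P, of 0 b]]
    by (simp add: scaleR_conv_of_real mult.commute)
  have 2: "(\<lambda>x. \<phi> x *\<^sub>R g x) absolutely_integrable_on {0..b}"
    using continuous_times_abs_integrable[OF cp has_ac_deriv_abs_int[OF ac, of 0 b]]
    by (simp add: scaleR_conv_of_real)
  show "(\<lambda>x. deriv \<phi> x *\<^sub>R f x) absolutely_integrable_on {0..}"
    by (rule abs_int_extend_zero[OF 1]) (use b in auto)
  show "(\<lambda>x. \<phi> x *\<^sub>R g x) absolutely_integrable_on {0..}"
    by (rule abs_int_extend_zero[OF 2]) (use b in auto)
  have "0 = of_real (\<phi> b) * f b - of_real (\<phi> 0) * f 0"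
    using b by simp
  also have "\<dots> = integral {0..b} (\<lambda>x. of_real (deriv \<phi> x) * f x + of_real (\<phi> x) * g x)"
    using has_ac_deriv_eq[OF has_ac_deriv_mult[OF P ac], of b] b(1) by simp
  also have "\<dots> = integral {0..b} (\<lambda>x. deriv \<phi> x *\<^sub>R f x) + integral {0..b} (\<lambda>x. \<phi> x *\<^sub>R g x)"
    using Henstock_Kurzweil_Integration.integral_add[OF 1[THEN abs_int_integrable] 2[THEN abs_int_integrable]]
    by (simp add: scaleR_conv_of_real)
  also have "integral {0..b} (\<lambda>x. deriv \<phi> x *\<^sub>R f x) = integral {0..} (\<lambda>x. deriv \<phi> x *\<^sub>R f x)"
    by (rule abs_int_extend_zero(2)[OF 1, symmetric]) (use b in auto)
  also have "integral {0..b} (\<lambda>x. \<phi> x *\<^sub>R g x) = integral {0..} (\<lambda>x. \<phi> x *\<^sub>R g x)"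
    by (rule abs_int_extend_zero(2)[OF 2, symmetric]) (use b in auto)
  finally show "integral {0..} (\<lambda>x. deriv \<phi> x *\<^sub>R f x) = - integral {0..} (\<lambda>x. \<phi> x *\<^sub>R g x)"
    by (simp add: eq_neg_iff_add_eq_0)
qed

lemma has_weak_deriv_of_ac:
  assumes "has_ac_deriv f g"
  shows "has_weak_deriv f g"
  unfolding has_weak_deriv_def
  using test_fun_integration_by_parts[OF assms] by (simp add: halfline_integral)

section \<open>Absolute continuity from weak derivatives\<close>

text \<open>The zero mean of \<open>h\<close> makes its primitive vanish again to the right of
  \<open>b\<close>, and \<open>0 < a\<close> keeps the support away from the vertex. This supplies
  test functions with a prescribed derivative.\<close>

lemma test_fun_integral:
  fixes h :: "real \<Rightarrow> real"
  assumes h: "continuous_on UNIV h" "\<And>t. t \<notin> {a..b} \<Longrightarrow> h t = 0"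
    and ab: "0 < a" "a < b" and z: "integral {a..b} h = 0"
  shows "test_fun (\<lambda>t. integral {0..t} h)" "deriv (\<lambda>t. integral {0..t} h) = h"
proof -
  define \<phi> where "\<phi> = (\<lambda>t. integral {0..t} h)"
  have int: "h integrable_on {x..y}" for x y
    using h(1) by (intro integrable_continuous_real) (auto elim: continuous_on_subset)
  have low: "\<phi> t = 0" if "t \<le> a" for t
  proof -
    have "integral {0..t} h = integral {0..t} (\<lambda>_. 0)"
      by (rule integral_spike[of "{a}"]) (use that h(2) in auto)
    then show ?thesis by (simp add: \<phi>_def)
  qed
  have high: "\<phi> t = 0" if "b \<le> t" for t
  proof -
    have "integral {b..t} h = integral {b..t} (\<lambda>_. 0)"
      by (rule integral_spike[of "{b}"]) (use that h(2) in auto)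
    moreover have "\<phi> t = \<phi> a + integral {a..b} h + integral {b..t} h"
      unfolding \<phi>_def
      using Henstock_Kurzweil_Integration.integral_combine[of 0 a b h]
        Henstock_Kurzweil_Integration.integral_combine[of 0 b t h] int ab that by simp
    ultimately show ?thesis using z low[of a] by simp
  qed
  have D: "(\<phi> has_real_derivative h t) (at t)" for t
  proof (cases "t < a")
    case True
    have "(\<phi> has_real_derivative 0) (at t)"
      by (rule has_field_derivative_transform_within_open[of "\<lambda>_. 0" _ _ "{..<a}"])
        (use True low in auto)
    then show ?thesis using h(2)[of t] True by simp
  next
    case False
    then have "(\<phi> has_real_derivative h t) (at t within {0..t+1})"
      unfolding \<phi>_def using ab h(1)
      by (intro integral_has_real_derivative) (auto elim: continuous_on_subset)
    moreover have "at t within {0..t+1} = at t"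
      by (rule at_within_interior) (use False ab in auto)
    ultimately show ?thesis by simp
  qed
  have sub: "{t. \<phi> t \<noteq> 0} \<subseteq> {a..b}"
    using low high by (metis (mono_tags, lifting) atLeastAtMost_iff linorder_linear mem_Collect_eq subsetI)
  then have sub: "closure {t. \<phi> t \<noteq> 0} \<subseteq> {a..b}"
    by (rule closure_minimal) auto
  show "deriv (\<lambda>t. integral {0..t} h) = h"
    using D by (auto simp: \<phi>_def intro: DERIV_imp_deriv)
  show "test_fun (\<lambda>t. integral {0..t} h)"
    unfolding test_fun_def \<phi>_def[symmetric]
  proof (intro conjI)
    show "\<phi> C1_differentiable_on UNIV"
      unfolding C1_differentiable_on_def
      using D h(1) by (auto simp: has_real_derivative_iff_has_vector_derivative)
    show "compact (closure {t. \<phi> t \<noteq> 0})"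
      using sub by (metis closed_closure compact_Icc compact_Int_closed inf.absorb_iff2)
    show "closure {t. \<phi> t \<noteq> 0} \<subseteq> {0<..}"
      using sub ab by auto
  qed
qed

text \<open>Testing with \<open>w (F - m)\<close>, where \<open>w\<close> is a bump and \<open>m\<close> the \<open>w\<close>-mean of \<open>F\<close>,
  gives \<open>\<integral> w (F - m)\<^sup>2 = 0\<close>.\<close>

lemma du_Bois_Reymond:
  fixes F :: "real \<Rightarrow> real"
  assumes F: "continuous_on {0..} F"
    and test: "\<And>\<phi>. test_fun \<phi> \<Longrightarrow> integral {0..} (\<lambda>x. deriv \<phi> x * F x) = 0"
    and x: "0 \<le> x"
  shows "F x = F 0"
proof -
  \<comment> \<open>Constancy is first shown on intervals bounded away from \<open>0\<close>, where
    test functions live; the value at \<open>0\<close> is reached at the end by continuity.\<close>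
  have const: "F s = F t" if ab: "0 < a" and st: "a < s" "s < b" "a < t" "t < b" for a b s t
  proof -
    have "a < b" using st by simp
    define w where "w = (\<lambda>t. max 0 ((t - a) * (b - t)))"
    \<comment> \<open>\<open>G\<close> continues \<open>F\<close> by a constant to the left of
      \<open>0\<close>, so that \<open>h\<close> below is continuous on the whole line.\<close>
    define G where "G = (\<lambda>t. F (max 0 t))"
    have cG: "continuous_on UNIV G"
      unfolding G_def by (rule continuous_on_compose2[OF F]) (auto intro!: continuous_intros)
    have cw: "continuous_on UNIV w"
      unfolding w_def by (intro continuous_intros)
    have w0: "w t = 0" if "t \<notin> {a..b}" for t
      using that \<open>a < b\<close> by (auto simp: w_def max_def not_le zero_le_mult_iff)
    have wpos: "w t > 0" if "a < t" "t < b" for t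
      using that by (auto simp: w_def)
    have wn: "w t \<ge> 0" for t by (simp add: w_def)
    have cont: "continuous_on {a..b} w" "continuous_on {a..b} G"
      using cw cG by (auto elim: continuous_on_subset)
    have W: "integral {a..b} w \<noteq> 0"
      using integral_eq_0_iff[OF cont(1) \<open>a < b\<close>] wn wpos[of s] st by (auto simp: Ball_def)
    define m where "m = integral {a..b} (\<lambda>t. w t * G t) / integral {a..b} w"
    define h where "h = (\<lambda>t. w t * (G t - m))"
    have ch: "continuous_on UNIV h"
      unfolding h_def using cw cG by (intro continuous_intros)
    have h0: "h t = 0" if "t \<notin> {a..b}" for t
      using w0[OF that] by (simp add: h_def)
    have ih: "(\<lambda>t. w t * G t) integrable_on {a..b}" "w integrable_on {a..b}" "h integrable_on {a..b}"
        "(\<lambda>t. h t * G t) integrable_on {a..b}"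
      using cw cG ch by (auto intro!: integrable_continuous_real continuous_intros elim: continuous_on_subset)
    have "integral {a..b} h = integral {a..b} (\<lambda>t. w t * G t - w t * m)"
      by (simp add: h_def algebra_simps)
    also have "\<dots> = integral {a..b} (\<lambda>t. w t * G t) - integral {a..b} w * m"
      using ih by (subst Henstock_Kurzweil_Integration.integral_diff) (auto intro: integrable_on_mult_left)
    also have "\<dots> = 0" using W by (simp add: m_def)
    finally have zh: "integral {a..b} h = 0" .
    note tf = test_fun_integral[OF ch h0 ab \<open>a < b\<close> zh, simplified]
    have "integral {0..} (\<lambda>x. h x * F x) = 0"
      using test[OF tf(1)] tf(2) by simp
    also have "integral {0..} (\<lambda>x. h x * F x) = integral {0..} (\<lambda>x. if x \<in> {a..b} then h x * G x else 0)"
      by (rule Henstock_Kurzweil_Integration.integral_cong) (use h0 in \<open>auto simp: G_def\<close>)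
    also have "\<dots> = integral ({a..b} \<inter> {0..}) (\<lambda>x. h x * G x)"
      by (rule integral_restrict_Int)
    also have "{a..b} \<inter> {0..} = {a..b}" using ab by auto
    finally have zhG: "integral {a..b} (\<lambda>x. h x * G x) = 0" .
    have "integral {a..b} (\<lambda>t. w t * (G t - m)\<^sup>2) = integral {a..b} (\<lambda>t. h t * G t - h t * m)"
      by (simp add: h_def algebra_simps power2_eq_square)
    also have "\<dots> = 0"
      using ih zhG zh by (subst Henstock_Kurzweil_Integration.integral_diff) (auto intro: integrable_on_mult_left)
    finally have "\<forall>t\<in>{a..b}. w t * (G t - m)\<^sup>2 = 0"
      using wn cont by (subst (asm) integral_eq_0_iff[OF _ \<open>a < b\<close>]) (auto intro!: continuous_intros)
    then have "G t = m" if "a < t" "t < b" for t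
    proof -
      have "w t * (G t - m)\<^sup>2 = 0"
        using \<open>\<forall>t\<in>{a..b}. w t * (G t - m)\<^sup>2 = 0\<close> that by simp
      then show ?thesis using wpos[OF that] by simp
    qed
    then have "G s = G t" using st by simp
    then show ?thesis using st ab by (simp add: G_def max_def)
  qed
  show ?thesis
  proof (cases "x = 0")
    case False
    with x have "x > 0" by simp
    have "(F \<longlongrightarrow> F 0) (at 0 within {0..})"
      using F by (auto simp: continuous_on_def)
    then have "(F \<longlongrightarrow> F 0) (at_right 0)"
      by (rule tendsto_mono[rotated]) (auto intro: at_le)
    moreover have "(F \<longlongrightarrow> F x) (at_right 0)"
    proof (rule tendsto_eventually)
      show "\<forall>\<^sub>F s in at_right 0. F s = F x"
        using eventually_at_right_less[of "0::real"]
      proof eventually_elim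
        case (elim s)
        \<comment> \<open>The left end \<open>min s x / 2\<close> is positive, and the interval
          contains both points.\<close>
        then show ?case using const[of "min s x / 2" s "max s x + 1" x] \<open>x > 0\<close> by auto
      qed
    qed
    ultimately show ?thesis using tendsto_unique[OF trivial_limit_at_right_real] by blast
  qed simp
qed

text \<open>On a bounded interval the constant \<open>1\<close> is integrable, and the modulus is at
  most one plus its square.\<close>

lemma L2_abs_int:
  assumes "g \<in> Lp_halfline 2"
  shows "g absolutely_integrable_on {0..x}"
proof (rule measurable_bounded_by_integrable_imp_absolutely_integrable)
  show "g \<in> borel_measurable (lebesgue_on {0..x})"
    using assms by (auto simp: Lp_halfline_2_iff intro: measurable_restrict_mono)
  have "(\<lambda>x. (cmod (g x))\<^sup>2) absolutely_integrable_on {0..x}"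
    using assms by (auto simp: Lp_halfline_2_iff intro: abs_int_intervals)
  then show "(\<lambda>x. 1 + (cmod (g x))\<^sup>2) integrable_on {0..x}"
    by (intro integrable_add abs_int_integrable) auto
  fix y
  show "norm (g y) \<le> 1 + (cmod (g y))\<^sup>2"
    using sum_squares_bound[of 1 "cmod (g y)"] norm_ge_zero[of "g y"] by (simp del: norm_ge_zero)
qed auto

text \<open>The difference of \<open>f\<close> and the primitive \<open>G\<close> of
  \<open>g\<close> has weak derivative zero, hence is constant. Continuity of \<open>f\<close>
  yields this at every point and not just almost everywhere.\<close>

lemma ac_of_has_weak_deriv:
  assumes f: "continuous_on {0..} f" and g: "g \<in> Lp_halfline 2" and w: "has_weak_deriv f g"
  shows "has_ac_deriv f g"
proof -
  define G where "G = (\<lambda>x. integral {0..x} g)"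
  have G: "has_ac_deriv G g"
    using has_ac_deriv_indefinite[of g 0] L2_abs_int[OF g] by (simp add: G_def)
  \<comment> \<open>\<open>du_Bois_Reymond\<close> concerns real functions; \<open>h\<close> stands
    for the real and the imaginary part.\<close>
  have key: "h (f x - G x) = h (f 0 - G 0)" if h: "bounded_linear h" and x: "0 \<le> x"
    for h :: "complex \<Rightarrow> real" and x
  proof (rule du_Bois_Reymond[OF _ _ x])
    have cF: "continuous_on {0..} (\<lambda>x. f x - G x)"
      using f has_ac_deriv_continuous[OF G] by (intro continuous_intros)
    then show "continuous_on {0..} (\<lambda>x. h (f x - G x))"
      by (rule bounded_linear.continuous_on[OF h])
    fix \<phi> assume t: "test_fun \<phi>"
    obtain b where b: "b > 0" "\<And>x. x \<le> 0 \<or> b \<le> x \<Longrightarrow> \<phi> x = 0 \<and> deriv \<phi> x = 0"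
      and d: "continuous_on UNIV (deriv \<phi>)"
      using test_fun_properties[OF t] by metis
    have "(\<lambda>x. deriv \<phi> x *\<^sub>R f x) absolutely_integrable_on {0..b}"
      using f d by (intro absolutely_integrable_continuous_real continuous_intros)
        (auto elim: continuous_on_subset)
    then have i1: "(\<lambda>x. deriv \<phi> x *\<^sub>R f x) absolutely_integrable_on {0..}"
      by (rule abs_int_extend_zero) (use b in auto)
    note ibp = test_fun_integration_by_parts[OF G t]
    have "integral {0..} (\<lambda>x. deriv \<phi> x *\<^sub>R f x) = - integral {0..} (\<lambda>x. \<phi> x *\<^sub>R g x)"
      using w t halfline_integral[OF i1] halfline_integral[OF ibp(2)] unfolding has_weak_deriv_def by metis
    then have z: "integral {0..} (\<lambda>x. deriv \<phi> x *\<^sub>R f x - deriv \<phi> x *\<^sub>R G x) = 0"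
      using ibp i1 by (simp add: Henstock_Kurzweil_Integration.integral_diff abs_int_integrable)
    have "integral {0..} (\<lambda>x. h (deriv \<phi> x *\<^sub>R f x - deriv \<phi> x *\<^sub>R G x)) = 0"
      using integral_linear[OF integrable_diff[OF i1[THEN abs_int_integrable] ibp(1)[THEN abs_int_integrable]] h] z
      by (simp add: o_def linear_0[OF bounded_linear.linear[OF h]])
    then show "integral {0..} (\<lambda>x. deriv \<phi> x * h (f x - G x)) = 0"
      by (simp add: linear_diff[OF bounded_linear.linear[OF h]] linear_scale[OF bounded_linear.linear[OF h]]
          right_diff_distrib)
  qed
  have F: "f x - G x = f 0 - G 0" if "0 \<le> x" for x
    by (rule complex_eqI) (rule key[OF bounded_linear_Re that], rule key[OF bounded_linear_Im that])
  show ?thesis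
    unfolding has_ac_deriv_def
  proof (intro allI impI conjI)
    fix x :: real assume "0 \<le> x"
    from F[OF this] show "f x = f 0 + integral {0..x} g"
      by (simp add: G_def diff_eq_eq)
  qed (rule L2_abs_int[OF g])
qed

text \<open>The difference of the two derivatives has integral zero over every interval, so it
  vanishes almost everywhere by Lebesgue differentiation.\<close>

lemma has_ac_deriv_unique:
  fixes f :: "real \<Rightarrow> 'a::euclidean_space"
  assumes "has_ac_deriv f g" "has_ac_deriv f h"
  obtains N where "negligible N" "\<And>x. 0 \<le> x \<Longrightarrow> x \<notin> N \<Longrightarrow> g x = h x"
proof -
  \<comment> \<open>Extension by zero, to obtain integrability on intervals that reach below
    \<open>0\<close>.\<close>
  define k where "k = (\<lambda>x. if x \<in> {0..} then g x - h x else 0)"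
  have gh: "(\<lambda>x. g x - h x) integrable_on {a..b}" "integral {a..b} (\<lambda>x. g x - h x) = 0"
    if "0 \<le> a" "a \<le> b" for a b
  proof -
    have i: "g integrable_on {a..b}" "h integrable_on {a..b}"
      using assms that by (auto intro: has_ac_deriv_int)
    then show "(\<lambda>x. g x - h x) integrable_on {a..b}"
      by (rule integrable_diff)
    show "integral {a..b} (\<lambda>x. g x - h x) = 0"
      using has_ac_deriv_diff_eq[OF assms(1) that] has_ac_deriv_diff_eq[OF assms(2) that] i
      by (simp add: Henstock_Kurzweil_Integration.integral_diff)
  qed
  have k: "k integrable_on cbox a b" for a b
  proof -
    have "{0..} \<inter> {a..b} = {max 0 a..b}" by auto
    moreover have "(\<lambda>x. g x - h x) integrable_on {max 0 a..b}"
      using gh(1)[of "max 0 a" b] by (cases "max 0 a \<le> b") auto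
    ultimately show ?thesis
      unfolding k_def by (subst integrable_restrict_Int) simp
  qed
  obtain N where N: "negligible N"
    "\<And>x e. \<lbrakk>x \<notin> N; 0 < e\<rbrakk> \<Longrightarrow> \<exists>d>0. \<forall>s. 0 < s \<and> s < d \<longrightarrow>
       norm (integral (cbox x (x + s *\<^sub>R One)) k /\<^sub>R s ^ DIM(real) - k x) < e"
    using integrable_ccontinuous_explicit[OF k] by metis
  have "g x = h x" if x: "0 \<le> x" "x \<notin> N" for x
  proof (rule ccontr)
    assume "g x \<noteq> h x"
    then have "k x \<noteq> 0" using x by (simp add: k_def)
    \<comment> \<open>With \<open>norm (k x)\<close> itself as tolerance: the averages to the right
      of \<open>x\<close> are zero, so their distance from \<open>k x\<close> is exactly this number
      and not smaller.\<close>
    then have "0 < norm (k x)" by simp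
    from N(2)[OF x(2) this] show False
    proof (elim exE conjE)
      fix d :: real
      assume d: "d > 0" "\<forall>s. 0 < s \<and> s < d \<longrightarrow>
        norm (integral (cbox x (x + s *\<^sub>R One)) k /\<^sub>R s ^ DIM(real) - k x) < norm (k x)"
      have "integral {x..x + d / 2} k = integral {x..x + d / 2} (\<lambda>x. g x - h x)"
        by (rule Henstock_Kurzweil_Integration.integral_cong) (use x in \<open>auto simp: k_def\<close>)
      also have "\<dots> = 0" using gh(2)[of x "x + d / 2"] x d(1) by simp
      finally show False using d(2)[rule_format, of "d / 2"] d(1) by simp
    qed
  qed
  with N(1) show ?thesis using that by blast
qed

lemma H1_halflineD:
  assumes "f \<in> H1_halfline"
  shows "f \<in> Lp_halfline 2" "weak_deriv f \<in> Lp_halfline 2" "has_ac_deriv f (weak_deriv f)"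
proof -
  obtain g where "g \<in> Lp_halfline 2 \<and> has_weak_deriv f g"
    using assms by (auto simp: H1_halfline_def)
  then have "weak_deriv f \<in> Lp_halfline 2 \<and> has_weak_deriv f (weak_deriv f)"
    unfolding weak_deriv_def by (rule someI[where P="\<lambda>g. g \<in> Lp_halfline 2 \<and> has_weak_deriv f g"])
  then show "f \<in> Lp_halfline 2" "weak_deriv f \<in> Lp_halfline 2" "has_ac_deriv f (weak_deriv f)"
    using assms by (auto simp: H1_halfline_def intro: ac_of_has_weak_deriv)
qed

lemma H1_halflineI:
  assumes "f \<in> Lp_halfline 2" "g \<in> Lp_halfline 2" "has_ac_deriv f g"
  shows "f \<in> H1_halfline"
  using assms has_weak_deriv_of_ac[OF assms(3)] has_ac_deriv_continuous[OF assms(3)]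
  by (auto simp: H1_halfline_def)

text \<open>Lets any explicit derivative stand in for the one selected by \<open>weak_deriv\<close>
  when norms are computed.\<close>

lemma integral_weak_deriv:
  assumes "f \<in> Lp_halfline 2" "g \<in> Lp_halfline 2" "has_ac_deriv f g"
  shows "integral {0..} (\<lambda>x. (cmod (weak_deriv f x))\<^sup>2) = integral {0..} (\<lambda>x. (cmod (g x))\<^sup>2)"
proof -
  obtain N where "negligible N" "\<And>x. 0 \<le> x \<Longrightarrow> x \<notin> N \<Longrightarrow> weak_deriv f x = g x"
    by (rule has_ac_deriv_unique[OF H1_halflineD(3)[OF H1_halflineI[OF assms]] assms(3)]) blast
  then show ?thesis
    by (intro integral_spike[of N]) auto
qed

section \<open>The energy on one edge\<close>

locale edge =
  fixes f g :: "real \<Rightarrow> complex" and k t :: real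
  assumes f: "f \<in> Lp_halfline 2" and g: "g \<in> Lp_halfline 2" and ac: "has_ac_deriv f g"
    and k: "k > 0"
begin

definition m :: real where "m = integral {0..} (\<lambda>x. (cmod (f x))\<^sup>2)"
definition z :: real where "z = t - k / 2 * m"
text \<open>This is \<open>t\<close> minus \<open>k / 2\<close> times the mass of \<open>f\<close>
  beyond \<open>x\<close>; the integral from \<open>0\<close> displays it as an absolutely
  continuous function with initial value \<open>z\<close>. For the sech soliton it is
  \<open>t * tanh (t * x + x0)\<close>.\<close>

definition T :: "real \<Rightarrow> real" where "T x = z + k / 2 * integral {0..x} (\<lambda>s. (cmod (f s))\<^sup>2)"
text \<open>The defect in the first-order equation \<open>f' = - T f\<close>, which the soliton
  solves exactly.\<close>

definition D :: "real \<Rightarrow> complex" where "D x = g x + of_real (T x) * f x"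
definition d :: real where "d = integral {0..} (\<lambda>x. (cmod (D x))\<^sup>2)"

lemma f2: "(\<lambda>x. (cmod (f x))\<^sup>2) absolutely_integrable_on {0..}"
  and g2: "(\<lambda>x. (cmod (g x))\<^sup>2) absolutely_integrable_on {0..}"
  using f g by (auto simp: Lp_halfline_2_iff)

lemma m_nonneg: "0 \<le> m"
  unfolding m_def using f2 by (intro Henstock_Kurzweil_Integration.integral_nonneg) (auto intro: abs_int_integrable)

lemma T_0 [simp]: "T 0 = z"
  by (simp add: T_def)

lemma T_ac: "has_ac_deriv T (\<lambda>x. k / 2 * (cmod (f x))\<^sup>2)"
proof -
  have "has_ac_deriv (\<lambda>x. 0 + integral {0..x} (\<lambda>s. (cmod (f s))\<^sup>2)) (\<lambda>x. (cmod (f x))\<^sup>2)"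
    by (intro has_ac_deriv_indefinite abs_int_intervals[OF f2]) simp
  from has_ac_deriv_add[OF has_ac_deriv_const[of z] has_ac_deriv_cmult[OF this, of "k / 2"]]
  show ?thesis by (simp add: T_def[abs_def])
qed

lemma T_bounds:
  assumes "0 \<le> x"
  shows "z \<le> T x" "T x \<le> t"
proof -
  have "0 \<le> integral {0..x} (\<lambda>s. (cmod (f s))\<^sup>2)"
    by (intro Henstock_Kurzweil_Integration.integral_nonneg abs_int_integrable abs_int_intervals[OF f2]) auto
  then show "z \<le> T x" using k by (simp add: T_def)
  have "integral {0..x} (\<lambda>s. (cmod (f s))\<^sup>2) \<le> m"
    unfolding m_def
    by (intro integral_subset_le abs_int_integrable abs_int_intervals[OF f2] f2) auto
  then have "k / 2 * integral {0..x} (\<lambda>s. (cmod (f s))\<^sup>2) \<le> k / 2 * m"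
    using k by (intro mult_left_mono) auto
  then show "T x \<le> t" by (simp add: T_def z_def)
qed

lemma T_tendsto: "(T \<longlongrightarrow> t) at_top"
proof -
  have i: "(\<lambda>x. k / 2 * (cmod (f x))\<^sup>2) absolutely_integrable_on {0..}"
    using f2 by (intro set_integrable_mult_right) auto
  have eq: "integral {0..} (\<lambda>x. k / 2 * (cmod (f x))\<^sup>2) = k / 2 * m"
    by (simp add: m_def)
  show ?thesis
    using has_ac_deriv_tendsto[OF T_ac i] unfolding eq by (simp add: z_def)
qed

lemma T_measurable: "(\<lambda>x. of_real (T x) :: complex) \<in> borel_measurable halfline"
  using has_ac_deriv_continuous[OF T_ac]
  by (intro continuous_imp_measurable_on_sets_lebesgue continuous_intros) auto

lemma T_abs_le: "0 \<le> x \<Longrightarrow> \<bar>T x\<bar> \<le> \<bar>z\<bar> + \<bar>t\<bar>"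
  using T_bounds[of x] by linarith

lemma Tf_L2: "h \<in> Lp_halfline 2 \<Longrightarrow> (\<lambda>x. of_real (T x) * h x) \<in> Lp_halfline 2"
  by (rule L2_bounded_mult[OF T_measurable, of "\<bar>z\<bar> + \<bar>t\<bar>"]) (auto simp: T_abs_le)

lemma D_L2: "D \<in> Lp_halfline 2"
  unfolding D_def[abs_def] by (intro L2_add g Tf_L2 f)

lemma D2: "(\<lambda>x. (cmod (D x))\<^sup>2) absolutely_integrable_on {0..}"
  using D_L2 by (auto simp: Lp_halfline_2_iff)

lemma d_nonneg: "0 \<le> d"
  unfolding d_def using D2 by (intro Henstock_Kurzweil_Integration.integral_nonneg) (auto intro: abs_int_integrable)

lemma Re_cnj_abs_int:
  assumes "p \<in> Lp_halfline 2" "q \<in> Lp_halfline 2"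
  shows "(\<lambda>x. Re (cnj (p x) * q x)) absolutely_integrable_on {0..}"
  using absolutely_integrable_linear[OF L2_mult[OF L2_cnj[OF assms(1)] assms(2)] bounded_linear_Re]
  by (simp only: o_def)

lemma f2_ac: "has_ac_deriv (\<lambda>x. (cmod (f x))\<^sup>2) (\<lambda>x. 2 * Re (cnj (f x) * g x))"
  by (rule has_ac_deriv_cmod_square[OF ac])

lemma f2_deriv_int: "(\<lambda>x. 2 * Re (cnj (f x) * g x)) absolutely_integrable_on {0..}"
  by (intro set_integrable_mult_right impI Re_cnj_abs_int f g)

lemma f2_tendsto: "((\<lambda>x. (cmod (f x))\<^sup>2) \<longlongrightarrow> 0) at_top"
  by (rule has_ac_deriv_integrable(2)[OF f2_ac f2 f2_deriv_int])

text \<open>The derivative of the squared modulus is integrable, so the squared modulus is bounded;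
  the fourth power is then bounded times integrable.\<close>

lemma f4: "(\<lambda>x. (cmod (f x)) ^ 4) absolutely_integrable_on {0..}"
proof -
  have "(cmod (f x))\<^sup>2 \<le> (cmod (f 0))\<^sup>2 + integral {0..} (\<lambda>x. norm (2 * Re (cnj (f x) * g x)))"
    if "0 \<le> x" for x
    using has_ac_deriv_norm_diff_le[OF f2_ac f2_deriv_int that] unfolding real_norm_def by linarith
  then have "bounded ((\<lambda>x. (cmod (f x))\<^sup>2) ` {0..})"
    unfolding bounded_iff by (intro exI[of _ "(cmod (f 0))\<^sup>2 + integral {0..} (\<lambda>x. norm (2 * Re (cnj (f x) * g x)))"]) auto
  then have "(\<lambda>x. (cmod (f x))\<^sup>2 * (cmod (f x))\<^sup>2) absolutely_integrable_on {0..}"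
    by (intro bounded_times_abs_integrable halfline_measurable f2) auto
  then show ?thesis by (simp add: power_add[symmetric])
qed

lemma T_times_abs_int:
  assumes "h absolutely_integrable_on {0..}"
  shows "(\<lambda>x. T x * h x :: real) absolutely_integrable_on {0..}"
proof (rule bounded_times_abs_integrable[OF _ _ _ assms])
  show "T \<in> borel_measurable halfline"
    using has_ac_deriv_continuous[OF T_ac] by (intro continuous_imp_measurable_on_sets_lebesgue) auto
  show "bounded (T ` {0..})"
    unfolding bounded_iff by (intro exI[of _ "\<bar>z\<bar> + \<bar>t\<bar>"]) (auto simp: T_abs_le)
qed auto

text \<open>Grouped so that every term besides the first is a product of powers of \<open>T\<close>
  with \<open>(cmod (f x))\<^sup>2\<close> or its derivative, as in the derivative of the
  calibration.\<close>

lemma cmod_D_square: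
  "(cmod (D x))\<^sup>2 = (cmod (g x))\<^sup>2 + (T x * (2 * Re (cnj (f x) * g x)) + T x * (T x * (cmod (f x))\<^sup>2))"
  unfolding D_def cmod_power2 by (simp add: power2_eq_square algebra_simps)

text \<open>\<open>T |f|\<^sup>2 + 2 T\<^sup>3 / (3 k)\<close> is the calibration: its derivative is \<open>|D|\<^sup>2 - |g|\<^sup>2 + k |f|\<^sup>4 / 2\<close>.\<close>

lemma energy_identity:
  "integral {0..} (\<lambda>x. (cmod (g x))\<^sup>2) - k / 2 * integral {0..} (\<lambda>x. (cmod (f x)) ^ 4)
     = d + z * (cmod (f 0))\<^sup>2 - 2 / (3 * k) * (t ^ 3 - z ^ 3)"
proof -
  define p where "p = (\<lambda>x. T x * (cmod (f x))\<^sup>2 + 2 / (3 * k) * (T x * (T x * T x)))"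
  define q where "q = (\<lambda>x. (T x * (2 * Re (cnj (f x) * g x)) + T x * (T x * (cmod (f x))\<^sup>2))
      + k / 2 * (cmod (f x)) ^ 4)"
  have "has_ac_deriv p (\<lambda>x. (k / 2 * (cmod (f x))\<^sup>2 * (cmod (f x))\<^sup>2 + T x * (2 * Re (cnj (f x) * g x)))
      + 2 / (3 * k) * (k / 2 * (cmod (f x))\<^sup>2 * (T x * T x)
        + T x * (k / 2 * (cmod (f x))\<^sup>2 * T x + T x * (k / 2 * (cmod (f x))\<^sup>2))))"
    unfolding p_def by (intro has_ac_deriv_add has_ac_deriv_cmult has_ac_deriv_mult T_ac f2_ac)
  then have pq: "has_ac_deriv p q"
    by (rule has_ac_deriv_cong) (use k in \<open>auto simp: q_def field_simps power4_eq_xxxx power2_eq_square\<close>)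
  have iq1: "(\<lambda>x. T x * (2 * Re (cnj (f x) * g x)) + T x * (T x * (cmod (f x))\<^sup>2)) absolutely_integrable_on {0..}"
    by (intro set_integral_add T_times_abs_int f2_deriv_int f2)
  have iq2: "(\<lambda>x. k / 2 * (cmod (f x)) ^ 4) absolutely_integrable_on {0..}"
    by (intro set_integrable_mult_right f4)
  have iq: "q absolutely_integrable_on {0..}"
    unfolding q_def by (intro set_integral_add iq1 iq2)
  \<comment> \<open>At infinity \<open>f\<close> dies out and \<open>T\<close> tends to
    \<open>t\<close>, so only the cubic term of the calibration survives.\<close>
  have "(p \<longlongrightarrow> t * 0 + 2 / (3 * k) * (t * (t * t))) at_top"
    unfolding p_def by (intro tendsto_intros T_tendsto f2_tendsto)
  moreover have "(p \<longlongrightarrow> p 0 + integral {0..} q) at_top"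
    by (rule has_ac_deriv_tendsto[OF pq iq])
  ultimately have "p 0 + integral {0..} q = 2 / (3 * k) * (t * (t * t))"
    using tendsto_unique[OF trivial_limit_at_top_linorder] by fastforce
  then have q: "integral {0..} q = 2 / (3 * k) * (t ^ 3 - z ^ 3) - z * (cmod (f 0))\<^sup>2"
    by (simp add: p_def right_diff_distrib power3_eq_cube)
  have "integral {0..} q
      = integral {0..} (\<lambda>x. T x * (2 * Re (cnj (f x) * g x)) + T x * (T x * (cmod (f x))\<^sup>2))
        + k / 2 * integral {0..} (\<lambda>x. (cmod (f x)) ^ 4)"
    unfolding q_def
    using Henstock_Kurzweil_Integration.integral_add[OF iq1[THEN abs_int_integrable] iq2[THEN abs_int_integrable]]
    by simp
  moreover have "d = integral {0..} (\<lambda>x. (cmod (g x))\<^sup>2)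
      + integral {0..} (\<lambda>x. T x * (2 * Re (cnj (f x) * g x)) + T x * (T x * (cmod (f x))\<^sup>2))"
    unfolding d_def cmod_D_square
    by (rule Henstock_Kurzweil_Integration.integral_add[OF g2[THEN abs_int_integrable] iq1[THEN abs_int_integrable]])
  ultimately show ?thesis using q by linarith
qed

definition S :: "real \<Rightarrow> real" where "S x = k / 2 * (cmod (f x))\<^sup>2 + T x * T x"
text \<open>Twice the Cauchy-Schwarz bound \<open>k * sqrt (m * d)\<close> for the total variation
  of \<open>S\<close>.\<close>

definition \<eta> :: real where "\<eta> = 2 * k * sqrt (m * d)"

lemma \<eta>_nonneg: "0 \<le> \<eta>"
  using k m_nonneg d_nonneg by (simp add: \<eta>_def)

lemma \<eta>_square: "\<eta>\<^sup>2 = 4 * k\<^sup>2 * (m * d)"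
  using m_nonneg d_nonneg by (simp add: \<eta>_def power_mult_distrib)

text \<open>\<open>S\<close> is a first integral of the soliton equation.\<close>

lemma S_bound:
  assumes x: "0 \<le> x"
  shows "\<bar>S x - t\<^sup>2\<bar> \<le> \<eta>"
proof -
  define s where "s = (\<lambda>x. k * Re (cnj (f x) * D x))"
  have "has_ac_deriv S (\<lambda>x. k / 2 * (2 * Re (cnj (f x) * g x))
      + (k / 2 * (cmod (f x))\<^sup>2 * T x + T x * (k / 2 * (cmod (f x))\<^sup>2)))"
    unfolding S_def[abs_def] by (intro has_ac_deriv_add has_ac_deriv_cmult has_ac_deriv_mult T_ac f2_ac)
  \<comment> \<open>The two terms combine to \<open>k * Re (cnj (f x) * D x)\<close>: the first
    integral varies only through the defect.\<close>
  then have ac: "has_ac_deriv S s"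
    by (rule has_ac_deriv_cong)
      (auto simp: s_def D_def cmod_power2, simp_all add: algebra_simps power2_eq_square)
  have si: "s absolutely_integrable_on {0..}"
    unfolding s_def by (intro set_integrable_mult_right Re_cnj_abs_int f D_L2)
  have ifD: "(\<lambda>x. cmod (f x * D x)) integrable_on {0..}"
    using L2_mult[OF f D_L2] by (simp add: absolutely_integrable_on_def)
  have "integral {0..} (\<lambda>x. norm (s x)) \<le> integral {0..} (\<lambda>x. k * cmod (f x * D x))"
  proof (rule integral_le)
    show "(\<lambda>x. norm (s x)) integrable_on {0..}"
      using si by (simp add: absolutely_integrable_on_def)
    show "(\<lambda>x. k * cmod (f x * D x)) integrable_on {0..}"
      using ifD by (rule integrable_on_mult_right)
    show "norm (s x) \<le> k * cmod (f x * D x)" for x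
      using k abs_Re_le_cmod[of "cnj (f x) * D x"] by (simp add: s_def abs_mult norm_mult)
  qed
  also have "\<dots> = k * integral {0..} (\<lambda>x. cmod (f x * D x))"
    by simp
  also have "\<dots> \<le> k * sqrt (m * d)"
    using L2_Cauchy_Schwarz[OF f D_L2] k
    by (intro mult_left_mono real_le_rsqrt) (auto simp: m_def d_def)
  finally have bound: "integral {0..} (\<lambda>x. norm (s x)) \<le> k * sqrt (m * d)" .
  have diff: "\<bar>S y - S 0\<bar> \<le> k * sqrt (m * d)" if "0 \<le> y" for y
    using has_ac_deriv_norm_diff_le[OF ac si that] bound by simp
  \<comment> \<open>\<open>S\<close> tends to \<open>t\<^sup>2\<close>, so the variation bound also
    controls \<open>t\<^sup>2 - S 0\<close>. Passing through \<open>S 0\<close> costs the factor two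
    in \<open>\<eta>\<close>.\<close>
  have "(S \<longlongrightarrow> k / 2 * 0 + t * t) at_top"
    unfolding S_def[abs_def] by (intro tendsto_intros T_tendsto f2_tendsto)
  then have "((\<lambda>y. \<bar>S y - S 0\<bar>) \<longlongrightarrow> \<bar>t\<^sup>2 - S 0\<bar>) at_top"
    by (intro tendsto_intros) (simp add: power2_eq_square)
  then have "\<bar>t\<^sup>2 - S 0\<bar> \<le> k * sqrt (m * d)"
    by (rule tendsto_upperbound[OF _ eventually_mono[OF eventually_ge_at_top[of 0] diff]]) auto
  then show ?thesis using diff[OF x] unfolding \<eta>_def by linarith
qed

end

section \<open>Stability of the soliton\<close>

text \<open>A function \<open>f\<close> is compared with an exact solution \<open>\<phi>\<close> for
  the same \<open>k\<close> and \<open>t\<close>. Positivity of both values \<open>z\<close> keeps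
  both functions \<open>T\<close> positive on the half-line, which damps the errors.\<close>

locale edge_soliton = edge f g k t + sol: edge \<phi> \<psi> k t for f g k t \<phi> \<psi> +
  assumes D_sol: "\<And>x. 0 \<le> x \<Longrightarrow> sol.D x = 0"
    and z_sol: "0 < sol.z" and z: "0 < z"
begin

lemma sol_d: "sol.d = 0"
proof -
  have "sol.d = integral {0::real..} (\<lambda>x. 0 :: real)"
    unfolding sol.d_def by (rule Henstock_Kurzweil_Integration.integral_cong) (use D_sol in auto)
  then show ?thesis by simp
qed

lemma sol_S: "0 \<le> x \<Longrightarrow> sol.S x = t\<^sup>2"
  using sol.S_bound[of x] by (simp add: sol.\<eta>_def sol_d)

text \<open>The initial discrepancy plus the level at which a forcing of size \<open>\<eta>\<close>
  balances the damping rate \<open>sol.z\<close>.\<close>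

definition \<Delta> :: real where "\<Delta> = (z - sol.z)\<^sup>2 + (\<eta> / sol.z)\<^sup>2"

text \<open>Since \<open>T' = S - T\<^sup>2\<close>, and \<open>S\<close> is constantly
  \<open>t\<^sup>2\<close> for the soliton, the difference \<open>\<delta>\<close> obeys
  \<open>\<delta>' = (S - t\<^sup>2) - (T + sol.T) * \<delta>\<close>. The damping coefficient is at
  least \<open>sol.z\<close>, and a Gronwall argument for \<open>\<delta>\<^sup>2\<close> gives a
  bound uniform in \<open>x\<close>.\<close>

lemma T_diff_bound:
  assumes x: "0 \<le> x"
  shows "(T x - sol.T x)\<^sup>2 \<le> \<Delta>"
proof -
  define \<delta> where "\<delta> = (\<lambda>x. T x - sol.T x)"
  define \<delta>' where "\<delta>' = (\<lambda>x. k / 2 * (cmod (f x))\<^sup>2 - k / 2 * (cmod (\<phi> x))\<^sup>2)"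
  define c where "c = (\<eta> / sol.z)\<^sup>2"
  have \<delta>: "has_ac_deriv \<delta> \<delta>'"
    unfolding \<delta>_def \<delta>'_def by (intro has_ac_deriv_diff T_ac sol.T_ac)
  have E: "has_ac_deriv (\<lambda>x. exp (sol.z * x)) (\<lambda>x. sol.z * exp (sol.z * x))"
    by (rule has_ac_deriv_of_has_vector_derivative)
      (auto intro!: derivative_eq_intros continuous_intros
        simp: has_real_derivative_iff_has_vector_derivative[symmetric])
  \<comment> \<open>The integrating factor turns the differential inequality
    \<open>(\<delta>\<^sup>2)' \<le> - sol.z * (\<delta>\<^sup>2 - c)\<close> into monotonicity of
    \<open>W\<close>.\<close>
  define W where "W = (\<lambda>x. exp (sol.z * x) * (\<delta> x * \<delta> x - c))"
  define W' where "W' = (\<lambda>x. sol.z * exp (sol.z * x) * (\<delta> x * \<delta> x - c)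
      + exp (sol.z * x) * ((\<delta>' x * \<delta> x + \<delta> x * \<delta>' x) - 0))"
  have W: "has_ac_deriv W W'"
    unfolding W_def W'_def
    by (intro has_ac_deriv_mult has_ac_deriv_diff has_ac_deriv_const E \<delta>)
  have W'_nonpos: "W' y \<le> 0" if y: "0 \<le> y" for y
  proof -
    have \<delta>'_eq: "\<delta>' y = (S y - t\<^sup>2) - (T y + sol.T y) * \<delta> y"
      using sol_S[OF y] by (simp add: \<delta>'_def \<delta>_def S_def sol.S_def algebra_simps)
    have "2 * \<delta> y * \<delta>' y = 2 * (\<delta> y * (S y - t\<^sup>2)) - 2 * ((T y + sol.T y) * (\<delta> y)\<^sup>2)"
      unfolding \<delta>'_eq by (simp add: power2_eq_square algebra_simps)
    moreover have "\<delta> y * (S y - t\<^sup>2) \<le> \<bar>\<delta> y\<bar> * \<eta>"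
    proof -
      have "\<delta> y * (S y - t\<^sup>2) \<le> \<bar>\<delta> y * (S y - t\<^sup>2)\<bar>" by simp
      also have "\<dots> \<le> \<bar>\<delta> y\<bar> * \<eta>"
        unfolding abs_mult using S_bound[OF y] by (intro mult_left_mono) auto
      finally show ?thesis .
    qed
    \<comment> \<open>Young's inequality, weighted so that the forcing uses up only half of the
      guaranteed damping \<open>2 * sol.z * (\<delta> y)\<^sup>2\<close>.\<close>
    moreover have "2 * (\<bar>\<delta> y\<bar> * \<eta>) \<le> sol.z * (\<delta> y)\<^sup>2 + \<eta>\<^sup>2 / sol.z"
    proof -
      have "0 \<le> (sol.z * \<bar>\<delta> y\<bar> - \<eta>)\<^sup>2 / sol.z" using z_sol by simp
      also have "\<dots> = sol.z * (\<delta> y)\<^sup>2 + \<eta>\<^sup>2 / sol.z - 2 * (\<bar>\<delta> y\<bar> * \<eta>)"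
        using z_sol by (simp add: power2_diff field_simps power2_eq_square)
      finally show ?thesis by simp
    qed
    moreover have "sol.z * (\<delta> y)\<^sup>2 \<le> (T y + sol.T y) * (\<delta> y)\<^sup>2"
      using T_bounds(1)[OF y] sol.T_bounds(1)[OF y] z by (intro mult_right_mono) auto
    ultimately have "2 * \<delta> y * \<delta>' y \<le> \<eta>\<^sup>2 / sol.z - sol.z * (\<delta> y)\<^sup>2" by linarith
    moreover have "sol.z * c = \<eta>\<^sup>2 / sol.z"
      using z_sol by (simp add: c_def power2_eq_square)
    ultimately have "sol.z * (\<delta> y * \<delta> y - c) + 2 * \<delta> y * \<delta>' y \<le> 0"
      by (simp add: right_diff_distrib power2_eq_square)
    then have "exp (sol.z * y) * (sol.z * (\<delta> y * \<delta> y - c) + 2 * \<delta> y * \<delta>' y) \<le> 0"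
      by (intro mult_nonneg_nonpos) auto
    then show ?thesis by (simp add: W'_def algebra_simps)
  qed
  have "W x \<le> W 0"
    by (rule has_ac_deriv_antimono[OF W W'_nonpos x])
  then have "exp (sol.z * x) * (\<delta> x * \<delta> x - c) \<le> (z - sol.z)\<^sup>2 - c"
    by (simp add: W_def \<delta>_def power2_eq_square)
  also have "\<dots> \<le> (z - sol.z)\<^sup>2" by (simp add: c_def)
  also have "\<dots> \<le> exp (sol.z * x) * (z - sol.z)\<^sup>2"
    using z_sol x by (simp add: mult_le_cancel_right1)
  finally have "\<delta> x * \<delta> x - c \<le> (z - sol.z)\<^sup>2" by simp
  then show ?thesis by (simp add: \<Delta>_def c_def \<delta>_def power2_eq_square)
qed

text \<open>Bounds the squared norm of the residual \<open>R\<close> in the equation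
  \<open>h' + T h = R\<close> for the difference \<open>h\<close> of \<open>f\<close> and
  \<open>\<phi>\<close>.\<close>

definition \<rho> :: real where "\<rho> = 2 * d + 2 * \<Delta> * sol.m"

text \<open>The difference \<open>h\<close> satisfies a linear equation \<open>h' + T h = R\<close>
  whose residual consists of \<open>D\<close> and \<open>(T - sol.T) * \<phi>\<close>. Multiplying
  by the conjugate of \<open>h\<close>, integrating and using \<open>T \<ge> z > 0\<close> bounds
  \<open>h\<close> by its vertex value and \<open>R\<close>; the equation then bounds
  \<open>h'\<close>, as \<open>T \<le> t\<close>.\<close>

lemma soliton_distance:
  shows "integral {0..} (\<lambda>x. (cmod (f x - \<phi> x))\<^sup>2) \<le> ((cmod (f 0 - \<phi> 0))\<^sup>2 + \<rho> / z) / z" (is ?th1)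
    and "integral {0..} (\<lambda>x. (cmod (g x - \<psi> x))\<^sup>2)
       \<le> 2 * t\<^sup>2 * (((cmod (f 0 - \<phi> 0))\<^sup>2 + \<rho> / z) / z) + 2 * \<rho>" (is ?th2)
proof -
  define h where "h = (\<lambda>x. f x - \<phi> x)"
  define h' where "h' = (\<lambda>x. g x - \<psi> x)"
  define R where "R = (\<lambda>x. h' x + of_real (T x) * h x)"
  have h: "h \<in> Lp_halfline 2" and h': "h' \<in> Lp_halfline 2"
    unfolding h_def h'_def by (intro L2_diff f g sol.f sol.g)+
  have hac: "has_ac_deriv h h'"
    unfolding h_def h'_def by (intro has_ac_deriv_diff ac sol.ac)
  have R: "R \<in> Lp_halfline 2"
    unfolding R_def by (intro L2_add h' Tf_L2 h)
  have h2: "(\<lambda>x. (cmod (h x))\<^sup>2) absolutely_integrable_on {0..}"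
    and R2: "(\<lambda>x. (cmod (R x))\<^sup>2) absolutely_integrable_on {0..}"
    and h'2: "(\<lambda>x. (cmod (h' x))\<^sup>2) absolutely_integrable_on {0..}"
    using h R h' by (auto simp: Lp_halfline_2_iff)
  note i = h2[THEN abs_int_integrable] R2[THEN abs_int_integrable] h'2[THEN abs_int_integrable]
    D2[THEN abs_int_integrable] sol.f2[THEN abs_int_integrable]
  have "(cmod (R x))\<^sup>2 \<le> 2 * (cmod (D x))\<^sup>2 + 2 * \<Delta> * (cmod (\<phi> x))\<^sup>2" if x: "0 \<le> x" for x
  proof -
    have "\<psi> x = - of_real (sol.T x) * \<phi> x"
      using D_sol[OF x] by (simp add: sol.D_def add_eq_0_iff2)
    then have "R x = D x + - (of_real (T x - sol.T x) * \<phi> x)"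
      by (simp add: R_def h_def h'_def D_def algebra_simps)
    then have "(cmod (R x))\<^sup>2 \<le> 2 * (cmod (D x))\<^sup>2 + 2 * (cmod (of_real (T x - sol.T x) * \<phi> x))\<^sup>2"
      using cmod_add_square_le[of "D x" "- (of_real (T x - sol.T x) * \<phi> x)"] by simp
    also have "(cmod (of_real (T x - sol.T x) * \<phi> x))\<^sup>2 = (T x - sol.T x)\<^sup>2 * (cmod (\<phi> x))\<^sup>2"
      by (simp add: norm_mult power_mult_distrib del: of_real_diff)
    also have "\<dots> \<le> \<Delta> * (cmod (\<phi> x))\<^sup>2"
      by (intro mult_right_mono T_diff_bound x) auto
    finally show ?thesis by simp
  qed
  then have "integral {0..} (\<lambda>x. (cmod (R x))\<^sup>2)
      \<le> integral {0..} (\<lambda>x. 2 * (cmod (D x))\<^sup>2 + 2 * \<Delta> * (cmod (\<phi> x))\<^sup>2)"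
    by (intro integral_le integrable_add integrable_on_mult_right i) auto
  also have "\<dots> = \<rho>"
    unfolding \<rho>_def d_def sol.m_def using i
    by (subst Henstock_Kurzweil_Integration.integral_add) (auto intro: integrable_on_mult_right)
  finally have R\<rho>: "integral {0..} (\<lambda>x. (cmod (R x))\<^sup>2) \<le> \<rho>" .
  have hh': "(\<lambda>x. 2 * Re (cnj (h x) * h' x)) absolutely_integrable_on {0..}"
    by (intro set_integrable_mult_right Re_cnj_abs_int h h')
  \<comment> \<open>Substitute the equation for \<open>h'\<close> and split the product of
    \<open>h\<close> and \<open>R\<close> by Young's inequality; half of the term with
    \<open>T\<close> absorbs the part in \<open>h\<close>.\<close>
  have pt: "2 * Re (cnj (h x) * h' x) \<le> (1 / z) * (cmod (R x))\<^sup>2 - z * (cmod (h x))\<^sup>2" if x: "0 \<le> x" for x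
  proof -
    have "Re (cnj (h x) * R x) \<le> cmod (h x) * cmod (R x)"
      using complex_Re_le_cmod[of "cnj (h x) * R x"] by (simp add: norm_mult)
    moreover have "0 \<le> (z * cmod (h x) - cmod (R x))\<^sup>2 / z" using z by simp
    then have "2 * (cmod (h x) * cmod (R x)) \<le> z * (cmod (h x))\<^sup>2 + (1 / z) * (cmod (R x))\<^sup>2"
      using z by (simp add: power2_diff field_simps power2_eq_square)
    moreover have "z * (cmod (h x))\<^sup>2 \<le> T x * (cmod (h x))\<^sup>2"
      using T_bounds(1)[OF x] by (intro mult_right_mono) auto
    moreover have "Re (cnj (h x) * h' x) = Re (cnj (h x) * R x) - T x * (cmod (h x))\<^sup>2"
      unfolding R_def cmod_power2 by (simp add: algebra_simps power2_eq_square)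
    ultimately show ?thesis by linarith
  qed
  have "- (cmod (h 0))\<^sup>2 = integral {0..} (\<lambda>x. 2 * Re (cnj (h x) * h' x))"
    using has_ac_deriv_integrable(1)[OF has_ac_deriv_cmod_square[OF hac] h2 hh'] by simp
  also have "\<dots> \<le> integral {0..} (\<lambda>x. (1 / z) * (cmod (R x))\<^sup>2 - z * (cmod (h x))\<^sup>2)"
    by (intro integral_le integrable_diff integrable_on_mult_right i abs_int_integrable[OF hh'] pt) auto
  also have "\<dots> = (1 / z) * integral {0..} (\<lambda>x. (cmod (R x))\<^sup>2) - z * integral {0..} (\<lambda>x. (cmod (h x))\<^sup>2)"
    by (subst Henstock_Kurzweil_Integration.integral_diff) ((rule integrable_on_mult_right, rule i)+, simp)
  also have "\<dots> \<le> (1 / z) * \<rho> - z * integral {0..} (\<lambda>x. (cmod (h x))\<^sup>2)"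
    using R\<rho> z by (intro diff_right_mono mult_left_mono) auto
  finally have "integral {0..} (\<lambda>x. (cmod (h x))\<^sup>2) * z \<le> (cmod (h 0))\<^sup>2 + \<rho> / z"
    by (simp add: mult.commute)
  then have th1: "integral {0..} (\<lambda>x. (cmod (h x))\<^sup>2) \<le> ((cmod (h 0))\<^sup>2 + \<rho> / z) / z"
    using z by (simp add: pos_le_divide_eq)
  then show ?th1 by (simp add: h_def)
  have "(cmod (h' x))\<^sup>2 \<le> 2 * t\<^sup>2 * (cmod (h x))\<^sup>2 + 2 * (cmod (R x))\<^sup>2" if x: "0 \<le> x" for x
  proof -
    have "(cmod (h' x))\<^sup>2 \<le> 2 * (cmod (- (of_real (T x) * h x)))\<^sup>2 + 2 * (cmod (R x))\<^sup>2"
      using cmod_add_square_le[of "- (of_real (T x) * h x)" "R x"] by (simp add: R_def)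
    also have "(cmod (- (of_real (T x) * h x)))\<^sup>2 = (T x)\<^sup>2 * (cmod (h x))\<^sup>2"
      by (simp add: norm_mult power_mult_distrib del: of_real_diff)
    also have "(T x)\<^sup>2 * (cmod (h x))\<^sup>2 \<le> t\<^sup>2 * (cmod (h x))\<^sup>2"
      using T_bounds[OF x] z by (intro mult_right_mono power_mono) auto
    finally show ?thesis by simp
  qed
  then have "integral {0..} (\<lambda>x. (cmod (h' x))\<^sup>2)
      \<le> integral {0..} (\<lambda>x. 2 * t\<^sup>2 * (cmod (h x))\<^sup>2 + 2 * (cmod (R x))\<^sup>2)"
    by (intro integral_le integrable_add integrable_on_mult_right i) auto
  also have "\<dots> = 2 * t\<^sup>2 * integral {0..} (\<lambda>x. (cmod (h x))\<^sup>2) + 2 * integral {0..} (\<lambda>x. (cmod (R x))\<^sup>2)"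
    using i by (subst Henstock_Kurzweil_Integration.integral_add) (auto intro: integrable_on_mult_right)
  also have "\<dots> \<le> 2 * t\<^sup>2 * (((cmod (h 0))\<^sup>2 + \<rho> / z) / z) + 2 * \<rho>"
    using R\<rho> th1 by (intro add_mono mult_left_mono) auto
  finally show ?th2 by (simp add: h_def h'_def)
qed

end

section \<open>The soliton\<close>

text \<open>The sech profile, shifted by \<open>x0\<close> and turned by the phase
  \<open>\<zeta>\<close>.\<close>

definition soliton :: "real \<Rightarrow> real \<Rightarrow> real \<Rightarrow> complex \<Rightarrow> real \<Rightarrow> complex" where
  "soliton k t x0 \<zeta> = (\<lambda>x. \<zeta> * of_real (sqrt (2 / k) * t / cosh (t * x + x0)))"

text \<open>Written as \<open>- T\<close> times the soliton, so that the vanishing of the defect can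
  be read off.\<close>

definition soliton_deriv :: "real \<Rightarrow> real \<Rightarrow> real \<Rightarrow> complex \<Rightarrow> real \<Rightarrow> complex" where
  "soliton_deriv k t x0 \<zeta> = (\<lambda>x. - of_real (t * tanh (t * x + x0)) * soliton k t x0 \<zeta> x)"

lemma tanh_surj:
  fixes q :: real
  assumes "0 < q" "q < 1"
  obtains x where "0 \<le> x" "tanh x = q"
proof -
  \<comment> \<open>This is \<open>exp\<close> of the inverse hyperbolic tangent of
    \<open>q\<close>.\<close>
  define y where "y = sqrt ((1 + q) / (1 - q))"
  have y2: "y\<^sup>2 = (1 + q) / (1 - q)" using assms by (simp add: y_def)
  have "y \<ge> 1" using assms by (simp add: y_def)
  then have "tanh (ln y) = (y\<^sup>2 - 1) / (y\<^sup>2 + 1)" by (intro tanh_ln_real) auto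
  also have "\<dots> = q" unfolding y2 using assms by (simp add: divide_simps)
  finally show ?thesis using that[of "ln y"] \<open>y \<ge> 1\<close> by simp
qed

context
  fixes k t x0 :: real and \<zeta> :: complex
  assumes k: "k > 0" and t: "t > 0" and x0: "0 \<le> x0" and \<zeta>: "cmod \<zeta> = 1"
begin

text \<open>The form with \<open>tanh\<close> shows that \<open>k / 2\<close> times this is the
  derivative of \<open>t * tanh (t * x + x0)\<close>, which identifies \<open>T\<close> for the
  soliton.\<close>

lemma soliton_square:
  "(cmod (soliton k t x0 \<zeta> x))\<^sup>2 = 2 / k * (t\<^sup>2 * (1 - (tanh (t * x + x0))\<^sup>2))"
proof -
  have c: "cosh (t * x + x0) \<noteq> 0" using cosh_real_pos[of "t * x + x0"] by simp
  have "1 - (tanh (t * x + x0))\<^sup>2 = 1 / (cosh (t * x + x0))\<^sup>2"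
  proof -
    have "(sinh (t * x + x0))\<^sup>2 = (cosh (t * x + x0))\<^sup>2 - 1"
      by (simp add: cosh_square_eq)
    then show ?thesis using c by (simp add: tanh_def power_divide diff_divide_distrib)
  qed
  then show ?thesis
    using k t \<zeta> by (simp add: soliton_def norm_mult norm_divide power_mult_distrib power_divide)
qed

lemma soliton_ac: "has_ac_deriv (soliton k t x0 \<zeta>) (soliton_deriv k t x0 \<zeta>)"
proof -
  define r where "r = (\<lambda>x. sqrt (2 / k) * t / cosh (t * x + x0))"
  have D: "(r has_real_derivative - (t * tanh (t * x + x0)) * r x) (at x within {0..})" for x
  proof -
    have c: "cosh (t * x + x0) \<noteq> 0" using cosh_real_pos[of "t * x + x0"] by simp
    have "(r has_real_derivative - (sqrt (2 / k) * t * (sinh (t * x + x0) * t))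
        / (cosh (t * x + x0) * cosh (t * x + x0))) (at x within {0..})"
      unfolding r_def by (rule derivative_eq_intros refl | use c in simp)+
    moreover have "- (sqrt (2 / k) * t * (sinh (t * x + x0) * t)) / (cosh (t * x + x0) * cosh (t * x + x0))
        = - (t * tanh (t * x + x0)) * r x"
      by (simp add: r_def tanh_def)
    ultimately show ?thesis by simp
  qed
  have "has_ac_deriv r (\<lambda>x. - (t * tanh (t * x + x0)) * r x)"
  proof (rule has_ac_deriv_of_has_vector_derivative)
    show "(r has_vector_derivative - (t * tanh (t * x + x0)) * r x) (at x within {0..})" for x
      using D by (simp add: has_real_derivative_iff_has_vector_derivative)
    show "continuous_on {0..} (\<lambda>x. - (t * tanh (t * x + x0)) * r x)"
      unfolding r_def tanh_def by (intro continuous_intros) (auto simp: less_imp_neq[symmetric])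
  qed
  from has_ac_deriv_cmult[OF has_ac_deriv_linear[OF bounded_linear_of_real this], of \<zeta>]
  show ?thesis
    by (rule has_ac_deriv_cong) (auto simp: soliton_def soliton_deriv_def r_def)
qed

lemma soliton_measurable: "soliton k t x0 \<zeta> \<in> borel_measurable halfline"
  using has_ac_deriv_continuous[OF soliton_ac] by (intro continuous_imp_measurable_on_sets_lebesgue) auto

lemma soliton_L2: "soliton k t x0 \<zeta> \<in> Lp_halfline 2"
  unfolding Lp_halfline_2_iff
proof
  show "(\<lambda>x. (cmod (soliton k t x0 \<zeta> x))\<^sup>2) absolutely_integrable_on {0..}"
  proof (rule abs_int_bound)
    show "(\<lambda>x. (cmod (soliton k t x0 \<zeta> x))\<^sup>2) \<in> borel_measurable halfline"
      using soliton_measurable by measurable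
    show "(\<lambda>x. 4 * t\<^sup>2 / k * exp (- t * x)) absolutely_integrable_on {0..}"
      using k t by (intro nonnegative_absolutely_integrable_1 integrable_on_mult_right
          integrable_on_exp_minus_to_infinity) auto
    show "norm ((cmod (soliton k t x0 \<zeta> x))\<^sup>2) \<le> 4 * t\<^sup>2 / k * exp (- t * x)" if x: "0 \<le> x" for x
    proof -
      define y where "y = t * x + x0"
      \<comment> \<open>One factor \<open>cosh y\<close> gives exponential decay, the other is
        merely at least \<open>1\<close>.\<close>
      have "exp (t * x) \<le> exp y" using x0 by (simp add: y_def)
      also have "\<dots> \<le> 2 * cosh y" by (simp add: cosh_def)
      also have "\<dots> \<le> 2 * (cosh y)\<^sup>2"
        using cosh_real_ge_1[of y] by (simp add: power2_eq_square)
      finally have "1 / (cosh y)\<^sup>2 \<le> 2 / exp (t * x)"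
        using cosh_real_pos[of y] by (simp add: field_simps)
      moreover have "(cmod (soliton k t x0 \<zeta> x))\<^sup>2 = 2 * t\<^sup>2 / k * (1 / (cosh y)\<^sup>2)"
        using k t \<zeta> by (simp add: soliton_def norm_mult norm_divide power_mult_distrib power_divide y_def)
      moreover have "2 * t\<^sup>2 / k * (1 / (cosh y)\<^sup>2) \<le> 2 * t\<^sup>2 / k * (2 / exp (t * x))"
        using calculation(1) k by (intro mult_left_mono) auto
      moreover have "2 * t\<^sup>2 / k * (2 / exp (t * x)) = 4 * t\<^sup>2 / k * exp (- t * x)"
        by (simp add: exp_minus divide_inverse)
      moreover have "norm ((cmod (soliton k t x0 \<zeta> x))\<^sup>2) = (cmod (soliton k t x0 \<zeta> x))\<^sup>2"
        by (simp only: real_norm_def abs_power2)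
      ultimately show ?thesis by linarith
    qed
  qed
qed (rule soliton_measurable)

lemma soliton_deriv_L2: "soliton_deriv k t x0 \<zeta> \<in> Lp_halfline 2"
  unfolding soliton_deriv_def
proof (rule L2_bounded_mult[OF _ _ soliton_L2])
  show "(\<lambda>x. - complex_of_real (t * tanh (t * x + x0))) \<in> borel_measurable halfline"
    unfolding tanh_def by (intro continuous_imp_measurable_on_sets_lebesgue continuous_intros)
      (auto simp: less_imp_neq[symmetric])
  show "cmod (- complex_of_real (t * tanh (t * x + x0))) \<le> t" for x
  proof -
    have "cmod (- complex_of_real (t * tanh (t * x + x0))) = t * \<bar>tanh (t * x + x0)\<bar>"
      using t by (simp only: norm_minus_cancel norm_of_real abs_mult abs_of_pos)
    also have "\<dots> \<le> t * 1"
      using t tanh_real_bounds[of "t * x + x0"] by (intro mult_left_mono) auto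
    finally show ?thesis by simp
  qed
qed

lemma soliton_edge: "edge (soliton k t x0 \<zeta>) (soliton_deriv k t x0 \<zeta>) k"
  by unfold_locales (rule soliton_L2 soliton_deriv_L2 soliton_ac k)+

lemma soliton_tanh_ac:
  "has_ac_deriv (\<lambda>x. t * tanh (t * x + x0)) (\<lambda>x. k / 2 * (cmod (soliton k t x0 \<zeta> x))\<^sup>2)"
proof (rule has_ac_deriv_of_has_vector_derivative)
  have "((\<lambda>x. t * tanh (t * x + x0)) has_real_derivative k / 2 * (cmod (soliton k t x0 \<zeta> x))\<^sup>2)
      (at x within {0..})" for x
    unfolding soliton_square using k cosh_real_pos[of "t * x + x0"]
    by (auto intro!: derivative_eq_intros simp: power2_eq_square)
  then show "((\<lambda>x. t * tanh (t * x + x0)) has_vector_derivative k / 2 * (cmod (soliton k t x0 \<zeta> x))\<^sup>2)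
      (at x within {0..})" for x
    by (simp add: has_real_derivative_iff_has_vector_derivative)
  show "continuous_on {0..} (\<lambda>x. k / 2 * (cmod (soliton k t x0 \<zeta> x))\<^sup>2)"
    using has_ac_deriv_continuous[OF soliton_ac] by (intro continuous_intros)
qed

interpretation sol: edge "soliton k t x0 \<zeta>" "soliton_deriv k t x0 \<zeta>" k t
  by (rule soliton_edge)

text \<open>The mass is the total increase of \<open>t * tanh (t * x + x0)\<close>, which tends to
  \<open>t\<close>, up to the factor \<open>k / 2\<close>.\<close>

lemma soliton_mass: "sol.m = 2 / k * (t - t * tanh x0)"
proof -
  have i: "(\<lambda>x. k / 2 * (cmod (soliton k t x0 \<zeta> x))\<^sup>2) absolutely_integrable_on {0..}"
    using sol.f2 by (intro set_integrable_mult_right) auto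
  have eq: "integral {0..} (\<lambda>x. k / 2 * (cmod (soliton k t x0 \<zeta> x))\<^sup>2) = k / 2 * sol.m"
    by (simp add: sol.m_def)
  have "filterlim (\<lambda>x. x0 + t * x) at_top at_top"
    by (intro filterlim_tendsto_add_at_top[OF tendsto_const]
        filterlim_tendsto_pos_mult_at_top[OF tendsto_const t] filterlim_ident)
  then have "filterlim (\<lambda>x. t * x + x0) at_top at_top" by (simp add: add.commute)
  then have "((\<lambda>x. t * tanh (t * x + x0)) \<longlongrightarrow> t * 1) at_top"
    by (intro tendsto_intros filterlim_compose[OF tanh_real_at_top])
  moreover have "((\<lambda>x. t * tanh (t * x + x0)) \<longlongrightarrow> t * tanh (t * 0 + x0) + k / 2 * sol.m) at_top"
    using has_ac_deriv_tendsto[OF soliton_tanh_ac i] unfolding eq .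
  ultimately have "t * 1 = t * tanh (t * 0 + x0) + k / 2 * sol.m"
    by (rule tendsto_unique[OF trivial_limit_at_top_linorder])
  then show ?thesis using k by (simp add: field_simps)
qed

lemma soliton_z: "sol.z = t * tanh x0"
  using k by (simp add: sol.z_def soliton_mass field_simps)

lemma soliton_T: "0 \<le> x \<Longrightarrow> sol.T x = t * tanh (t * x + x0)"
  using has_ac_deriv_eq[OF soliton_tanh_ac, of x] by (simp add: sol.T_def soliton_z)

lemma soliton_D: "0 \<le> x \<Longrightarrow> sol.D x = 0"
  by (simp only: sol.D_def soliton_T) (simp add: soliton_deriv_def)

lemma soliton_d: "sol.d = 0"
proof -
  have "sol.d = integral {0::real..} (\<lambda>x. 0 :: real)"
    unfolding sol.d_def by (rule Henstock_Kurzweil_Integration.integral_cong) (use soliton_D in auto)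
  then show ?thesis by simp
qed

end

section \<open>The scalar problem on the star graph\<close>

lemma Lp_norm_pow:
  assumes "0 < p"
  shows "Lp_norm N p u ^ p = (\<Sum>e=1..N. LINT x|halfline. cmod (u e x) ^ p)"
  unfolding Lp_norm_def using assms
  by (intro real_root_pow_pos2 sum_nonneg Bochner_Integration.integral_nonneg) auto

lemma H1_graph_edge:
  assumes "u \<in> H1_graph N" "e \<in> {1..N}" "0 < k"
  shows "edge (u e) (weak_deriv (u e)) k"
proof -
  have "u e \<in> H1_halfline" using assms by (auto simp: H1_graph_def)
  from H1_halflineD[OF this] assms(3) show ?thesis by unfold_locales
qed

definition int2 :: "(real \<Rightarrow> complex) \<Rightarrow> real" where "int2 f = integral {0..} (\<lambda>x. (cmod (f x))\<^sup>2)"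
definition int4 :: "(real \<Rightarrow> complex) \<Rightarrow> real" where "int4 f = integral {0..} (\<lambda>x. cmod (f x) ^ 4)"

lemma int2_L2: "f \<in> Lp_halfline 2 \<Longrightarrow> (LINT x|halfline. (cmod (f x))\<^sup>2) = int2 f"
  unfolding int2_def by (rule halfline_integral) (auto simp: Lp_halfline_2_iff)

lemma Lp_norm_H1:
  assumes "u \<in> H1_graph N"
  shows "(Lp_norm N 2 u)\<^sup>2 = (\<Sum>e=1..N. int2 (u e))"
    and "(Lp_norm N 2 (graph_deriv u))\<^sup>2 = (\<Sum>e=1..N. int2 (weak_deriv (u e)))"
    and "Lp_norm N 4 u ^ 4 = (\<Sum>e=1..N. int4 (u e))"
proof -
  have E: "edge (u e) (weak_deriv (u e)) 1" if "e \<in> {1..N}" for e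
    using H1_graph_edge[OF assms that] by simp
  show "(Lp_norm N 2 u)\<^sup>2 = (\<Sum>e=1..N. int2 (u e))"
    by (subst Lp_norm_pow) (auto intro!: sum.cong int2_L2 edge.f[OF E])
  show "(Lp_norm N 2 (graph_deriv u))\<^sup>2 = (\<Sum>e=1..N. int2 (weak_deriv (u e)))"
    by (subst Lp_norm_pow) (auto simp: graph_deriv_def intro!: sum.cong int2_L2 edge.g[OF E])
  show "Lp_norm N 4 u ^ 4 = (\<Sum>e=1..N. int4 (u e))"
    unfolding int4_def
    by (subst Lp_norm_pow) (auto intro!: sum.cong halfline_integral edge.f4[OF E])
qed

lemma H1_norm_square:
  assumes "u \<in> H1_graph N"
  shows "(H1_norm N u)\<^sup>2 = (\<Sum>e=1..N. int2 (u e) + int2 (weak_deriv (u e)))"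
  unfolding sum.distrib Lp_norm_H1(1,2)[OF assms, symmetric] H1_norm_def
  by (intro real_sqrt_pow2 add_nonneg_nonneg zero_le_power2)

definition scalar_energy :: "nat \<Rightarrow> real \<Rightarrow> real \<Rightarrow> graph_fun \<Rightarrow> real" where
  "scalar_energy N \<gamma> k u = (\<Sum>e=1..N. int2 (weak_deriv (u e))) - \<gamma> * (cmod (u 1 0))\<^sup>2
     - k / 2 * (\<Sum>e=1..N. int4 (u e))"

locale star =
  fixes N :: nat and \<gamma> t k :: real
  assumes N: "N \<ge> 1" and \<gamma>: "\<gamma> > 0" and t: "\<gamma> / real N < t"
    and small: "real N * t - \<gamma> \<le> 2 * \<gamma> / real N" and k: "k > 0"
begin

text \<open>The equal share of \<open>\<gamma>\<close> on each edge. It is the value of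
  \<open>z\<close> on every edge of the minimizer, where the scalar energy equals
  \<open>ground\<close>.\<close>

definition z0 :: real where "z0 = \<gamma> / real N"
definition \<sigma> :: real where "\<sigma> = real N * t - \<gamma>"
definition ground :: real where "ground = - 2 / (3 * k) * (real N * (t ^ 3 - z0 ^ 3))"

definition edge_z :: "graph_fun \<Rightarrow> nat \<Rightarrow> real" where "edge_z u e = edge.z (u e) k t"
definition edge_d :: "graph_fun \<Rightarrow> nat \<Rightarrow> real" where "edge_d u e = edge.d (u e) (weak_deriv (u e)) k t"

lemma z0: "0 < z0" "z0 < t" "real N * z0 = \<gamma>"
  using N \<gamma> t by (auto simp: z0_def)

lemma t_pos: "0 < t"
  using z0 by simp

lemma edge_at: "u \<in> H1_graph N \<Longrightarrow> e \<in> {1..N} \<Longrightarrow> edge (u e) (weak_deriv (u e)) k"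
  using H1_graph_edge k by blast

lemma edge_z_eq: "u \<in> H1_graph N \<Longrightarrow> e \<in> {1..N} \<Longrightarrow> edge_z u e = t - k / 2 * int2 (u e)"
  unfolding edge_z_def int2_def by (simp add: edge.z_def[OF edge_at] edge.m_def[OF edge_at])

lemma edge_d_nonneg: "u \<in> H1_graph N \<Longrightarrow> e \<in> {1..N} \<Longrightarrow> 0 \<le> edge_d u e"
  unfolding edge_d_def by (rule edge.d_nonneg[OF edge_at])

lemma int2_nonneg: "u \<in> H1_graph N \<Longrightarrow> e \<in> {1..N} \<Longrightarrow> 0 \<le> int2 (u e)"
  using edge.m_nonneg[OF edge_at] by (simp add: edge.m_def[OF edge_at] int2_def)

context
  fixes u assumes u: "u \<in> H1_graph N" and mass: "(\<Sum>e=1..N. int2 (u e)) = 2 * \<sigma> / k"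
begin

text \<open>This is the mass constraint rewritten; it makes the vertex terms of the edge identities
  add up to exactly the delta term of the energy.\<close>

lemma sum_edge_z: "(\<Sum>e=1..N. edge_z u e) = \<gamma>"
proof -
  have "(\<Sum>e=1..N. edge_z u e) = (\<Sum>e=1..N. t - k / 2 * int2 (u e))"
    by (rule sum.cong) (use edge_z_eq[OF u] in auto)
  also have "\<dots> = real N * t - k / 2 * (\<Sum>e=1..N. int2 (u e))"
    by (simp add: sum_subtractf sum_distrib_left)
  also have "\<dots> = \<gamma>"
    unfolding mass using k by (simp add: \<sigma>_def field_simps)
  finally show ?thesis .
qed

lemma int2_le: "e \<in> {1..N} \<Longrightarrow> int2 (u e) \<le> 2 * \<sigma> / k"
  unfolding mass[symmetric] by (rule member_le_sum) (auto intro: int2_nonneg[OF u])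

text \<open>This is the only place where the smallness of the mass enters.\<close>

lemma edge_z_ge: "e \<in> {1..N} \<Longrightarrow> t \<le> edge_z u e + 2 * z0"
proof -
  assume e: "e \<in> {1..N}"
  have "k / 2 * int2 (u e) \<le> \<sigma>"
    using mult_left_mono[OF int2_le[OF e], of "k / 2"] k by simp
  then show ?thesis
    using small by (simp add: edge_z_eq[OF u e] \<sigma>_def z0_def)
qed

text \<open>Sum the edge identities; the vertex terms cancel by \<open>sum_edge_z\<close>. The cubes
  are expanded around \<open>z0\<close>, and the linear parts of the expansion sum to zero, again by
  \<open>sum_edge_z\<close>.\<close>

lemma scalar_energy_eq:
  "scalar_energy N \<gamma> k u = ground + (\<Sum>e=1..N. edge_d u e)
     + 2 / (3 * k) * (\<Sum>e=1..N. (edge_z u e - z0)\<^sup>2 * (edge_z u e + 2 * z0))"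
proof -
  have id: "int2 (weak_deriv (u e)) - k / 2 * int4 (u e)
      = edge_d u e + edge_z u e * (cmod (u 1 0))\<^sup>2 - 2 / (3 * k) * (t ^ 3 - edge_z u e ^ 3)" if e: "e \<in> {1..N}" for e
  proof -
    have "1 \<in> {1..N}" using N by simp
    then have 0: "u e 0 = u 1 0" using u e unfolding H1_graph_def by blast
    show ?thesis
      using edge.energy_identity[OF edge_at[OF u e], of t] unfolding int2_def int4_def edge_d_def edge_z_def 0 .
  qed
  define A where "A = (\<Sum>e=1..N. edge_d u e)"
  define B where "B = (\<Sum>e=1..N. (edge_z u e - z0)\<^sup>2 * (edge_z u e + 2 * z0))"
  define C where "C = (\<Sum>e=1..N. edge_z u e ^ 3)"
  define h where "h = (cmod (u 1 0))\<^sup>2"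
  define c where "c = 2 / (3 * k)"
  have "scalar_energy N \<gamma> k u
      = (\<Sum>e=1..N. int2 (weak_deriv (u e)) - k / 2 * int4 (u e)) - \<gamma> * h"
    by (simp add: scalar_energy_def sum_subtractf sum_distrib_left h_def)
  also have "(\<Sum>e=1..N. int2 (weak_deriv (u e)) - k / 2 * int4 (u e))
      = (\<Sum>e=1..N. edge_d u e + edge_z u e * h - c * (t ^ 3 - edge_z u e ^ 3))"
    by (rule sum.cong[OF refl]) (simp only: id h_def c_def)
  also have "\<dots> = A + (\<Sum>e=1..N. edge_z u e) * h - c * (real N * t ^ 3 - C)"
  proof -
    have "(\<Sum>e=1..N. c * (t ^ 3 - edge_z u e ^ 3)) = c * (real N * t ^ 3 - C)"
      unfolding C_def sum_distrib_left[symmetric] sum_subtractf by simp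
    then show ?thesis
      unfolding A_def sum_distrib_right sum.distrib sum_subtractf by simp
  qed
  finally have eq: "scalar_energy N \<gamma> k u = A - c * (real N * t ^ 3 - C)"
    unfolding sum_edge_z by simp
  define w where "w = z0"
  have w: "\<gamma> = real N * w" using z0(3) by (simp only: w_def)
  \<comment> \<open>The cube minus its tangent line at \<open>w\<close> has the double root
    \<open>w\<close> and the simple root \<open>-2 * w\<close>.\<close>
  have "C = (\<Sum>e=1..N. (edge_z u e - w)\<^sup>2 * (edge_z u e + 2 * w) + 3 * w\<^sup>2 * edge_z u e - 2 * w ^ 3)"
    unfolding C_def by (rule sum.cong[OF refl]) (simp add: power2_eq_square power3_eq_cube algebra_simps)
  also have "\<dots> = B + 3 * w\<^sup>2 * (\<Sum>e=1..N. edge_z u e) - real N * (2 * w ^ 3)"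
    unfolding B_def w_def[symmetric] sum_subtractf sum.distrib sum_distrib_left by simp
  also have "(\<Sum>e=1..N. edge_z u e) = real N * w"
    using sum_edge_z w by (rule trans)
  finally have C: "C = B + real N * w ^ 3"
    by (simp add: power2_eq_square power3_eq_cube)
  have g: "ground = - (c * (real N * (t ^ 3 - w ^ 3)))"
    by (simp add: ground_def c_def w_def)
  have "scalar_energy N \<gamma> k u = ground + A + c * B"
    unfolding eq C g by (simp add: right_diff_distrib distrib_left)
  then show ?thesis by (simp only: A_def B_def c_def)
qed

lemma edge_z_term_ge: "e \<in> {1..N} \<Longrightarrow> t * (edge_z u e - z0)\<^sup>2 \<le> (edge_z u e - z0)\<^sup>2 * (edge_z u e + 2 * z0)"
  using mult_left_mono[OF edge_z_ge, of e "(edge_z u e - z0)\<^sup>2"] by (simp add: mult.commute)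

lemma edge_z_term_nonneg: "e \<in> {1..N} \<Longrightarrow> 0 \<le> (edge_z u e - z0)\<^sup>2 * (edge_z u e + 2 * z0)"
  using edge_z_ge[of e] t_pos by (intro mult_nonneg_nonneg) auto

lemma edge_z_sum_nonneg: "0 \<le> (\<Sum>e=1..N. (edge_z u e - z0)\<^sup>2 * (edge_z u e + 2 * z0))"
  by (intro sum_nonneg edge_z_term_nonneg)

lemma edge_d_sum_nonneg: "0 \<le> (\<Sum>e=1..N. edge_d u e)"
  by (intro sum_nonneg edge_d_nonneg[OF u])

lemma ground_le: "ground \<le> scalar_energy N \<gamma> k u"
proof -
  have "0 \<le> 2 / (3 * k) * (\<Sum>e=1..N. (edge_z u e - z0)\<^sup>2 * (edge_z u e + 2 * z0))"
    using edge_z_sum_nonneg k by (intro mult_nonneg_nonneg) auto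
  then show ?thesis using scalar_energy_eq edge_d_sum_nonneg by linarith
qed

lemma edge_d_le:
  assumes "e \<in> {1..N}"
  shows "edge_d u e \<le> scalar_energy N \<gamma> k u - ground"
proof -
  have "edge_d u e \<le> (\<Sum>e=1..N. edge_d u e)"
    using assms by (intro member_le_sum) (auto intro: edge_d_nonneg[OF u])
  moreover have "0 \<le> 2 / (3 * k) * (\<Sum>e=1..N. (edge_z u e - z0)\<^sup>2 * (edge_z u e + 2 * z0))"
    using edge_z_sum_nonneg k by (intro mult_nonneg_nonneg) auto
  ultimately show ?thesis using scalar_energy_eq by linarith
qed

text \<open>All terms of the excess energy are nonnegative, so each is at most the gap; the factor
  \<open>edge_z u e + 2 * z0\<close> is at least \<open>t\<close>.\<close>

lemma edge_z_le:
  assumes "e \<in> {1..N}"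
  shows "(edge_z u e - z0)\<^sup>2 \<le> 3 * k / (2 * t) * (scalar_energy N \<gamma> k u - ground)"
proof -
  have "t * (edge_z u e - z0)\<^sup>2 \<le> (edge_z u e - z0)\<^sup>2 * (edge_z u e + 2 * z0)"
    by (rule edge_z_term_ge[OF assms])
  also have "\<dots> \<le> (\<Sum>e=1..N. (edge_z u e - z0)\<^sup>2 * (edge_z u e + 2 * z0))"
    using assms by (intro member_le_sum edge_z_term_nonneg) auto
  finally have "2 / (3 * k) * (t * (edge_z u e - z0)\<^sup>2)
      \<le> 2 / (3 * k) * (\<Sum>e=1..N. (edge_z u e - z0)\<^sup>2 * (edge_z u e + 2 * z0))"
    using k by (intro mult_left_mono) auto
  also have "\<dots> \<le> scalar_energy N \<gamma> k u - ground"
    using scalar_energy_eq edge_d_sum_nonneg by linarith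
  finally have "3 * k / (2 * t) * (2 / (3 * k) * (t * (edge_z u e - z0)\<^sup>2))
      \<le> 3 * k / (2 * t) * (scalar_energy N \<gamma> k u - ground)"
    using k t_pos by (intro mult_left_mono) auto
  then show ?thesis using k t_pos by simp
qed

end

end

section \<open>Scalar ground states and the distance to them\<close>

lemma tendsto_zero_if_square_le:
  fixes f g :: "nat \<Rightarrow> real"
  assumes "\<And>n. (f n)\<^sup>2 \<le> g n" "g \<longlonglongrightarrow> 0"
  shows "f \<longlonglongrightarrow> 0"
proof -
  have "(\<lambda>n. (f n)\<^sup>2) \<longlonglongrightarrow> 0"
    by (rule tendsto_sandwich[OF _ _ tendsto_const assms(2)]) (use assms(1) in auto)
  then have "(\<lambda>n. sqrt ((f n)\<^sup>2)) \<longlonglongrightarrow> sqrt 0"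
    by (rule tendsto_real_sqrt)
  then show ?thesis by (simp add: tendsto_rabs_zero_iff)
qed

lemma H1_graph_diff:
  assumes "u \<in> H1_graph N" "v \<in> H1_graph N"
  shows "u - v \<in> H1_graph N"
proof -
  have "(u - v) e \<in> H1_halfline" if "e \<in> {1..N}" for e
  proof -
    have uv: "u e \<in> H1_halfline" "v e \<in> H1_halfline"
      using assms that by (auto simp: H1_graph_def)
    note U = H1_halflineD[OF uv(1)] and V = H1_halflineD[OF uv(2)]
    have eq: "(u - v) e = (\<lambda>x. u e x - v e x)" by (simp add: fun_diff_def)
    show ?thesis
      unfolding eq by (rule H1_halflineI[OF L2_diff[OF U(1) V(1)] L2_diff[OF U(2) V(2)] has_ac_deriv_diff[OF U(3) V(3)]])
  qed
  moreover have "(u - v) e 0 = (u - v) e' 0" if "e \<in> {1..N}" "e' \<in> {1..N}" for e e'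
  proof -
    have "u e 0 = u e' 0" "v e 0 = v e' 0"
      using assms that unfolding H1_graph_def by blast+
    then show ?thesis by simp
  qed
  ultimately show ?thesis unfolding H1_graph_def by blast
qed

context star
begin

text \<open>The shift for which the soliton has \<open>T 0 = z0\<close>.\<close>

definition x0 :: real where "x0 = (SOME x. 0 \<le> x \<and> tanh x = z0 / t)"

lemma x0: "0 \<le> x0" "t * tanh x0 = z0"
proof -
  have "\<exists>x. 0 \<le> x \<and> tanh x = z0 / t"
    using tanh_surj[of "z0 / t"] z0 t_pos by auto
  then have "0 \<le> x0 \<and> tanh x0 = z0 / t"
    unfolding x0_def by (rule someI_ex)
  then show "0 \<le> x0" "t * tanh x0 = z0" using t_pos by auto
qed

definition ground_state :: "complex \<Rightarrow> graph_fun" where "ground_state \<zeta> = (\<lambda>e. soliton k t x0 \<zeta>)"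
text \<open>The modulus of the ground states at the vertex.\<close>

definition peak :: real where "peak = sqrt (2 / k) * t / cosh x0"

lemma peak_pos: "0 < peak"
  using k t_pos by (simp add: peak_def)

lemma soliton_0: "soliton k t x0 \<zeta> 0 = \<zeta> * of_real peak"
  by (simp add: soliton_def peak_def)

text \<open>The first integral at the vertex:
  \<open>k / 2 * peak\<^sup>2 + z0\<^sup>2 = t\<^sup>2\<close>.\<close>

lemma peak_square: "peak\<^sup>2 = 2 / k * (t\<^sup>2 - z0\<^sup>2)"
proof -
  have "peak\<^sup>2 = (cmod (soliton k t x0 1 0))\<^sup>2"
    unfolding soliton_0 using peak_pos by simp
  also have "\<dots> = 2 / k * (t\<^sup>2 * (1 - (tanh x0)\<^sup>2))"
    using soliton_square[OF k t_pos x0(1), of 1 0] by simp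
  also have "t\<^sup>2 * (1 - (tanh x0)\<^sup>2) = t\<^sup>2 - z0\<^sup>2"
    unfolding x0(2)[symmetric] by (simp add: power_mult_distrib algebra_simps)
  finally show ?thesis .
qed

text \<open>The sum of the two estimates in \<open>soliton_distance\<close>, with \<open>h\<close>
  the squared vertex discrepancy. The local \<open>\<rho>\<close> majorizes the one of
  \<open>edge_soliton\<close>: the mass on the edge is replaced by the total mass
  \<open>2 * \<sigma> / k\<close>, so that only \<open>h\<close>, \<open>d\<close> and
  \<open>z\<close> vary with the function.\<close>

definition bound :: "real \<Rightarrow> real \<Rightarrow> real \<Rightarrow> real" where
  "bound h d z = (let \<rho> = 2 * d + 2 * ((z - z0)\<^sup>2 + 4 * k\<^sup>2 * (2 * \<sigma> / k) * d / z0\<^sup>2) * (2 / k * (t - z0))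
     in (1 + 2 * t\<^sup>2) * ((h + \<rho> / z) / z) + 2 * \<rho>)"

context
  fixes \<zeta> :: complex assumes \<zeta>: "cmod \<zeta> = 1"
begin

lemmas sol = k t_pos x0(1) \<zeta>

lemma ground_state_H1: "ground_state \<zeta> \<in> H1_graph N"
  using H1_halflineI[OF soliton_L2[OF sol] soliton_deriv_L2[OF sol] soliton_ac[OF sol]]
  by (simp add: H1_graph_def ground_state_def)

lemma ground_state_int2: "int2 (ground_state \<zeta> e) = 2 / k * (t - z0)"
  using soliton_mass[OF sol] unfolding edge.m_def[OF soliton_edge[OF sol]] by (simp add: ground_state_def int2_def x0(2))

lemma ground_state_mass: "(\<Sum>e=1..N. int2 (ground_state \<zeta> e)) = 2 * \<sigma> / k"
proof -
  have "(\<Sum>e=1..N. int2 (ground_state \<zeta> e)) = 2 / k * (real N * t - real N * z0)"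
    unfolding ground_state_int2 by (simp add: right_diff_distrib mult.left_commute)
  also have "\<dots> = 2 * \<sigma> / k"
    unfolding z0(3) \<sigma>_def by simp
  finally show ?thesis .
qed

text \<open>The edge identity holds with \<open>d = 0\<close> and \<open>z = z0\<close> on all
  edges, and \<open>N\<close> times \<open>z0\<close> cancels the vertex term.\<close>

lemma ground_state_energy: "scalar_energy N \<gamma> k (ground_state \<zeta>) = ground"
proof -
  define I where "I = int2 (weak_deriv (soliton k t x0 \<zeta>))"
  define Q where "Q = int4 (soliton k t x0 \<zeta>)"
  have z: "edge.z (soliton k t x0 \<zeta>) k t = z0"
    using soliton_z[OF sol] x0(2) by simp
  have "I - k / 2 * Q = z0 * peak\<^sup>2 - 2 / (3 * k) * (t ^ 3 - z0 ^ 3)"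
    using edge.energy_identity[OF soliton_edge[OF sol], of t]
    unfolding soliton_d[OF sol] z soliton_0 I_def Q_def int2_def int4_def
      integral_weak_deriv[OF soliton_L2[OF sol] soliton_deriv_L2[OF sol] soliton_ac[OF sol]]
    using \<zeta> peak_pos by (simp add: norm_mult)
  then have "real N * (I - k / 2 * Q) = real N * (z0 * peak\<^sup>2 - 2 / (3 * k) * (t ^ 3 - z0 ^ 3))"
    by (simp only:)
  also have "\<dots> = (real N * z0) * peak\<^sup>2 + ground"
    by (simp add: ground_def algebra_simps)
  finally have "real N * (I - k / 2 * Q) = \<gamma> * peak\<^sup>2 + ground"
    unfolding z0(3) .
  moreover have "cmod (\<zeta> * of_real peak) = peak"
    using \<zeta> peak_pos by (simp add: norm_mult)
  ultimately show ?thesis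
    unfolding scalar_energy_def ground_state_def soliton_0 I_def[symmetric] Q_def[symmetric]
    by (simp add: algebra_simps)
qed

lemma ground_state_distance:
  assumes u: "u \<in> H1_graph N" and mass: "(\<Sum>e=1..N. int2 (u e)) = 2 * \<sigma> / k"
    and pos: "\<And>e. e \<in> {1..N} \<Longrightarrow> 0 < edge_z u e"
  shows "(H1_norm N (u - ground_state \<zeta>))\<^sup>2
     \<le> (\<Sum>e=1..N. bound ((cmod (u 1 0 - \<zeta> * of_real peak))\<^sup>2) (edge_d u e) (edge_z u e))"
  unfolding H1_norm_square[OF H1_graph_diff[OF u ground_state_H1]]
proof (rule sum_mono)
  fix e assume e: "e \<in> {1..N}"
  interpret edge_soliton "u e" "weak_deriv (u e)" k t "soliton k t x0 \<zeta>" "soliton_deriv k t x0 \<zeta>"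
  proof (intro edge_soliton.intro edge_soliton_axioms.intro)
    show "edge (u e) (weak_deriv (u e)) k" by (rule edge_at[OF u e])
    show "edge (soliton k t x0 \<zeta>) (soliton_deriv k t x0 \<zeta>) k" by (rule soliton_edge[OF sol])
    show "edge.D (soliton k t x0 \<zeta>) (soliton_deriv k t x0 \<zeta>) k t x = 0" if "0 \<le> x" for x
      by (rule soliton_D[OF sol that])
    show "0 < edge.z (soliton k t x0 \<zeta>) k t"
      using soliton_z[OF sol] x0(2) z0(1) by simp
    show "0 < edge.z (u e) k t" using pos[OF e] by (simp add: edge_z_def)
  qed
  have solz: "sol.z = z0" using soliton_z[OF sol] x0(2) by simp
  have solm: "sol.m = 2 / k * (t - z0)" using soliton_mass[OF sol] x0(2) by simp
  have zd: "z = edge_z u e" "d = edge_d u e" by (simp_all add: edge_z_def edge_d_def)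
  have u0: "u e 0 = u 1 0"
  proof -
    have "1 \<in> {1..N}" using N by simp
    then show ?thesis using u e unfolding H1_graph_def by blast
  qed
  define h where "h = (cmod (u 1 0 - \<zeta> * of_real peak))\<^sup>2"
  define r where "r = 2 * edge_d u e + 2 * ((edge_z u e - z0)\<^sup>2 + 4 * k\<^sup>2 * (2 * \<sigma> / k) * edge_d u e / z0\<^sup>2) * (2 / k * (t - z0))"
  \<comment> \<open>Replaces the mass \<open>m\<close> of the edge by the prescribed total
    mass.\<close>
  have "(\<eta> / z0)\<^sup>2 = 4 * k\<^sup>2 * (m * d) / z0\<^sup>2"
    by (simp add: power_divide \<eta>_square)
  also have "\<dots> \<le> 4 * k\<^sup>2 * ((2 * \<sigma> / k) * d) / z0\<^sup>2"
    using int2_le[OF u mass e] d_nonneg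
    by (intro divide_right_mono mult_left_mono mult_right_mono) (auto simp: m_def int2_def)
  finally have "\<Delta> \<le> (edge_z u e - z0)\<^sup>2 + 4 * k\<^sup>2 * (2 * \<sigma> / k) * edge_d u e / z0\<^sup>2"
    unfolding \<Delta>_def solz zd by (simp add: mult.assoc)
  then have "2 * \<Delta> * sol.m \<le> 2 * ((edge_z u e - z0)\<^sup>2 + 4 * k\<^sup>2 * (2 * \<sigma> / k) * edge_d u e / z0\<^sup>2) * (2 / k * (t - z0))"
    unfolding solm using k z0 by (intro mult_right_mono mult_left_mono) auto
  then have \<rho>r: "\<rho> \<le> r"
    by (simp only: \<rho>_def r_def zd add_left_mono)
  have v0: "(cmod (u e 0 - soliton k t x0 \<zeta> 0))\<^sup>2 = h"
    by (simp only: u0 soliton_0 h_def)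
  have H: "(h + \<rho> / z) / z \<le> (h + r / edge_z u e) / edge_z u e"
    unfolding zd(1) using pos[OF e] \<rho>r by (intro divide_right_mono add_left_mono) auto
  have eq: "(u - ground_state \<zeta>) e = (\<lambda>x. u e x - soliton k t x0 \<zeta> x)"
    by (simp add: fun_diff_def ground_state_def)
  have 1: "int2 ((u - ground_state \<zeta>) e) \<le> (h + r / edge_z u e) / edge_z u e"
    unfolding eq int2_def using soliton_distance(1) H unfolding v0 by linarith
  have "int2 (weak_deriv ((u - ground_state \<zeta>) e))
      = integral {0..} (\<lambda>x. (cmod (weak_deriv (u e) x - soliton_deriv k t x0 \<zeta> x))\<^sup>2)"
    unfolding eq int2_def
    by (intro integral_weak_deriv L2_diff has_ac_deriv_diff f g ac sol.f sol.g sol.ac)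
  also have "\<dots> \<le> 2 * t\<^sup>2 * ((h + \<rho> / z) / z) + 2 * \<rho>"
    using soliton_distance(2) unfolding v0 .
  also have "\<dots> \<le> 2 * t\<^sup>2 * ((h + r / edge_z u e) / edge_z u e) + 2 * r"
    using H \<rho>r by (intro add_mono mult_left_mono) auto
  finally show "int2 ((u - ground_state \<zeta>) e) + int2 (weak_deriv ((u - ground_state \<zeta>) e))
      \<le> bound ((cmod (u 1 0 - \<zeta> * of_real peak))\<^sup>2) (edge_d u e) (edge_z u e)"
    using 1 unfolding bound_def Let_def h_def[symmetric] r_def[symmetric] distrib_right by linarith
qed

end

lemma bound_tendsto:
  assumes "h \<longlonglongrightarrow> 0" "d \<longlonglongrightarrow> 0" "z \<longlonglongrightarrow> z0"
  shows "(\<lambda>n. bound (h n) (d n) (z n)) \<longlonglongrightarrow> 0"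
proof -
  define C where "C = 4 * k\<^sup>2 * (2 * \<sigma> / k)"
  define m where "m = 2 / k * (t - z0)"
  have "(\<lambda>n. 2 * d n + 2 * ((z n - z0)\<^sup>2 + C * d n / z0\<^sup>2) * m)
      \<longlonglongrightarrow> 2 * 0 + 2 * ((z0 - z0)\<^sup>2 + C * 0 / z0\<^sup>2) * m"
    using z0(1) by (intro tendsto_intros assms) auto
  then have r: "(\<lambda>n. 2 * d n + 2 * ((z n - z0)\<^sup>2 + C * d n / z0\<^sup>2) * m) \<longlonglongrightarrow> 0"
    by simp
  have "(\<lambda>n. (1 + 2 * t\<^sup>2) * ((h n + (2 * d n + 2 * ((z n - z0)\<^sup>2 + C * d n / z0\<^sup>2) * m) / z n) / z n)
      + 2 * (2 * d n + 2 * ((z n - z0)\<^sup>2 + C * d n / z0\<^sup>2) * m))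
      \<longlonglongrightarrow> (1 + 2 * t\<^sup>2) * ((0 + 0 / z0) / z0) + 2 * 0"
    using z0(1) by (intro tendsto_intros assms r) auto
  moreover have "(1 + 2 * t\<^sup>2) * ((0 + 0 / z0) / z0) + 2 * 0 = 0" by simp
  ultimately show ?thesis by (simp only: bound_def Let_def C_def m_def)
qed

section \<open>Scalar minimizing sequences\<close>

context
  fixes u :: "nat \<Rightarrow> graph_fun"
  assumes u: "\<And>n. u n \<in> H1_graph N" and mass: "\<And>n. (\<Sum>e=1..N. int2 (u n e)) = 2 * \<sigma> / k"
    and min: "(\<lambda>n. scalar_energy N \<gamma> k (u n)) \<longlonglongrightarrow> ground"
begin

lemma gap_tendsto: "(\<lambda>n. scalar_energy N \<gamma> k (u n) - ground) \<longlonglongrightarrow> 0"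
  using tendsto_diff[OF min tendsto_const[of ground]] by simp

lemma edge_d_tendsto: "e \<in> {1..N} \<Longrightarrow> (\<lambda>n. edge_d (u n) e) \<longlonglongrightarrow> 0"
  by (rule tendsto_sandwich[OF _ _ tendsto_const gap_tendsto])
    (auto intro!: always_eventually edge_d_nonneg[OF u] edge_d_le[OF u mass])

lemma edge_z_tendsto: "e \<in> {1..N} \<Longrightarrow> (\<lambda>n. edge_z (u n) e) \<longlonglongrightarrow> z0"
proof -
  assume e: "e \<in> {1..N}"
  have "(\<lambda>n. edge_z (u n) e - z0) \<longlonglongrightarrow> 0"
  proof (rule tendsto_zero_if_square_le)
    show "(edge_z (u n) e - z0)\<^sup>2 \<le> 3 * k / (2 * t) * (scalar_energy N \<gamma> k (u n) - ground)" for n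
      by (rule edge_z_le[OF u mass e])
    show "(\<lambda>n. 3 * k / (2 * t) * (scalar_energy N \<gamma> k (u n) - ground)) \<longlonglongrightarrow> 0"
      using tendsto_mult_right_zero[OF gap_tendsto] .
  qed
  then show ?thesis by (simp only: LIM_zero_iff)
qed

text \<open>\<open>S_bound\<close> at \<open>x = 0\<close> puts \<open>k / 2\<close> times the
  squared vertex modulus plus \<open>z\<^sup>2\<close> within \<open>\<eta>\<close> of
  \<open>t\<^sup>2\<close>. Here \<open>\<eta>\<close> tends to zero with \<open>edge_d\<close>, and
  \<open>z\<close> tends to \<open>z0\<close>.\<close>

lemma vertex_tendsto: "(\<lambda>n. cmod (u n 1 0)) \<longlonglongrightarrow> peak"
proof -
  have e: "1 \<in> {1..N}" using N by simp
  have "(\<lambda>n. k / 2 * (cmod (u n 1 0))\<^sup>2 + edge_z (u n) 1 * edge_z (u n) 1 - t\<^sup>2) \<longlonglongrightarrow> 0"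
  proof (rule tendsto_zero_if_square_le)
    show "(k / 2 * (cmod (u n 1 0))\<^sup>2 + edge_z (u n) 1 * edge_z (u n) 1 - t\<^sup>2)\<^sup>2
        \<le> 4 * k\<^sup>2 * (2 * \<sigma> / k) * edge_d (u n) 1" for n
    proof -
      interpret edge "u n 1" "weak_deriv (u n 1)" k t by (rule edge_at[OF u e])
      have zd: "z = edge_z (u n) 1" "d = edge_d (u n) 1" by (simp_all add: edge_z_def edge_d_def)
      have "\<bar>k / 2 * (cmod (u n 1 0))\<^sup>2 + edge_z (u n) 1 * edge_z (u n) 1 - t\<^sup>2\<bar> \<le> \<eta>"
        using S_bound[of 0] by (simp only: S_def T_0 zd)
      then have "(k / 2 * (cmod (u n 1 0))\<^sup>2 + edge_z (u n) 1 * edge_z (u n) 1 - t\<^sup>2)\<^sup>2 \<le> \<eta>\<^sup>2"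
        using \<eta>_nonneg by (simp add: abs_le_square_iff[symmetric])
      also have "\<eta>\<^sup>2 = 4 * k\<^sup>2 * (m * d)"
        by (rule \<eta>_square)
      also have "\<dots> \<le> 4 * k\<^sup>2 * (2 * \<sigma> / k * d)"
      proof -
        have "m \<le> 2 * \<sigma> / k"
          using int2_le[OF u[of n] mass[of n] e] unfolding m_def int2_def .
        then show ?thesis by (intro mult_left_mono mult_right_mono d_nonneg) auto
      qed
      finally show ?thesis by (simp only: zd mult.assoc)
    qed
    show "(\<lambda>n. 4 * k\<^sup>2 * (2 * \<sigma> / k) * edge_d (u n) 1) \<longlonglongrightarrow> 0"
      using tendsto_mult_right_zero[OF edge_d_tendsto[OF e]] .
  qed
  from tendsto_mult[OF tendsto_const[of "2 / k"]
      tendsto_diff[OF tendsto_add[OF this tendsto_const[of "t\<^sup>2"]] tendsto_mult[OF edge_z_tendsto[OF e] edge_z_tendsto[OF e]]]]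
  have "(\<lambda>n. 2 / k * (k / 2 * (cmod (u n 1 0))\<^sup>2 + edge_z (u n) 1 * edge_z (u n) 1 - t\<^sup>2 + t\<^sup>2 - edge_z (u n) 1 * edge_z (u n) 1))
      \<longlonglongrightarrow> 2 / k * (0 + t\<^sup>2 - z0 * z0)" .
  moreover have "2 / k * (k / 2 * (cmod (u n 1 0))\<^sup>2 + edge_z (u n) 1 * edge_z (u n) 1 - t\<^sup>2 + t\<^sup>2 - edge_z (u n) 1 * edge_z (u n) 1)
      = (cmod (u n 1 0))\<^sup>2" for n
    using k by simp
  moreover have "2 / k * (0 + t\<^sup>2 - z0 * z0) = peak\<^sup>2"
    unfolding peak_square by (simp add: power2_eq_square)
  ultimately have "(\<lambda>n. (cmod (u n 1 0))\<^sup>2) \<longlonglongrightarrow> peak\<^sup>2"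
    by (simp only:)
  from tendsto_real_sqrt[OF this] show ?thesis
    using peak_pos by simp
qed

lemma phases_exist:
  obtains \<zeta> where "\<And>n. cmod (\<zeta> n) = 1" "(\<lambda>n. u n 1 0 - \<zeta> n * of_real peak) \<longlonglongrightarrow> 0"
proof
  \<comment> \<open>The phase of the vertex value; the default \<open>1\<close> keeps it on the unit
    circle if that value is zero.\<close>
  define \<zeta> where "\<zeta> = (\<lambda>n. if u n 1 0 = 0 then 1 else sgn (u n 1 0))"
  show "cmod (\<zeta> n) = 1" for n by (simp add: \<zeta>_def norm_sgn)
  have eq: "u n 1 0 = \<zeta> n * of_real (cmod (u n 1 0))" for n
    by (simp add: \<zeta>_def sgn_eq)
  have "cmod (u n 1 0 - \<zeta> n * of_real peak) = \<bar>cmod (u n 1 0) - peak\<bar>" for n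
  proof -
    have "u n 1 0 - \<zeta> n * of_real peak = \<zeta> n * of_real (cmod (u n 1 0) - peak)"
      by (subst (1) eq) (simp add: right_diff_distrib)
    then show ?thesis
      using \<open>cmod (\<zeta> n) = 1\<close> by (simp only: norm_mult norm_of_real mult_1)
  qed
  moreover have "(\<lambda>n. \<bar>cmod (u n 1 0) - peak\<bar>) \<longlonglongrightarrow> 0"
    by (rule tendsto_rabs_zero[OF LIM_zero[OF vertex_tendsto]])
  ultimately show "(\<lambda>n. u n 1 0 - \<zeta> n * of_real peak) \<longlonglongrightarrow> 0"
    by - (rule tendsto_norm_zero_cancel, simp only:)
qed

text \<open>The phases may vary with \<open>n\<close>: constant ones give convergence to a fixed
  state, moving ones give convergence to the set of ground states.\<close>

lemma H1_tendsto:
  assumes \<zeta>: "\<And>n. cmod (\<zeta> n) = 1" "(\<lambda>n. u n 1 0 - \<zeta> n * of_real peak) \<longlonglongrightarrow> 0"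
  shows "(\<lambda>n. H1_norm N (u n - ground_state (\<zeta> n))) \<longlonglongrightarrow> 0"
proof -
  define h where "h = (\<lambda>n. (cmod (u n 1 0 - \<zeta> n * of_real peak))\<^sup>2)"
  have "(\<lambda>n. (cmod (u n 1 0 - \<zeta> n * of_real peak))\<^sup>2) \<longlonglongrightarrow> 0\<^sup>2"
    by (intro tendsto_power tendsto_norm_zero \<zeta>(2))
  then have h: "h \<longlonglongrightarrow> 0" by (simp add: h_def)
  have "(\<lambda>n. \<Sum>e=1..N. bound (h n) (edge_d (u n) e) (edge_z (u n) e)) \<longlonglongrightarrow> (\<Sum>e=1..N. 0)"
    by (intro tendsto_sum bound_tendsto h edge_d_tendsto edge_z_tendsto)
  then have lim: "(\<lambda>n. \<Sum>e=1..N. bound (h n) (edge_d (u n) e) (edge_z (u n) e)) \<longlonglongrightarrow> 0" by simp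
  \<comment> \<open>\<open>ground_state_distance\<close> requires positive \<open>edge_z\<close>,
    which holds eventually because the limit \<open>z0\<close> is positive.\<close>
  have "\<forall>\<^sub>F n in sequentially. \<forall>e\<in>{1..N}. 0 < edge_z (u n) e"
    using z0(1) by (intro eventually_ball_finite ballI order_tendstoD(1)[OF edge_z_tendsto]) auto
  then have "\<forall>\<^sub>F n in sequentially. (H1_norm N (u n - ground_state (\<zeta> n)))\<^sup>2
      \<le> (\<Sum>e=1..N. bound (h n) (edge_d (u n) e) (edge_z (u n) e))"
  proof eventually_elim
    case (elim n)
    then show ?case unfolding h_def by (intro ground_state_distance \<zeta> u mass) auto
  qed
  then have "(\<lambda>n. (H1_norm N (u n - ground_state (\<zeta> n)))\<^sup>2) \<longlonglongrightarrow> 0"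
    by (rule tendsto_sandwich[OF _ _ tendsto_const lim, rotated]) auto
  from tendsto_zero_if_square_le[OF order_refl this] show ?thesis .
qed

end
end

section \<open>The coupled problem\<close>

lemma abs_int_mult_square:
  assumes "edge f f' k" "edge g g' k'"
  shows "(\<lambda>x. (cmod (f x * g x))\<^sup>2) absolutely_integrable_on {0..}"
proof (rule abs_int_bound)
  interpret f: edge f f' k by fact
  interpret g: edge g g' k' by fact
  show "(\<lambda>x. (cmod (f x * g x))\<^sup>2) \<in> borel_measurable halfline"
    using f.f g.f by (auto simp: Lp_halfline_2_iff)
  show "(\<lambda>x. cmod (f x) ^ 4 + cmod (g x) ^ 4) absolutely_integrable_on {0..}"
    by (intro set_integral_add f.f4 g.f4)
  show "norm ((cmod (f x * g x))\<^sup>2) \<le> cmod (f x) ^ 4 + cmod (g x) ^ 4" for x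
  proof -
    have "2 * (cmod (f x))\<^sup>2 * (cmod (g x))\<^sup>2 \<le> ((cmod (f x))\<^sup>2)\<^sup>2 + ((cmod (g x))\<^sup>2)\<^sup>2"
      by (rule sum_squares_bound)
    moreover have "0 \<le> (cmod (f x))\<^sup>2 * (cmod (g x))\<^sup>2" by simp
    moreover have "norm ((cmod (f x * g x))\<^sup>2) = (cmod (f x))\<^sup>2 * (cmod (g x))\<^sup>2"
      by (simp add: norm_mult power_mult_distrib)
    moreover have "cmod (f x) ^ 4 = ((cmod (f x))\<^sup>2)\<^sup>2" "cmod (g x) ^ 4 = ((cmod (g x))\<^sup>2)\<^sup>2"
      by simp_all
    ultimately show ?thesis by linarith
  qed
qed

definition int22 :: "(real \<Rightarrow> complex) \<Rightarrow> (real \<Rightarrow> complex) \<Rightarrow> real" where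
  "int22 f g = integral {0..} (\<lambda>x. (cmod (f x * g x))\<^sup>2)"

text \<open>The scalar energies carry the quartic strengths \<open>k\<close> and \<open>l\<close> in
  place of \<open>a\<close> and \<open>c\<close>; the last sum makes up the difference and contains
  the coupling.\<close>

lemma energy_H1:
  assumes u: "u \<in> H1_graph N" and v: "v \<in> H1_graph N"
  shows "energy N \<gamma> a b c (u, v) = scalar_energy N \<gamma> k u + scalar_energy N \<gamma> l v
    + (\<Sum>e=1..N. (k - a) / 2 * int4 (u e) + (l - c) / 2 * int4 (v e) - b * int22 (u e) (v e))"
proof -
  have E: "edge (u e) (weak_deriv (u e)) 1" "edge (v e) (weak_deriv (v e)) 1" if "e \<in> {1..N}" for e
    using H1_graph_edge[OF u that] H1_graph_edge[OF v that] by simp_all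
  have "(Lp_norm N 2 (\<lambda>e x. u e x * v e x))\<^sup>2 = (\<Sum>e=1..N. int22 (u e) (v e))"
    unfolding int22_def
    by (subst Lp_norm_pow) (auto intro!: sum.cong halfline_integral abs_int_mult_square[OF E])
  moreover have "(\<Sum>e=1..N. (k - a) / 2 * int4 (u e) + (l - c) / 2 * int4 (v e) - b * int22 (u e) (v e))
      = (k - a) / 2 * (\<Sum>e=1..N. int4 (u e)) + (l - c) / 2 * (\<Sum>e=1..N. int4 (v e))
        - b * (\<Sum>e=1..N. int22 (u e) (v e))"
    by (simp only: sum_subtractf sum.distrib sum_distrib_left)
  ultimately show ?thesis
    by (simp only: energy_def scalar_energy_def prod.case Lp_norm_H1[OF u] Lp_norm_H1[OF v])
      (simp add: field_simps)
qed

text \<open>Pointwise Young inequality, from the square of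
  \<open>q * (cmod (f x))\<^sup>2 - (cmod (g x))\<^sup>2\<close>. Equality holds where the squared
  moduli have ratio \<open>q\<close>.\<close>

lemma coupling_le:
  assumes E: "edge f f' k" "edge g g' k'" and q: "0 < q"
  shows "2 * int22 f g \<le> q * int4 f + int4 g / q"
proof -
  interpret f: edge f f' k by fact
  interpret g: edge g g' k' by fact
  have i: "(\<lambda>x. (cmod (f x * g x))\<^sup>2) integrable_on {0..}" "(\<lambda>x. cmod (f x) ^ 4) integrable_on {0..}"
      "(\<lambda>x. cmod (g x) ^ 4) integrable_on {0..}"
    using abs_int_mult_square[OF E] f.f4 g.f4 by (auto intro: abs_int_integrable)
  have "2 * int22 f g = integral {0..} (\<lambda>x. 2 * (cmod (f x * g x))\<^sup>2)"
    by (simp add: int22_def)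
  also have "\<dots> \<le> integral {0..} (\<lambda>x. q * cmod (f x) ^ 4 + 1 / q * cmod (g x) ^ 4)"
  proof (intro integral_le integrable_add integrable_on_mult_right i)
    fix x
    have "0 \<le> (q * (cmod (f x))\<^sup>2 - (cmod (g x))\<^sup>2)\<^sup>2 / q" using q by simp
    also have "\<dots> = q * cmod (f x) ^ 4 + 1 / q * cmod (g x) ^ 4 - 2 * (cmod (f x * g x))\<^sup>2"
      using q by (simp add: power2_diff norm_mult power_mult_distrib field_simps power2_eq_square power4_eq_xxxx)
    finally show "2 * (cmod (f x * g x))\<^sup>2 \<le> q * cmod (f x) ^ 4 + 1 / q * cmod (g x) ^ 4" by simp
  qed
  also have "\<dots> = integral {0..} (\<lambda>x. q * cmod (f x) ^ 4) + integral {0..} (\<lambda>x. 1 / q * cmod (g x) ^ 4)"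
    by (intro Henstock_Kurzweil_Integration.integral_add integrable_on_mult_right i)
  also have "\<dots> = q * int4 f + int4 g / q"
    by (simp add: int4_def)
  finally show ?thesis .
qed

lemma X_norm_tendsto:
  assumes "(\<lambda>n. H1_norm N (fst (w n))) \<longlonglongrightarrow> 0" "(\<lambda>n. H1_norm N (snd (w n))) \<longlonglongrightarrow> 0"
  shows "(\<lambda>n. X_norm N (w n)) \<longlonglongrightarrow> 0"
proof -
  have "(\<lambda>n. sqrt ((H1_norm N (fst (w n)))\<^sup>2 + (H1_norm N (snd (w n)))\<^sup>2)) \<longlonglongrightarrow> sqrt (0\<^sup>2 + 0\<^sup>2)"
    by (intro tendsto_intros assms)
  then show ?thesis by (simp add: X_norm_def)
qed

lemma unit_circle_subsequence:
  fixes \<zeta> :: "nat \<Rightarrow> complex"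
  assumes "\<And>n. cmod (\<zeta> n) = 1"
  obtains l r where "cmod l = 1" "strict_mono (r :: nat \<Rightarrow> nat)" "(\<zeta> \<circ> r) \<longlonglongrightarrow> l"
proof -
  have "\<forall>n. \<zeta> n \<in> sphere 0 1" using assms by simp
  with compact_sphere[of 0 1] obtain l r where "l \<in> sphere 0 1" "strict_mono (r :: nat \<Rightarrow> nat)" "(\<zeta> \<circ> r) \<longlonglongrightarrow> l"
    unfolding compact_def by meson
  then show ?thesis using that by simp
qed

text \<open>The conditions \<open>ka\<close> and \<open>lc\<close> say
  \<open>a / k + b / l = 1\<close> and \<open>b / k + c / l = 1\<close>. They make the quartic
  surplus in \<open>energy_H1\<close> exactly what the Young inequality with
  \<open>q = k / l\<close> needs to absorb the coupling.\<close>

locale coupled = su: star N \<gamma> t k + sv: star N \<gamma> t l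
  for N :: nat and \<gamma> t k l :: real +
  fixes a b c :: real
  assumes b: "0 < b" and ka: "k - a = b * (k / l)" and lc: "l - c = b * (l / k)"
begin

definition \<alpha> :: real where "\<alpha> = 2 * su.\<sigma> / k"
definition \<beta> :: real where "\<beta> = 2 * su.\<sigma> / l"
definition minimum :: real where "minimum = su.ground + sv.ground"

lemma edges:
  "u \<in> H1_graph N \<Longrightarrow> v \<in> H1_graph N \<Longrightarrow> e \<in> {1..N} \<Longrightarrow>
    edge (u e) (weak_deriv (u e)) k \<and> edge (v e) (weak_deriv (v e)) l"
  using su.edge_at sv.edge_at by blast

lemma decoupled_le:
  assumes u: "u \<in> H1_graph N" and v: "v \<in> H1_graph N"
  shows "scalar_energy N \<gamma> k u + scalar_energy N \<gamma> l v \<le> energy N \<gamma> a b c (u, v)"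
proof -
  have "0 \<le> (k - a) / 2 * int4 (u e) + (l - c) / 2 * int4 (v e) - b * int22 (u e) (v e)"
    if e: "e \<in> {1..N}" for e
  proof -
    have "0 < k / l" using su.k sv.k by simp
    from coupling_le[OF conjunct1[OF edges[OF u v e]] conjunct2[OF edges[OF u v e]] this]
    have "b * (2 * int22 (u e) (v e)) \<le> b * (k / l * int4 (u e) + int4 (v e) / (k / l))"
      using b by (intro mult_left_mono) auto
    also have "\<dots> = 2 * (b * (k / l) / 2 * int4 (u e) + b * (l / k) / 2 * int4 (v e))"
      using su.k sv.k by (simp add: field_simps)
    finally have "2 * (b * int22 (u e) (v e)) \<le> 2 * (b * (k / l) / 2 * int4 (u e) + b * (l / k) / 2 * int4 (v e))"
      by (simp only: mult.left_commute[of b 2])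
    then show ?thesis
      unfolding ka lc mult_le_cancel_left_pos[OF zero_less_numeral] by (simp only: diff_ge_0_iff_ge)
  qed
  then have "0 \<le> (\<Sum>e=1..N. (k - a) / 2 * int4 (u e) + (l - c) / 2 * int4 (v e) - b * int22 (u e) (v e))"
    by (rule sum_nonneg)
  then show ?thesis
    unfolding energy_H1[OF u v, of \<gamma> a b c k l] by linarith
qed

lemma admissible_iff:
  "(u, v) \<in> admissible N \<alpha> \<beta> \<longleftrightarrow> u \<in> H1_graph N \<and> v \<in> H1_graph N \<and>
     (\<Sum>e=1..N. int2 (u e)) = 2 * su.\<sigma> / k \<and> (\<Sum>e=1..N. int2 (v e)) = 2 * sv.\<sigma> / l"
  by (auto simp: admissible_def X_space_def Lp_norm_H1 \<alpha>_def \<beta>_def)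

lemma minimum_le:
  assumes "w \<in> admissible N \<alpha> \<beta>"
  shows "minimum \<le> energy N \<gamma> a b c w"
proof -
  obtain u v where w: "w = (u, v)" by (cases w)
  with assms have uv: "u \<in> H1_graph N" "v \<in> H1_graph N" "(\<Sum>e=1..N. int2 (u e)) = 2 * su.\<sigma> / k"
      "(\<Sum>e=1..N. int2 (v e)) = 2 * sv.\<sigma> / l"
    by (auto simp: admissible_iff)
  then show ?thesis
    using su.ground_le[OF uv(1,3)] sv.ground_le[OF uv(2,4)] decoupled_le[OF uv(1,2)]
    unfolding minimum_def w by linarith
qed

definition state :: "complex \<Rightarrow> complex \<Rightarrow> graph_fun \<times> graph_fun" where
  "state \<zeta> \<xi> = (su.ground_state \<zeta>, sv.ground_state \<xi>)"

context
  fixes \<zeta> \<xi> :: complex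
  assumes \<zeta>: "cmod \<zeta> = 1" and \<xi>: "cmod \<xi> = 1"
begin

lemma state_admissible: "state \<zeta> \<xi> \<in> admissible N \<alpha> \<beta>"
  unfolding state_def admissible_iff
  using su.ground_state_H1[OF \<zeta>] sv.ground_state_H1[OF \<xi>] su.ground_state_mass[OF \<zeta>] sv.ground_state_mass[OF \<xi>] by blast

text \<open>The squared moduli of the two components have the constant ratio \<open>k / l\<close>,
  the equality case of the Young inequality, so nothing is lost in decoupling.\<close>

lemma state_energy: "energy N \<gamma> a b c (state \<zeta> \<xi>) = minimum"
proof -
  define f where "f = soliton k t su.x0 \<zeta>"
  \<comment> \<open>The shift depends only on \<open>\<gamma>\<close>, \<open>N\<close> and
    \<open>t\<close>, so both components use the same \<open>x0\<close>.\<close>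
  define g where "g = soliton l t su.x0 \<xi>"
  have sq: "(cmod (g x))\<^sup>2 = k / l * (cmod (f x))\<^sup>2" for x
    unfolding f_def g_def soliton_square[OF su.k su.t_pos su.x0(1) \<zeta>]
      soliton_square[OF sv.k su.t_pos su.x0(1) \<xi>]
    using su.k sv.k by simp
  have "int4 g = integral {0..} (\<lambda>x. (k / l)\<^sup>2 * cmod (f x) ^ 4)"
    unfolding int4_def
  proof (rule Henstock_Kurzweil_Integration.integral_cong)
    fix x
    have "cmod (g x) ^ 4 = ((cmod (g x))\<^sup>2)\<^sup>2" by simp
    also have "\<dots> = (k / l)\<^sup>2 * cmod (f x) ^ 4" unfolding sq power_mult_distrib by simp
    finally show "cmod (g x) ^ 4 = (k / l)\<^sup>2 * cmod (f x) ^ 4" .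
  qed
  then have g4: "int4 g = (k / l)\<^sup>2 * int4 f" by (simp add: int4_def)
  have "int22 f g = integral {0..} (\<lambda>x. k / l * cmod (f x) ^ 4)"
    unfolding int22_def
  proof (rule Henstock_Kurzweil_Integration.integral_cong)
    fix x
    have "(cmod (f x * g x))\<^sup>2 = (cmod (f x))\<^sup>2 * (cmod (g x))\<^sup>2"
      by (simp add: norm_mult power_mult_distrib)
    also have "\<dots> = k / l * cmod (f x) ^ 4" unfolding sq by (simp add: power4_eq_xxxx power2_eq_square)
    finally show "(cmod (f x * g x))\<^sup>2 = k / l * cmod (f x) ^ 4" .
  qed
  then have g22: "int22 f g = k / l * int4 f" by (simp add: int4_def)
  have z: "(k - a) / 2 * int4 f + (l - c) / 2 * int4 g - b * int22 f g = 0"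
    unfolding g4 g22 ka lc using su.k sv.k by (simp add: power2_eq_square)
  have gs: "sv.ground_state \<xi> e = g" "su.ground_state \<zeta> e = f" for e
    by (simp_all add: su.ground_state_def sv.ground_state_def f_def g_def)
  show ?thesis
    unfolding state_def energy_H1[OF su.ground_state_H1[OF \<zeta>] sv.ground_state_H1[OF \<xi>], of \<gamma> a b c k l]
    by (simp only: gs z su.ground_state_energy[OF \<zeta>] sv.ground_state_energy[OF \<xi>] minimum_def sum.neutral_const add_0_right)
qed

end

lemma J_eq: "J N \<gamma> a b c \<alpha> \<beta> = minimum"
  unfolding J_def
proof (rule cInf_eq_minimum)
  show "minimum \<in> energy N \<gamma> a b c ` admissible N \<alpha> \<beta>"
    using state_admissible[of 1 1] state_energy[of 1 1] by force
qed (auto intro: minimum_le)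

lemma state_ground: "cmod \<zeta> = 1 \<Longrightarrow> cmod \<xi> = 1 \<Longrightarrow> state \<zeta> \<xi> \<in> ground_states N \<gamma> a b c \<alpha> \<beta>"
  using state_admissible state_energy by (simp add: ground_states_def J_eq)

section \<open>Minimizing sequences of the coupled problem\<close>

context
  fixes w assumes w: "minimizing_seq N \<gamma> a b c \<alpha> \<beta> w"
begin

definition "u n = fst (w n)"
definition "v n = snd (w n)"

lemma w_eq: "w n = (u n, v n)"
  by (simp add: u_def v_def)

lemma uv:
  shows "u n \<in> H1_graph N" "v n \<in> H1_graph N" "(\<Sum>e=1..N. int2 (u n e)) = 2 * su.\<sigma> / k"
    "(\<Sum>e=1..N. int2 (v n e)) = 2 * sv.\<sigma> / l"
proof -
  have "(u n, v n) \<in> admissible N \<alpha> \<beta>"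
    using w unfolding minimizing_seq_def w_eq[symmetric] by blast
  then show "u n \<in> H1_graph N" "v n \<in> H1_graph N" "(\<Sum>e=1..N. int2 (u n e)) = 2 * su.\<sigma> / k"
    "(\<Sum>e=1..N. int2 (v n e)) = 2 * sv.\<sigma> / l"
    unfolding admissible_iff by blast+
qed

text \<open>The gap of the coupled energy is the sum of three nonnegative parts: the two scalar gaps
  and the loss in decoupling. Each tends to zero with the sum.\<close>

lemma scalar_minimizing:
  "(\<lambda>n. scalar_energy N \<gamma> k (u n)) \<longlonglongrightarrow> su.ground" "(\<lambda>n. scalar_energy N \<gamma> l (v n)) \<longlonglongrightarrow> sv.ground"
proof -
  have "(\<lambda>n. energy N \<gamma> a b c (w n)) \<longlonglongrightarrow> minimum"
    using w by (simp add: minimizing_seq_def J_eq)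
  then have lim: "(\<lambda>n. energy N \<gamma> a b c (w n) - minimum) \<longlonglongrightarrow> 0"
    by (rule LIM_zero)
  have ge1: "su.ground \<le> scalar_energy N \<gamma> k (u n)" for n
    by (rule su.ground_le[OF uv(1) uv(3)])
  have ge2: "sv.ground \<le> scalar_energy N \<gamma> l (v n)" for n
    by (rule sv.ground_le[OF uv(2) uv(4)])
  have ge3: "scalar_energy N \<gamma> k (u n) + scalar_energy N \<gamma> l (v n) \<le> energy N \<gamma> a b c (w n)" for n
    using decoupled_le[OF uv(1)[of n] uv(2)[of n]] by (simp only: w_eq)
  have "(\<lambda>n. scalar_energy N \<gamma> k (u n) - su.ground) \<longlonglongrightarrow> 0"
  proof (rule tendsto_sandwich[OF _ _ tendsto_const lim]; intro always_eventually allI)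
    fix n
    show "0 \<le> scalar_energy N \<gamma> k (u n) - su.ground"
      "scalar_energy N \<gamma> k (u n) - su.ground \<le> energy N \<gamma> a b c (w n) - minimum"
      using ge1[of n] ge2[of n] ge3[of n] unfolding minimum_def by linarith+
  qed
  then show "(\<lambda>n. scalar_energy N \<gamma> k (u n)) \<longlonglongrightarrow> su.ground"
    by (rule LIM_zero_cancel)
  have "(\<lambda>n. scalar_energy N \<gamma> l (v n) - sv.ground) \<longlonglongrightarrow> 0"
  proof (rule tendsto_sandwich[OF _ _ tendsto_const lim]; intro always_eventually allI)
    fix n
    show "0 \<le> scalar_energy N \<gamma> l (v n) - sv.ground"
      "scalar_energy N \<gamma> l (v n) - sv.ground \<le> energy N \<gamma> a b c (w n) - minimum"
      using ge1[of n] ge2[of n] ge3[of n] unfolding minimum_def by linarith+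
  qed
  then show "(\<lambda>n. scalar_energy N \<gamma> l (v n)) \<longlonglongrightarrow> sv.ground"
    by (rule LIM_zero_cancel)
qed

lemma phases:
  obtains \<zeta> \<xi> where "\<And>n. cmod (\<zeta> n) = 1" "\<And>n. cmod (\<xi> n) = 1"
    "(\<lambda>n. u n 1 0 - \<zeta> n * of_real su.peak) \<longlonglongrightarrow> 0" "(\<lambda>n. v n 1 0 - \<xi> n * of_real sv.peak) \<longlonglongrightarrow> 0"
proof -
  obtain \<zeta> where \<zeta>: "\<And>n. cmod (\<zeta> n) = 1" "(\<lambda>n. u n 1 0 - \<zeta> n * of_real su.peak) \<longlonglongrightarrow> 0"
    by (rule su.phases_exist[OF uv(1) uv(3) scalar_minimizing(1)]) blast
  obtain \<xi> where \<xi>: "\<And>n. cmod (\<xi> n) = 1" "(\<lambda>n. v n 1 0 - \<xi> n * of_real sv.peak) \<longlonglongrightarrow> 0"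
    by (rule sv.phases_exist[OF uv(2) uv(4) scalar_minimizing(2)]) blast
  show ?thesis by (rule that[OF \<zeta>(1) \<xi>(1) \<zeta>(2) \<xi>(2)])
qed

text \<open>Covers both conclusions: a subsequence \<open>r\<close> with constant phases, and the
  full sequence with moving phases.\<close>

lemma X_tendsto:
  assumes r: "strict_mono (r :: nat \<Rightarrow> nat)"
    and "\<And>n. cmod (\<zeta> n) = 1" "\<And>n. cmod (\<xi> n) = 1"
    and "(\<lambda>n. u (r n) 1 0 - \<zeta> n * of_real su.peak) \<longlonglongrightarrow> 0"
    and "(\<lambda>n. v (r n) 1 0 - \<xi> n * of_real sv.peak) \<longlonglongrightarrow> 0"
  shows "(\<lambda>n. X_norm N (w (r n) - state (\<zeta> n) (\<xi> n))) \<longlonglongrightarrow> 0"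
proof (rule X_norm_tendsto)
  have lim: "(\<lambda>n. scalar_energy N \<gamma> k (u (r n))) \<longlonglongrightarrow> su.ground"
      "(\<lambda>n. scalar_energy N \<gamma> l (v (r n))) \<longlonglongrightarrow> sv.ground"
    using scalar_minimizing[THEN LIMSEQ_subseq_LIMSEQ, OF r] by (simp_all add: o_def)
  show "(\<lambda>n. H1_norm N (fst (w (r n) - state (\<zeta> n) (\<xi> n)))) \<longlonglongrightarrow> 0"
    using su.H1_tendsto[OF uv(1) uv(3) lim(1) assms(2,4)] by (simp only: fst_diff state_def fst_conv u_def)
  show "(\<lambda>n. H1_norm N (snd (w (r n) - state (\<zeta> n) (\<xi> n)))) \<longlonglongrightarrow> 0"
    using sv.H1_tendsto[OF uv(2) uv(4) lim(2) assms(3,5)] by (simp only: snd_diff state_def snd_conv v_def)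
qed

lemma convergent_subsequence:
  "\<exists>r. \<exists>\<Phi>\<in>X_space N. strict_mono (r :: nat \<Rightarrow> nat) \<and> (\<lambda>n. X_norm N (w (r n) - \<Phi>)) \<longlonglongrightarrow> 0"
proof -
  obtain \<zeta> \<xi> where ph: "\<And>n. cmod (\<zeta> n) = 1" "\<And>n. cmod (\<xi> n) = 1"
    "(\<lambda>n. u n 1 0 - \<zeta> n * of_real su.peak) \<longlonglongrightarrow> 0" "(\<lambda>n. v n 1 0 - \<xi> n * of_real sv.peak) \<longlonglongrightarrow> 0"
    by (rule phases) blast
  obtain z r1 where z: "cmod z = 1" "strict_mono (r1 :: nat \<Rightarrow> nat)" "(\<zeta> \<circ> r1) \<longlonglongrightarrow> z"
    by (rule unit_circle_subsequence[of \<zeta>, OF ph(1)]) blast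
  \<comment> \<open>The second extraction is made along \<open>r1\<close>, so that both phases
    converge along the composition.\<close>
  obtain x r2 where x: "cmod x = 1" "strict_mono (r2 :: nat \<Rightarrow> nat)" "((\<xi> \<circ> r1) \<circ> r2) \<longlonglongrightarrow> x"
    by (rule unit_circle_subsequence[of "\<xi> \<circ> r1"]) (use ph(2) in auto)
  define r where "r = r1 \<circ> r2"
  have r: "strict_mono r" unfolding r_def by (rule strict_mono_o[OF z(2) x(2)])
  have z': "(\<lambda>n. \<zeta> (r n)) \<longlonglongrightarrow> z" "(\<lambda>n. \<xi> (r n)) \<longlonglongrightarrow> x"
    using LIMSEQ_subseq_LIMSEQ[OF z(3) x(2)] x(3) by (simp_all add: r_def o_def)
  \<comment> \<open>The moving phase is replaced by its limit in the vertex condition.\<close>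
  have "(\<lambda>n. (u (r n) 1 0 - \<zeta> (r n) * of_real su.peak) + (\<zeta> (r n) - z) * of_real su.peak)
      \<longlonglongrightarrow> 0 + (z - z) * of_real su.peak"
    by (intro tendsto_intros z' LIMSEQ_subseq_LIMSEQ[OF ph(3) r, unfolded o_def])
  then have 1: "(\<lambda>n. u (r n) 1 0 - z * of_real su.peak) \<longlonglongrightarrow> 0"
    by (simp add: left_diff_distrib)
  have "(\<lambda>n. (v (r n) 1 0 - \<xi> (r n) * of_real sv.peak) + (\<xi> (r n) - x) * of_real sv.peak)
      \<longlonglongrightarrow> 0 + (x - x) * of_real sv.peak"
    by (intro tendsto_intros z' LIMSEQ_subseq_LIMSEQ[OF ph(4) r, unfolded o_def])
  then have 2: "(\<lambda>n. v (r n) 1 0 - x * of_real sv.peak) \<longlonglongrightarrow> 0"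
    by (simp add: left_diff_distrib)
  have "(\<lambda>n. X_norm N (w (r n) - state z x)) \<longlonglongrightarrow> 0"
    by (rule X_tendsto[OF r z(1) x(1) 1 2])
  moreover have "state z x \<in> X_space N"
    using state_admissible[OF z(1) x(1)] by (simp add: admissible_def case_prod_unfold)
  ultimately show ?thesis using r by blast
qed

text \<open>The states with moving phases are ground states themselves, so the distance to one of
  them bounds the infimum along the full sequence.\<close>

lemma distance_tendsto:
  "(\<lambda>n. INF \<Phi>\<in>ground_states N \<gamma> a b c \<alpha> \<beta>. X_norm N (w n - \<Phi>)) \<longlonglongrightarrow> 0"
proof -
  obtain \<zeta> \<xi> where ph: "\<And>n. cmod (\<zeta> n) = 1" "\<And>n. cmod (\<xi> n) = 1"
    "(\<lambda>n. u n 1 0 - \<zeta> n * of_real su.peak) \<longlonglongrightarrow> 0" "(\<lambda>n. v n 1 0 - \<xi> n * of_real sv.peak) \<longlonglongrightarrow> 0"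
    by (rule phases) blast
  have lim: "(\<lambda>n. X_norm N (w n - state (\<zeta> n) (\<xi> n))) \<longlonglongrightarrow> 0"
    using X_tendsto[OF strict_mono_id, of \<zeta> \<xi>] ph by simp
  have nn: "0 \<le> X_norm N p" for p by (simp add: X_norm_def)
  show ?thesis
  proof (rule tendsto_sandwich[OF _ _ tendsto_const lim]; intro always_eventually allI)
    fix n
    show "0 \<le> (INF \<Phi>\<in>ground_states N \<gamma> a b c \<alpha> \<beta>. X_norm N (w n - \<Phi>))"
      using state_ground[of 1 1] by (intro cINF_greatest nn) auto
    show "(INF \<Phi>\<in>ground_states N \<gamma> a b c \<alpha> \<beta>. X_norm N (w n - \<Phi>)) \<le> X_norm N (w n - state (\<zeta> n) (\<xi> n))"
      by (intro cINF_lower state_ground ph) (auto intro!: bdd_belowI[of _ 0] nn)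
  qed
qed

end
end

theorem theorem2p2:
  fixes N :: nat and \<gamma> a b c \<omega> \<alpha> \<beta> :: real
  assumes "N \<ge> 2" and "\<gamma> > 0"
    and "(0 < b \<and> b < min a c) \<or> (a > 0 \<and> c > 0 \<and> b > max a c)"
    and "\<omega> > \<gamma>\<^sup>2 / (real N)\<^sup>2"
    and "real N * sqrt \<omega> - \<gamma> \<le> 2 * \<gamma> / real N"
    and "\<alpha> = 2 * (b - c) / (b\<^sup>2 - a * c) * (real N * sqrt \<omega> - \<gamma>)"
    and "\<beta> = 2 * (b - a) / (b\<^sup>2 - a * c) * (real N * sqrt \<omega> - \<gamma>)"
  shows "((\<forall>w. minimizing_seq N \<gamma> a b c \<alpha> \<beta> w \<longrightarrow>
             (\<exists>r. \<exists>\<Phi>\<in>X_space N. strict_mono (r :: nat \<Rightarrow> nat) \<and>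
                (\<lambda>k. X_norm N (w (r k) - \<Phi>)) \<longlonglongrightarrow> 0))
          \<and> (\<exists>\<Phi>\<in>admissible N \<alpha> \<beta>. \<forall>w\<in>admissible N \<alpha> \<beta>.
                energy N \<gamma> a b c \<Phi> \<le> energy N \<gamma> a b c w)
          \<and> ground_states N \<gamma> a b c \<alpha> \<beta> \<noteq> {})
       \<and> (\<forall>w. minimizing_seq N \<gamma> a b c \<alpha> \<beta> w \<longrightarrow>
             (\<lambda>n. INF \<Phi>\<in>ground_states N \<gamma> a b c \<alpha> \<beta>. X_norm N (w n - \<Phi>)) \<longlonglongrightarrow> 0)"
proof -
  define D where "D = b\<^sup>2 - a * c"
  \<comment> \<open>\<open>k\<close> and \<open>l\<close> are the reciprocals of the squared
    amplitudes in the soliton pair, so the given masses become \<open>2 * \<sigma> / k\<close> and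
    \<open>2 * \<sigma> / l\<close>.\<close>
  define k where "k = D / (b - c)"
  define l where "l = D / (b - a)"
  \<comment> \<open>Under either alternative \<open>D\<close>, \<open>b - c\<close> and
    \<open>b - a\<close> share one sign, which makes \<open>k\<close> and \<open>l\<close>
    positive.\<close>
  have signs: "0 < b" "(b < a \<and> b < c \<and> D < 0) \<or> (a < b \<and> c < b \<and> 0 < D)"
  proof -
    show "0 < b" using assms(3) by auto
    show "(b < a \<and> b < c \<and> D < 0) \<or> (a < b \<and> c < b \<and> 0 < D)"
      using assms(3)
    proof
      assume "0 < b \<and> b < min a c"
      then have "b < a" "b < c" "0 < b" by auto
      moreover from this have "b * b < a * c" by (intro mult_strict_mono) auto
      ultimately show ?thesis by (simp add: D_def power2_eq_square)
    next
      assume "a > 0 \<and> c > 0 \<and> b > max a c"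
      then have "a < b" "c < b" "0 < a" "0 < c" by auto
      moreover from this have "a * c < b * b" by (intro mult_strict_mono) auto
      ultimately show ?thesis by (simp add: D_def power2_eq_square)
    qed
  qed
  then have nz: "b - c \<noteq> 0" "b - a \<noteq> 0" "D \<noteq> 0" by auto
  have k: "k > 0" and l: "l > 0"
    using signs(2) by (auto simp: k_def l_def zero_less_divide_iff)
  have kl: "k / l = (b - a) / (b - c)" "l / k = (b - c) / (b - a)"
    using nz by (simp_all add: k_def l_def)
  have ka: "k - a = b * (k / l)" and lc: "l - c = b * (l / k)"
    unfolding kl using nz
    by (simp_all add: k_def l_def D_def power2_eq_square field_simps)
  have t: "\<gamma> / real N < sqrt \<omega>"
  proof (rule real_less_rsqrt)
    show "(\<gamma> / real N)\<^sup>2 < \<omega>" using assms(4) by (simp add: power_divide)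
  qed
  interpret C: coupled N \<gamma> "sqrt \<omega>" k l a b c
    by unfold_locales (use assms(1,2,5) t k l signs(1) ka lc in auto)
  have \<alpha>: "\<alpha> = C.\<alpha>" and \<beta>: "\<beta> = C.\<beta>"
    unfolding assms(6,7) C.\<alpha>_def C.\<beta>_def C.su.\<sigma>_def using nz by (simp_all add: k_def l_def D_def algebra_simps)
  have "\<exists>\<Phi>\<in>admissible N \<alpha> \<beta>. \<forall>w\<in>admissible N \<alpha> \<beta>. energy N \<gamma> a b c \<Phi> \<le> energy N \<gamma> a b c w"
    using C.state_admissible[of 1 1] C.state_energy[of 1 1] C.minimum_le unfolding \<alpha> \<beta> by force
  moreover have "ground_states N \<gamma> a b c \<alpha> \<beta> \<noteq> {}"
    using C.state_ground[of 1 1] unfolding \<alpha> \<beta> by auto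
  ultimately show ?thesis
    using C.convergent_subsequence C.distance_tendsto unfolding \<alpha> \<beta> by blast
qed

end
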